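(* Let $m\ge2$ be a fixed integer and let $p=p_n\in(0,1)$, $s=s_n\in[0,1]$ be the parameters of the Erdős–Rényi $m$-uniform hypergraph testing problem described in the context, with laws $P=P_n$ under $H_0$ and $Q=Q_n$ under $H_1$. As $n\to\infty$: (i) If $$s^2\ \ge\ \frac{n\log n}{\binom{n}{m}\left(\log\frac1p-1+p\right)p},$$ then $H_0$ and $H_1$ are distinguishable, i.e. $TV(P,Q)=1+o(1)$. (ii) Suppose $p$ is bounded away from one and $\log\frac1p=o(\log n)$. For any constant $\epsilon>0$, if $$s^2\ <\ \frac{(1-\epsilon)\,n\log n}{\binom{n}{m}\left(\log\frac1p-1+p\right)p},$$ then $H_0$ and $H_1$ are indistinguishable, i.e. $TV(P,Q)=o(1)$.
   Context: An $m$-uniform binary hypergraph on $[n]=\{1,\dots,n\}$ is encoded by a symmetric $m$-dimensional $\{0,1\}$-valued array $A$ with entries $A_{i_1\dots i_m}$, invariant under permutations of the indices and equal to $0$ whenever the indices are not all distinct; so it is determined by the entries with $1\le i_1<\dots<i_m\le n$. $P_n$ denotes the group of permutations of $[n]$ and $\pi\sim \mathrm{Unif}(P_n)$ means that $\pi$ is uniformly distributed on it. Erdős–Rényi testing problem. One observes a pair $(A_1,A_2)$ of such arrays. Under $H_0$, all the entries $A_{1,i_1\dots i_m}$ and $A_{2,i_1\dots i_m}$, $1\le i_1<\dots<i_m\le n$, are i.i.d. Bernoulli$(ps)$. Under $H_1$, there is a latent $\pi\sim\mathrm{Unif}(P_n)$ (not observed) such that, conditional on $\pi$, the pairs $(A_{1,i_1\dots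 i_m},A_{2,\pi_{i_1}\dots\pi_{i_m}})$, $1\le i_1<\dots<i_m\le n$, are i.i.d., with $A_{1,i_1\dots i_m}\sim$ Bernoulli$(ps)$ and, given $A_{1,i_1\dots i_m}$, $$A_{2,\pi_{i_1}\dots\pi_{i_m}}\sim \mathrm{Bernoulli}\left(sA_{1,i_1\dots i_m}+(1-A_{1,i_1\dots i_m})\frac{ps(1-s)}{1-ps}\right).$$ (Both marginals are Bernoulli$(ps)$; equivalently, both hypergraphs are obtained, up to the relabelling $\pi$, by keeping each hyperedge of one common Erdős–Rényi hypergraph of hyperedge probability $p$ independently with probability $s$.) $P$ and $Q$ denote the laws of $(A_1,A_2)$ under $H_0$ and $H_1$ respectively. The total variation distance is $TV(P,Q)=\sup_{E}|P(E)-Q(E)|$ over measurable events $E$. The parameters $p,s$ may depend on $n$, and all asymptotics are as $n\to\infty$ with $m$ fixed. *)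

theory Defs
  imports "HOL-Probability.Probability" "HOL-Library.Landau_Symbols"
begin

text \<open>
  A symmetric m-dimensional array on $[n]$ that vanishes whenever two indices coincide is
  represented by its values on the $m$-subsets of $[n]$: the entry with indices
  $i_1 < \dots < i_m$ is the value at the set $\{i_1,\dots,i_m\}$. Off these sets the value is
  fixed to be \<^const>\<open>False\<close>, so that arrays and such functions correspond bijectively.
\<close>

type_synonym hypergraph = "nat set \<Rightarrow> bool"

definition hyperedges :: "nat \<Rightarrow> nat \<Rightarrow> nat set set" where
  "hyperedges m n = {e. e \<subseteq> {1..n} \<and> card e = m}"

definition ER_null :: "nat \<Rightarrow> nat \<Rightarrow> real \<Rightarrow> real \<Rightarrow> (hypergraph \<times> hypergraph) pmf" where
  "ER_null m n p s =
     pair_pmf (Pi_pmf (hyperedges m n) False (\<lambda>_. bernoulli_pmf (p * s)))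
              (Pi_pmf (hyperedges m n) False (\<lambda>_. bernoulli_pmf (p * s)))"

definition ER_edge_pair :: "real \<Rightarrow> real \<Rightarrow> (bool \<times> bool) pmf" where
  "ER_edge_pair p s =
     do {
       a \<leftarrow> bernoulli_pmf (p * s);
       b \<leftarrow> bernoulli_pmf (s * of_bool a + (1 - of_bool a) * (p * s * (1 - s) / (1 - p * s)));
       return_pmf (a, b)
     }"

text \<open>
  Given the latent permutation \<open>\<pi>\<close>, the family \<open>X\<close> below is i.i.d. with
  \<open>X e = (A1 e, A2 (\<pi> ` e))\<close>; hence \<open>A2 e\<close> is the second component of \<open>X\<close> at the preimage of \<open>e\<close>.
\<close>

definition ER_alt_given :: "nat \<Rightarrow> nat \<Rightarrow> real \<Rightarrow> real \<Rightarrow> (nat \<Rightarrow> nat) \<Rightarrow> (hypergraph \<times> hypergraph) pmf"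
  where
  "ER_alt_given m n p s \<pi> =
     map_pmf (\<lambda>X. (\<lambda>e. fst (X e), \<lambda>e. snd (X (inv \<pi> ` e))))
       (Pi_pmf (hyperedges m n) (False, False) (\<lambda>_. ER_edge_pair p s))"

definition ER_alt :: "nat \<Rightarrow> nat \<Rightarrow> real \<Rightarrow> real \<Rightarrow> (hypergraph \<times> hypergraph) pmf" where
  "ER_alt m n p s = bind_pmf (pmf_of_set {\<pi>. \<pi> permutes {1..n}}) (ER_alt_given m n p s)"

definition TV :: "'a measure \<Rightarrow> 'a measure \<Rightarrow> real" where
  "TV M N = (SUP E\<in>sets M. \<bar>measure M E - measure N E\<bar>)"

definition ER_TV :: "nat \<Rightarrow> nat \<Rightarrow> real \<Rightarrow> real \<Rightarrow> real" where
  "ER_TV m n p s = TV (measure_pmf (ER_null m n p s)) (measure_pmf (ER_alt m n p s))"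

definition ER_threshold :: "nat \<Rightarrow> nat \<Rightarrow> real \<Rightarrow> real" where
  "ER_threshold m n p =
     real n * ln (real n) / (real (n choose m) * (ln (1 / p) - 1 + p) * p)"

end

theory Submission
  imports Defs "HOL-Combinatorics.Combinatorics" "HOL-Real_Asymp.Real_Asymp"
begin

text \<open>
  Detection: maximise the number of shared edges over all relabellings. Under \<open>H1\<close> the true
  relabelling yields a binomial number with mean \<open>\<mu> = (n choose m) p s\<^sup>2\<close>, while under \<open>H0\<close> each of the
  \<open>n!\<close> relabellings reaches \<open>\<mu>\<close> with probability at most \<open>exp (- \<mu> (ln (1 / p) - 1 + p))\<close>; the factor
  \<open>exp (- n)\<close> in \<open>n! \<approx> (n / e) ^ n\<close> pays for lowering the test level slightly below \<open>\<mu>\<close>.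

  Impossibility: a conditional second moment argument. The second moment of the likelihood ratio is
  an average over a uniform permutation \<open>\<sigma>\<close> of the sum of \<open>\<rho> ^ (2 |S|)\<close> over the \<open>\<sigma>\<close>-invariant edge
  sets \<open>S\<close>. Edges that are not spanned by the fixed points of \<open>\<sigma>\<close> matter only if \<open>\<sigma>\<close> has many short
  cycles, which is super-exponentially unlikely. Edges spanned by \<open>k\<close> fixed points make the plain
  second moment too large when \<open>k\<close> is nearly \<open>n\<close>; under \<open>H1\<close>, however, no \<open>k\<close>-set spans many more
  shared edges than expected, and truncating to this event lowers the contribution to about
  \<open>exp ((k choose m) p s\<^sup>2 (ln (1 / p) - 1 + p))\<close>, which is smaller than \<open>k!\<close> below the threshold.
\<close>

section \<open>Finitely supported distributions and total variation\<close>

text \<open>In the indistinguishable regime \<open>s^2 (n choose m)\<close> is eventually at most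
  \<open>n powr (1 + \<nu>)\<close> for small \<open>\<nu>\<close>. For \<open>m = 2\<close> the
  quantity \<open>\<rho>^4 (n choose m)\<close> may then still be a small power of \<open>n\<close>,
  while \<open>\<rho>^6 (n choose m)\<close> tends to 0. So for typical \<open>\<sigma>\<close> the
  edges of period 1 and 2 must be located inside the short cycles of \<open>\<sigma>\<close>, and
  only longer edge cycles can be absorbed wholesale. For the other \<open>\<sigma>\<close> a crude
  bound is enough if \<open>1 / fact u\<close> or \<open>1 / fact k\<close> beats it. The truncation
  may depend on \<open>\<pi>\<close> only, whereas the fixed points come from comparing
  \<open>\<pi>\<close> with a second relabelling. Hence it controls all vertex sets at once and must
  pay the entropy of choosing a \<open>k\<close>-set. Its slack
  \<open>(\<epsilon> / 4) k ln n / ln (1 / p)\<close> costs \<open>(\<epsilon> / 4) k ln n\<close>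
  in the second moment and outweighs the entropy because \<open>ln (1 / p) = o(ln n)\<close>.
  Keeping \<open>p\<close> away from 1 makes \<open>ln (1 / p)\<close> comparable to the rate
  \<open>ln (1 / p) - 1 + p\<close> and bounds the latter below, which forces \<open>s\<close> to 0
  and makes the higher-order terms in \<open>s\<close> negligible.\<close>

lemma expectation_pair_pmf_finite:
  fixes f :: "'a \<times> 'b \<Rightarrow> real"
  assumes "finite (set_pmf M)" "finite (set_pmf N)"
  shows "measure_pmf.expectation (pair_pmf M N) f =
    measure_pmf.expectation M (\<lambda>a. measure_pmf.expectation N (\<lambda>b. f (a, b)))"
proof -
  have "measure_pmf.expectation (pair_pmf M N) f =
      (\<Sum>x\<in>set_pmf M \<times> set_pmf N. f x * pmf (pair_pmf M N) x)"
    by (rule integral_measure_pmf_real) (use assms in auto)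
  also have "\<dots> = (\<Sum>a\<in>set_pmf M. (\<Sum>b\<in>set_pmf N. f (a, b) * pmf N b) * pmf M a)"
    by (simp add: sum.cartesian_product' pmf_pair sum_distrib_right sum_distrib_left mult_ac)
  also have "\<dots> = (\<Sum>a\<in>set_pmf M. measure_pmf.expectation N (\<lambda>b. f (a, b)) * pmf M a)"
    using assms by (intro sum.cong refl arg_cong2[where f="(*)"] integral_measure_pmf_real[symmetric]) auto
  also have "\<dots> = measure_pmf.expectation M (\<lambda>a. measure_pmf.expectation N (\<lambda>b. f (a, b)))"
    by (rule integral_measure_pmf_real[symmetric]) (use assms in auto)
  finally show ?thesis .
qed

lemma finite_set_Pi_pmf:
  assumes "finite A" "\<And>x. x \<in> A \<Longrightarrow> finite (set_pmf (p x))"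
  shows "finite (set_pmf (Pi_pmf A d p))"
  using assms by (simp add: set_Pi_pmf finite_PiE_dflt)

lemma expectation_prod_Pi_pmf_finite:
  fixes f :: "'a \<Rightarrow> 'b \<Rightarrow> real"
  assumes "finite A" "\<And>x. finite (set_pmf (p x))"
  shows "measure_pmf.expectation (Pi_pmf A d p) (\<lambda>y. \<Prod>x\<in>A. f x (y x)) =
    (\<Prod>x\<in>A. measure_pmf.expectation (p x) (f x))"
  using assms(1)
proof (induction A rule: finite_induct)
  case (insert x A)
  have *: "(\<Prod>z\<in>insert x A. f z ((g(x := a)) z)) = f x a * (\<Prod>z\<in>A. f z (g z))" for g a
  proof -
    have "(\<Prod>z\<in>A. f z ((g(x := a)) z)) = (\<Prod>z\<in>A. f z (g z))"
      using insert by (intro prod.cong) auto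
    with insert show ?thesis by simp
  qed
  have "measure_pmf.expectation (Pi_pmf (insert x A) d p) (\<lambda>y. \<Prod>z\<in>insert x A. f z (y z)) =
    measure_pmf.expectation (pair_pmf (p x) (Pi_pmf A d p)) (\<lambda>(a, g). f x a * (\<Prod>z\<in>A. f z (g z)))"
    by (subst Pi_pmf_insert[OF insert(1,2)]) (simp only: integral_map_pmf * case_prod_unfold)
  also have "\<dots> = (\<Prod>x\<in>insert x A. measure_pmf.expectation (p x) (f x))"
    using insert assms(2) by (subst expectation_pair_pmf_finite) (auto intro: finite_set_Pi_pmf)
  finally show ?case .
qed auto

lemma prob_eq_expectation_density:
  fixes P Q :: "'a pmf"
  assumes "finite (set_pmf P)" "\<And>x. pmf Q x = pmf P x * L x"
  shows "measure_pmf.prob Q S = measure_pmf.expectation P (\<lambda>x. L x * indicator S x)"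
proof -
  have sub: "set_pmf Q \<subseteq> set_pmf P"
    using assms(2) by (auto simp: set_pmf_eq)
  have "measure_pmf.prob Q S = measure_pmf.expectation Q (indicator S)" by simp
  also have "\<dots> = (\<Sum>x\<in>set_pmf P. indicator S x * pmf Q x)"
    by (rule integral_measure_pmf_real) (use assms sub in auto)
  also have "\<dots> = (\<Sum>x\<in>set_pmf P. (L x * indicator S x) * pmf P x)"
    by (simp add: assms(2) mult_ac)
  also have "\<dots> = measure_pmf.expectation P (\<lambda>x. L x * indicator S x)"
    by (rule integral_measure_pmf_real[symmetric]) (use assms in auto)
  finally show ?thesis .
qed

text \<open>
  Truncated second moment: with \<open>L\<close> the likelihood ratio and \<open>L'\<close> a truncation of it, the variance of
  \<open>L'\<close> controls the total variation distance up to the mass lost by truncating.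
\<close>

lemma TV_truncated_second_moment:
  fixes P Q :: "'a pmf" and L L' :: "'a \<Rightarrow> real"
  assumes fin: "finite (set_pmf P)" and dens: "\<And>x. pmf Q x = pmf P x * L x"
    and L': "\<And>x. 0 \<le> L' x" "\<And>x. L' x \<le> L x"
    and lost: "1 - measure_pmf.expectation P L' \<le> d"
    and var: "measure_pmf.expectation P (\<lambda>x. (L' x)\<^sup>2) \<le> 1 + v"
  shows "TV (measure_pmf P) (measure_pmf Q) \<le> d + sqrt (v + 2 * d)"
proof -
  note int = integrable_measure_pmf_finite[OF fin]
  let ?E = "measure_pmf.expectation P"
  have EL: "?E L = 1"
    using prob_eq_expectation_density[OF fin dens, of UNIV] by simp
  have sq: "?E (\<lambda>x. \<bar>1 - L' x\<bar>) \<le> sqrt (v + 2 * d)"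
  proof (rule real_le_rsqrt)
    \<comment> \<open>Nonnegativity of the variance serves as the Cauchy-Schwarz step; only the
      first two moments of \<open>L'\<close> then remain.\<close>
    have "(?E (\<lambda>x. \<bar>1 - L' x\<bar>))\<^sup>2 \<le> ?E (\<lambda>x. \<bar>1 - L' x\<bar>\<^sup>2)"
    proof -
      have "0 \<le> measure_pmf.variance P (\<lambda>x. \<bar>1 - L' x\<bar>)" by (rule measure_pmf.variance_positive)
      then show ?thesis by (subst (asm) measure_pmf.variance_eq) (auto intro: int)
    qed
    also have "\<dots> = ?E (\<lambda>x. 1 - 2 * L' x + (L' x)\<^sup>2)"
      by (simp add: power2_eq_square algebra_simps)
    also have "\<dots> = 1 - 2 * ?E L' + ?E (\<lambda>x. (L' x)\<^sup>2)"
      by (simp add: int)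
    also have "\<dots> \<le> v + 2 * d" using lost var by simp
    finally show "(?E (\<lambda>x. \<bar>1 - L' x\<bar>))\<^sup>2 \<le> v + 2 * d" .
  qed
  have "\<bar>measure_pmf.prob P S - measure_pmf.prob Q S\<bar> \<le> d + sqrt (v + 2 * d)" for S
  proof -
    have "measure_pmf.prob P S = ?E (\<lambda>x. indicator S x)" by simp
    then have "measure_pmf.prob P S - measure_pmf.prob Q S = ?E (\<lambda>x. indicator S x - L x * indicator S x)"
      by (simp add: prob_eq_expectation_density[OF fin dens] int)
    then have "\<bar>measure_pmf.prob P S - measure_pmf.prob Q S\<bar> \<le> ?E (\<lambda>x. \<bar>indicator S x - L x * indicator S x\<bar>)"
      by simp
    \<comment> \<open>\<open>1 - L\<close> is \<open>(1 - L') - (L - L')\<close>; the subtracted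
      part is nonnegative with mean at most \<open>d\<close>, so the truncated mass is paid once
      more.\<close>
    also have "\<dots> \<le> ?E (\<lambda>x. \<bar>1 - L' x\<bar> + (L x - L' x))"
      using L' by (intro integral_mono int) (auto simp: indicator_def add_increasing, smt (verit))
    also have "\<dots> = ?E (\<lambda>x. \<bar>1 - L' x\<bar>) + (1 - ?E L')"
      by (simp add: int EL)
    finally show ?thesis using sq lost by simp
  qed
  then show ?thesis unfolding TV_def by (intro cSUP_least) auto
qed

section \<open>Elementary bounds on the total variation distance\<close>

lemma TV_bdd:
  "bdd_above ((\<lambda>E. \<bar>measure_pmf.prob P E - measure_pmf.prob Q E\<bar>) ` sets (measure_pmf P))"
proof (rule bdd_aboveI)
  fix x assume "x \<in> (\<lambda>E. \<bar>measure_pmf.prob P E - measure_pmf.prob Q E\<bar>) ` sets (measure_pmf P)"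
  then obtain E where "x = \<bar>measure_pmf.prob P E - measure_pmf.prob Q E\<bar>" by auto
  moreover have "0 \<le> measure_pmf.prob P E" "measure_pmf.prob P E \<le> 1"
     "0 \<le> measure_pmf.prob Q E" "measure_pmf.prob Q E \<le> 1" by auto
  ultimately show "x \<le> 1" by linarith
qed

lemma TV_ge: "\<bar>measure_pmf.prob P S - measure_pmf.prob Q S\<bar> \<le> TV (measure_pmf P) (measure_pmf Q)"
  unfolding TV_def by (rule cSUP_upper[OF _ TV_bdd]) simp

lemma TV_nonneg: "0 \<le> TV (measure_pmf P) (measure_pmf Q)"
  using TV_ge[of P "{}" Q] by simp

lemma TV_le_1: "TV (measure_pmf P) (measure_pmf Q) \<le> 1"
  unfolding TV_def
proof (intro cSUP_least)
  fix E
  have "0 \<le> measure_pmf.prob P E" "measure_pmf.prob P E \<le> 1"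
     "0 \<le> measure_pmf.prob Q E" "measure_pmf.prob Q E \<le> 1" by auto
  then show "\<bar>measure_pmf.prob P E - measure_pmf.prob Q E\<bar> \<le> 1" by linarith
qed auto

section \<open>Likelihood ratios\<close>

lemma expectation_bool:
  fixes f :: "bool \<Rightarrow> real"
  shows "measure_pmf.expectation M f = f True * pmf M True + f False * pmf M False"
  by (subst integral_measure_pmf_real[of UNIV]) (auto simp: UNIV_bool)

lemma finite_hyperedges [simp, intro]: "finite (hyperedges m n)"
  by (rule finite_subset[of _ "Pow {1..n}"]) (auto simp: hyperedges_def)

lemma card_hyperedges [simp]: "card (hyperedges m n) = n choose m"
  unfolding hyperedges_def using n_subsets[of "{1..n}" m] by simp

lemma image_mem_hyperedges_iff:
  assumes "\<pi> permutes {1..n}"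
  shows "\<pi> ` e \<in> hyperedges m n \<longleftrightarrow> e \<in> hyperedges m n"
proof -
  have "inj \<pi>" using assms by (rule permutes_inj)
  moreover have "\<pi> ` e \<subseteq> {1..n} \<longleftrightarrow> e \<subseteq> {1..n}"
    using permutes_in_image[OF assms] by blast
  ultimately show ?thesis
    by (simp add: hyperedges_def card_image inj_on_subset)
qed

lemma bij_betw_image_hyperedges:
  assumes "\<pi> permutes {1..n}"
  shows "bij_betw ((`) \<pi>) (hyperedges m n) (hyperedges m n)"
  unfolding bij_betw_def
proof
  show "inj_on ((`) \<pi>) (hyperedges m n)"
    using permutes_inj[OF assms] by (auto simp: inj_on_def inj_image_eq_iff)
  show "(`) \<pi> ` hyperedges m n = hyperedges m n"
  proof (intro equalityI subsetI)
    fix e assume e: "e \<in> hyperedges m n"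
    have "e = \<pi> ` inv \<pi> ` e"
      using permutes_surj[OF assms] by (simp add: image_f_inv_f)
    with e show "e \<in> (`) \<pi> ` hyperedges m n"
      using image_mem_hyperedges_iff[OF assms] by (metis imageI)
  qed (use image_mem_hyperedges_iff[OF assms] in auto)
qed

text \<open>Density of \<open>ER_edge_pair\<close> against two independent bits. Both laws have the
  same Bernoulli margins with \<open>q = p s\<close>, so the density is 1 plus a multiple of
  \<open>(a - q) (b - q)\<close>. The coefficient is the correlation of a matched pair divided by
  the variance \<open>q (1 - q)\<close>, with a factor \<open>s\<close> cancelled so that it also
  makes sense for \<open>s = 0\<close>. The centred form makes mixed moments vanish.\<close>

definition ER_ratio :: "real \<Rightarrow> real \<Rightarrow> bool \<Rightarrow> bool \<Rightarrow> real" where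
  "ER_ratio p s a b = 1 + (1 - p) / (p * (1 - p * s)\<^sup>2) * (of_bool a - p * s) * (of_bool b - p * s)"

definition ER_likelihood ::
    "nat \<Rightarrow> nat \<Rightarrow> real \<Rightarrow> real \<Rightarrow> (nat \<Rightarrow> nat) \<Rightarrow> hypergraph \<times> hypergraph \<Rightarrow> real" where
  "ER_likelihood m n p s \<pi> = (\<lambda>(A1, A2). \<Prod>e\<in>hyperedges m n. ER_ratio p s (A1 e) (A2 (\<pi> ` e)))"

text \<open>The mean of \<open>f\<close> at two independent Bernoulli bits with parameter
  \<open>q\<close>, kept as a polynomial so that identities per edge become algebra.\<close>

definition edge_mean :: "real \<Rightarrow> (bool \<Rightarrow> bool \<Rightarrow> real) \<Rightarrow> real" where
  "edge_mean q f = q\<^sup>2 * f True True + q * (1 - q) * (f True False + f False True) + (1 - q)\<^sup>2 * f False False"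

lemma edge_mean_mult:
  "edge_mean q (\<lambda>a b. u a * v b) = (q * u True + (1 - q) * u False) * (q * v True + (1 - q) * v False)"
  unfolding edge_mean_def by (simp add: power2_eq_square algebra_simps)

text \<open>Under H0 the entries of the second hypergraph are i.i.d., so permuting them changes
  nothing. This removes \<open>\<pi>\<close> from single expectations and reduces a pair of
  relabellings to their quotient.\<close>

lemma expectation_ER_null_reindex:
  fixes F :: "hypergraph \<times> hypergraph \<Rightarrow> real"
  assumes "\<pi> permutes {1..n}"
  shows "measure_pmf.expectation (ER_null m n p s) (\<lambda>(A1, A2). F (A1, \<lambda>e. A2 (\<pi> ` e))) =
    measure_pmf.expectation (ER_null m n p s) F"
proof -
  let ?M = "Pi_pmf (hyperedges m n) False (\<lambda>_. bernoulli_pmf (p * s))"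
  have 1: "map_pmf (\<lambda>A e. A (\<pi> ` e)) ?M = ?M"
    by (subst Pi_pmf_bij_betw[OF finite_hyperedges bij_betw_image_hyperedges[OF assms],
          where dflt=False and f="bernoulli_pmf (p * s)"])
      (simp_all add: image_mem_hyperedges_iff[OF assms] o_def)
  have "ER_null m n p s = pair_pmf (map_pmf (\<lambda>A. A) ?M) (map_pmf (\<lambda>A e. A (\<pi> ` e)) ?M)"
    by (simp only: 1 ER_null_def map_pmf_ident)
  also have "\<dots> = map_pmf (\<lambda>(A1, A2). (A1, \<lambda>e. A2 (\<pi> ` e))) (ER_null m n p s)"
    by (simp only: map_pair[symmetric] ER_null_def)
  finally have 2: "ER_null m n p s = map_pmf (\<lambda>(A1, A2). (A1, \<lambda>e. A2 (\<pi> ` e))) (ER_null m n p s)" .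
  show ?thesis
    by (subst (2) 2) (simp add: case_prod_unfold)
qed

lemma finite_set_ER_null [simp, intro]: "finite (set_pmf (ER_null m n p s))"
proof -
  have "finite (set_pmf (bernoulli_pmf (p * s)))" by (rule finite_subset[OF _ finite]) auto
  then show ?thesis by (simp add: ER_null_def finite_set_Pi_pmf)
qed

locale ER_params =
  fixes p s :: real
  assumes p_pos: "0 < p" and p_less: "p < 1" and s_nonneg: "0 \<le> s" and s_le: "s \<le> 1"
begin

lemma ps_bounds: "0 \<le> p * s" "p * s \<le> p" "p * s < 1"
proof -
  show "0 \<le> p * s" "p * s \<le> p" using p_pos s_nonneg s_le by (auto simp: mult_left_le)
  then show "p * s < 1" using p_less by linarith
qed

lemma expectation_ER_null_prod:
  assumes "\<pi> permutes {1..n}"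
  shows "measure_pmf.expectation (ER_null m n p s) (\<lambda>(A1, A2). \<Prod>e\<in>hyperedges m n. f e (A1 e) (A2 (\<pi> ` e)))
    = (\<Prod>e\<in>hyperedges m n. edge_mean (p * s) (f e))"
proof -
  let ?B = "bernoulli_pmf (p * s)"
  let ?M = "Pi_pmf (hyperedges m n) False (\<lambda>_. ?B)"
  have fin: "finite (set_pmf ?B)" by (rule finite_subset[OF _ finite]) auto
  have finM: "finite (set_pmf ?M)" by (rule finite_set_Pi_pmf) (use fin in auto)
  have "measure_pmf.expectation (ER_null m n p s) (\<lambda>(A1, A2). \<Prod>e\<in>hyperedges m n. f e (A1 e) (A2 (\<pi> ` e)))
    = measure_pmf.expectation (ER_null m n p s) (\<lambda>(A1, A2). \<Prod>e\<in>hyperedges m n. f e (A1 e) (A2 e))"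
    by (rule expectation_ER_null_reindex[OF assms, where F="\<lambda>(A1, A2). \<Prod>e\<in>hyperedges m n. f e (A1 e) (A2 e)", simplified])
  also have "\<dots> = measure_pmf.expectation ?M (\<lambda>A1. measure_pmf.expectation ?M (\<lambda>A2.
      \<Prod>e\<in>hyperedges m n. f e (A1 e) (A2 e)))"
    unfolding ER_null_def by (subst expectation_pair_pmf_finite[OF finM finM]) simp
  also have "\<dots> = measure_pmf.expectation ?M (\<lambda>A1. \<Prod>e\<in>hyperedges m n. measure_pmf.expectation ?B (f e (A1 e)))"
    by (subst expectation_prod_Pi_pmf_finite[OF finite_hyperedges fin]) simp
  also have "\<dots> = (\<Prod>e\<in>hyperedges m n. measure_pmf.expectation ?B (\<lambda>a. measure_pmf.expectation ?B (f e a)))"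
    by (rule expectation_prod_Pi_pmf_finite[OF finite_hyperedges fin])
  also have "\<dots> = (\<Prod>e\<in>hyperedges m n. edge_mean (p * s) (f e))"
    using ps_bounds by (intro prod.cong refl) (simp add: edge_mean_def power2_eq_square algebra_simps)
  finally show ?thesis .
qed

lemma ER_ratio_values:
  "ER_ratio p s True True = 1 / p"
  "ER_ratio p s True False = (1 - s) / (1 - p * s)"
  "ER_ratio p s False True = (1 - s) / (1 - p * s)"
  "ER_ratio p s False False = (1 - 2 * p * s + p * s\<^sup>2) / (1 - p * s)\<^sup>2"
proof -
  have nz: "p \<noteq> 0" "1 - p * s \<noteq> 0" using p_pos ps_bounds by auto
  show "ER_ratio p s True True = 1 / p"
    using nz by (simp add: ER_ratio_def power2_eq_square) (simp add: divide_simps)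
  have "(1 - p) / (p * (1 - p * s)\<^sup>2) * (1 - p * s) * (- (p * s)) = - ((1 - p) * s) / (1 - p * s)"
    using nz by (simp add: divide_simps power2_eq_square)
  then have "1 + (1 - p) / (p * (1 - p * s)\<^sup>2) * (1 - p * s) * (- (p * s)) =
      ((1 - p * s) - (1 - p) * s) / (1 - p * s)"
    using nz by (simp add: diff_divide_distrib)
  also have "(1 - p * s) - (1 - p) * s = 1 - s"
    by (simp add: algebra_simps)
  finally show TF: "ER_ratio p s True False = (1 - s) / (1 - p * s)"
    unfolding ER_ratio_def by simp
  have "ER_ratio p s False True = ER_ratio p s True False"
    unfolding ER_ratio_def by (simp only: mult_ac)
  with TF show "ER_ratio p s False True = (1 - s) / (1 - p * s)" by simp
  have "(1 - p) / (p * (1 - p * s)\<^sup>2) * (- (p * s)) * (- (p * s)) = (1 - p) * p * s\<^sup>2 / (1 - p * s)\<^sup>2"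
    using nz by (simp add: divide_simps power2_eq_square)
  then have "1 + (1 - p) / (p * (1 - p * s)\<^sup>2) * (- (p * s)) * (- (p * s)) = ((1 - p * s)\<^sup>2 + (1 - p) * p * s\<^sup>2) / (1 - p * s)\<^sup>2"
    using nz by (simp add: add_divide_distrib)
  also have "(1 - p * s)\<^sup>2 + (1 - p) * p * s\<^sup>2 = 1 - 2 * p * s + p * s\<^sup>2"
    by (simp add: power2_eq_square algebra_simps)
  finally show "ER_ratio p s False False = (1 - 2 * p * s + p * s\<^sup>2) / (1 - p * s)\<^sup>2"
    by (simp add: ER_ratio_def)
qed

lemma ER_ratio_nonneg: "0 \<le> ER_ratio p s a b"
proof -
  have "1 - 2 * p * s + p * s\<^sup>2 = (1 - p * s)\<^sup>2 + p * s\<^sup>2 * (1 - p)"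
    by (simp add: power2_eq_square algebra_simps)
  then have "0 \<le> 1 - 2 * p * s + p * s\<^sup>2" using p_pos p_less by simp
  then show ?thesis
    using p_pos s_le ps_bounds by (cases a; cases b) (simp_all add: ER_ratio_values)
qed

lemma ER_likelihood_nonneg: "0 \<le> ER_likelihood m n p s \<pi> \<omega>"
  by (auto simp: ER_likelihood_def ER_ratio_nonneg prod_nonneg split: prod.split)

lemma pmf_ER_edge_pair:
  "pmf (ER_edge_pair p s) (a, b) =
    pmf (bernoulli_pmf (p * s)) a * pmf (bernoulli_pmf (p * s)) b * ER_ratio p s a b"
proof -
  have r: "0 < 1 - p * s" using ps_bounds by simp
  have "s * p * s \<le> p * s" using mult_right_mono[OF s_le, of "p * s"] ps_bounds by (simp add: mult_ac)
  \<comment> \<open>\<open>bernoulli_pmf\<close> clips parameters outside the unit interval;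
    \<open>le1\<close> and \<open>ge0\<close> ensure that the conditional probability in
    \<open>ER_edge_pair\<close> is taken at face value.\<close>
  have le1: "p * s * (1 - s) / (1 - p * s) \<le> 1"
  proof -
    have "p * s * (1 - s) \<le> p * s * (1 - p * s)"
      using ps_bounds s_nonneg p_less by (intro mult_left_mono) (auto intro: mult_left_le_one_le p_pos[THEN less_imp_le])
    also have "\<dots> \<le> 1 - p * s" using ps_bounds r by (intro mult_left_le_one_le) auto
    finally show ?thesis using r by simp
  qed
  have ge0: "0 \<le> p * s * (1 - s) / (1 - p * s)"
    using ps_bounds s_le r by simp
  have pm: "pmf (ER_edge_pair p s) (a, b) = pmf (bernoulli_pmf (p * s)) a *
     pmf (bernoulli_pmf (s * of_bool a + (1 - of_bool a) * (p * s * (1 - s) / (1 - p * s)))) b"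
    unfolding ER_edge_pair_def pmf_bind
    by (cases a; cases b) (auto simp: pmf_bind indicator_def pmf_return expectation_bool)
  show ?thesis
    unfolding pm using ps_bounds s_nonneg s_le p_pos le1 ge0 r
    by (cases a; cases b) (simp_all add: ER_ratio_values divide_simps power2_eq_square, (simp add: algebra_simps)?)
qed


lemma pmf_ER_alt_given:
  assumes "\<pi> permutes {1..n}"
  shows "pmf (ER_alt_given m n p s \<pi>) \<omega> = pmf (ER_null m n p s) \<omega> * ER_likelihood m n p s \<pi> \<omega>"
proof -
  obtain A1 A2 where \<omega>: "\<omega> = (A1, A2)" by (cases \<omega>)
  let ?E = "hyperedges m n" and ?B = "bernoulli_pmf (p * s)"
  let ?M = "Pi_pmf ?E (False, False) (\<lambda>_. ER_edge_pair p s)"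
  let ?g = "\<lambda>X. (\<lambda>e. fst (X e), \<lambda>e. snd (X (inv \<pi> ` e)))"
  let ?X = "\<lambda>e. (A1 e, A2 (\<pi> ` e))"
  note bij = permutes_inv_o[OF assms]
  have ii: "\<pi> ` inv \<pi> ` e = e" "inv \<pi> ` \<pi> ` e = e" for e
    using bij by (simp_all add: image_comp)
  \<comment> \<open>Injectivity identifies the mass of a pair with that of the one family
    \<open>X\<close> producing it, so no sum over preimages arises.\<close>
  have inj: "inj ?g"
  proof (rule injI)
    fix X Y assume eq: "?g X = ?g Y"
    show "X = Y"
    proof
      fix e
      have "fst (X e) = fst (Y e)" using eq by (simp add: fun_eq_iff)
      moreover have "snd (X e) = snd (Y e)"
      proof -
        from eq have "\<forall>e. snd (X (inv \<pi> ` e)) = snd (Y (inv \<pi> ` e))" by (simp add: fun_eq_iff)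
        then have "snd (X (inv \<pi> ` \<pi> ` e)) = snd (Y (inv \<pi> ` \<pi> ` e))" by blast
        then show ?thesis by (simp only: ii)
      qed
      ultimately show "X e = Y e" by (rule prod_eqI)
    qed
  qed
  have "?g ?X = \<omega>" by (simp add: \<omega> ii)
  with pmf_map_inj'[OF inj, of ?M ?X] have 1: "pmf (ER_alt_given m n p s \<pi>) \<omega> = pmf ?M ?X"
    unfolding ER_alt_given_def by (simp only:)
  have re: "(\<Prod>e\<in>?E. pmf ?B (A2 (\<pi> ` e))) = (\<Prod>e\<in>?E. pmf ?B (A2 e))"
    by (rule prod.reindex_bij_betw[OF bij_betw_image_hyperedges[OF assms]])
  have sup: "(\<forall>e. e \<notin> ?E \<longrightarrow> \<not> A2 (\<pi> ` e)) \<longleftrightarrow> (\<forall>e. e \<notin> ?E \<longrightarrow> \<not> A2 e)"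
    using image_mem_hyperedges_iff[OF assms] ii by metis
  show ?thesis
  \<comment> \<open>Off the hyperedges the product laws are frozen at their default values; a pair
    violating this has mass 0 on both sides.\<close>
  proof (cases "\<forall>e. e \<notin> ?E \<longrightarrow> \<not> A1 e \<and> \<not> A2 e")
    case True
    then have "\<forall>e. e \<notin> ?E \<longrightarrow> ?X e = (False, False)" using sup by blast
    then have "pmf ?M ?X = (\<Prod>e\<in>?E. pmf (ER_edge_pair p s) (?X e))"
      by (simp add: pmf_Pi)
    also have "\<dots> = (\<Prod>e\<in>?E. pmf ?B (A1 e)) * (\<Prod>e\<in>?E. pmf ?B (A2 e)) * ER_likelihood m n p s \<pi> \<omega>"
      by (simp add: pmf_ER_edge_pair prod.distrib re ER_likelihood_def \<omega>)
    finally have 2: "pmf ?M ?X = (\<Prod>e\<in>?E. pmf ?B (A1 e)) * (\<Prod>e\<in>?E. pmf ?B (A2 e)) * ER_likelihood m n p s \<pi> \<omega>" .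
    show ?thesis unfolding 1 2
      using True by (simp add: ER_null_def \<omega> pmf_pair pmf_Pi)
  next
    case False
    then have "pmf ?M ?X = 0" using sup by (subst pmf_Pi) auto
    moreover have "pmf (ER_null m n p s) \<omega> = 0"
      using False by (auto simp add: ER_null_def \<omega> pmf_pair pmf_Pi)
    ultimately show ?thesis by (simp add: 1)
  qed
qed

lemma prob_ER_alt_given:
  assumes "\<pi> permutes {1..n}"
  shows "measure_pmf.prob (ER_alt_given m n p s \<pi>) S =
    measure_pmf.expectation (ER_null m n p s) (\<lambda>\<omega>. ER_likelihood m n p s \<pi> \<omega> * indicator S \<omega>)"
  by (rule prob_eq_expectation_density) (auto simp: pmf_ER_alt_given[OF assms])

lemma pmf_ER_alt:
  "pmf (ER_alt m n p s) \<omega> = pmf (ER_null m n p s) \<omega> *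
     ((\<Sum>\<pi> | \<pi> permutes {1..n}. ER_likelihood m n p s \<pi> \<omega>) / fact n)"
proof -
  have fin: "finite {\<pi>. \<pi> permutes {1..n}}" by (simp add: finite_permutations)
  have "id permutes {1..n}" by (rule permutes_id)
  then have ne: "{\<pi>. \<pi> permutes {1..n}} \<noteq> {}" by blast
  show ?thesis
    unfolding ER_alt_def using fin ne
    by (simp add: pmf_bind_pmf_of_set card_permutations pmf_ER_alt_given sum_distrib_left)
qed

lemma prob_ER_alt:
  "measure_pmf.prob (ER_alt m n p s) S =
    (\<Sum>\<pi> | \<pi> permutes {1..n}. measure_pmf.prob (ER_alt_given m n p s \<pi>) S) / fact n"
proof -
  note int = integrable_measure_pmf_finite[OF finite_set_ER_null]
  have "measure_pmf.prob (ER_alt m n p s) S = measure_pmf.expectation (ER_null m n p s)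
    (\<lambda>\<omega>. ((\<Sum>\<pi> | \<pi> permutes {1..n}. ER_likelihood m n p s \<pi> \<omega>) / fact n) * indicator S \<omega>)"
    by (rule prob_eq_expectation_density) (auto simp: pmf_ER_alt)
  also have "\<dots> = measure_pmf.expectation (ER_null m n p s)
    (\<lambda>\<omega>. (\<Sum>\<pi> | \<pi> permutes {1..n}. ER_likelihood m n p s \<pi> \<omega> * indicator S \<omega>) / fact n)"
    by (simp add: sum_distrib_right)
  also have "\<dots> = (\<Sum>\<pi> | \<pi> permutes {1..n}. measure_pmf.expectation (ER_null m n p s)
    (\<lambda>\<omega>. ER_likelihood m n p s \<pi> \<omega> * indicator S \<omega>)) / fact n"
    by (simp add: int)
  finally show ?thesis by (simp add: prob_ER_alt_given)
qed

lemma edge_mean_ER_ratio: "edge_mean (p * s) (ER_ratio p s) = 1"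
proof -
  have "edge_mean q (\<lambda>a b. 1 + k * (of_bool a - q) * (of_bool b - q)) = 1" for q k
    by (simp add: edge_mean_def power2_eq_square algebra_simps)
  then show ?thesis unfolding ER_ratio_def[abs_def] .
qed

section \<open>Generating functions of the number of shared edges\<close>

lemma edge_mean_ratio:
  "edge_mean (p * s) (\<lambda>a b. ER_ratio p s a b * (if a \<and> b then c else 1)) = 1 + p * s\<^sup>2 * (c - 1)"
proof -
  let ?q = "p * s" and ?k = "(1 - p) / (p * (1 - p * s)\<^sup>2)"
  have "edge_mean ?q (\<lambda>a b. ER_ratio p s a b * (if a \<and> b then c else 1)) =
      edge_mean ?q (ER_ratio p s) + ?q\<^sup>2 * ER_ratio p s True True * (c - 1)"
    by (simp add: edge_mean_def algebra_simps)
  also have "edge_mean ?q (ER_ratio p s) = 1"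
    by (rule edge_mean_ER_ratio)
  also have "?q\<^sup>2 * ER_ratio p s True True * (c - 1) = p * s\<^sup>2 * (c - 1)"
    using p_pos by (simp add: ER_ratio_values power2_eq_square)
  finally show ?thesis .
qed

lemma power_card_common:
  assumes "W \<subseteq> hyperedges m n"
  shows "c ^ card {e\<in>W. A1 e \<and> A2 (\<pi> ` e)} =
    (\<Prod>e\<in>hyperedges m n. if e \<in> W \<and> A1 e \<and> A2 (\<pi> ` e) then c else 1 :: real)"
proof -
  have "(\<Prod>e\<in>hyperedges m n. if e \<in> W \<and> A1 e \<and> A2 (\<pi> ` e) then c else 1) =
     (\<Prod>e\<in>{e\<in>hyperedges m n. e \<in> W \<and> A1 e \<and> A2 (\<pi> ` e)}. c)"
    by (rule prod.inter_filter[symmetric]) simp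
  also have "{e\<in>hyperedges m n. e \<in> W \<and> A1 e \<and> A2 (\<pi> ` e)} = {e\<in>W. A1 e \<and> A2 (\<pi> ` e)}"
    using assms by auto
  finally show ?thesis by simp
qed

lemma prod_if_mem_const:
  assumes "W \<subseteq> A" "finite A"
  shows "(\<Prod>e\<in>A. if e \<in> W then c else 1 :: real) = c ^ card W"
  using assms by (simp flip: prod.inter_restrict add: Int_absorb1)

lemma ER_null_common_mgf:
  assumes "\<pi> permutes {1..n}" "W \<subseteq> hyperedges m n"
  shows "measure_pmf.expectation (ER_null m n p s) (\<lambda>(A1, A2). c ^ card {e\<in>W. A1 e \<and> A2 (\<pi> ` e)})
    = (1 + (p * s)\<^sup>2 * (c - 1)) ^ card W"
proof -
  have "measure_pmf.expectation (ER_null m n p s) (\<lambda>(A1, A2). c ^ card {e\<in>W. A1 e \<and> A2 (\<pi> ` e)})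
    = (\<Prod>e\<in>hyperedges m n. edge_mean (p * s) (\<lambda>a b. if e \<in> W \<and> a \<and> b then c else 1))"
    using expectation_ER_null_prod[OF assms(1), of m "\<lambda>e a b. if e \<in> W \<and> a \<and> b then c else 1"]
    by (simp only: power_card_common[OF assms(2)])
  also have "\<dots> = (\<Prod>e\<in>hyperedges m n. if e \<in> W then 1 + (p * s)\<^sup>2 * (c - 1) else 1)"
    by (intro prod.cong refl) (auto simp: edge_mean_def power2_eq_square algebra_simps)
  also have "\<dots> = (1 + (p * s)\<^sup>2 * (c - 1)) ^ card W"
    using assms(2) by (simp add: prod_if_mem_const)
  finally show ?thesis .
qed

text \<open>Weighting by the likelihood changes the measure to H1, where a matched pair consists of
  two ones with probability \<open>q^2 / p = p s^2\<close> instead of \<open>q^2\<close>, with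
  \<open>q = p s\<close>. The number of shared edges in \<open>W\<close> is binomial under either
  law.\<close>

lemma ER_alt_common_mgf:
  assumes "\<pi> permutes {1..n}" "W \<subseteq> hyperedges m n"
  shows "measure_pmf.expectation (ER_null m n p s)
      (\<lambda>\<omega>. ER_likelihood m n p s \<pi> \<omega> * (case \<omega> of (A1, A2) \<Rightarrow> c ^ card {e\<in>W. A1 e \<and> A2 (\<pi> ` e)}))
    = (1 + p * s\<^sup>2 * (c - 1)) ^ card W"
proof -
  let ?f = "\<lambda>e a b. ER_ratio p s a b * (if e \<in> W \<and> a \<and> b then c else 1)"
  have "measure_pmf.expectation (ER_null m n p s)
      (\<lambda>\<omega>. ER_likelihood m n p s \<pi> \<omega> * (case \<omega> of (A1, A2) \<Rightarrow> c ^ card {e\<in>W. A1 e \<and> A2 (\<pi> ` e)}))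
    = measure_pmf.expectation (ER_null m n p s)
      (\<lambda>(A1, A2). \<Prod>e\<in>hyperedges m n. ?f e (A1 e) (A2 (\<pi> ` e)))"
    by (simp only: power_card_common[OF assms(2)] ER_likelihood_def case_prod_unfold prod.distrib)
  also have "\<dots> = (\<Prod>e\<in>hyperedges m n. edge_mean (p * s) (?f e))"
    by (rule expectation_ER_null_prod[OF assms(1)])
  also have "\<dots> = (\<Prod>e\<in>hyperedges m n. if e \<in> W then 1 + p * s\<^sup>2 * (c - 1) else 1)"
  proof (intro prod.cong refl)
    fix e show "edge_mean (p * s) (?f e) = (if e \<in> W then 1 + p * s\<^sup>2 * (c - 1) else 1)"
      by (cases "e \<in> W") (simp_all add: edge_mean_ratio edge_mean_ER_ratio)
  qed
  also have "\<dots> = (1 + p * s\<^sup>2 * (c - 1)) ^ card W"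
    using assms(2) by (simp add: prod_if_mem_const)
  finally show ?thesis .
qed

text \<open>The correlation of a matched pair of entries under H1: covariance
  \<open>p s^2 (1 - p)\<close> over variance \<open>p s (1 - p s)\<close>.\<close>

definition \<rho> :: real where "\<rho> = (1 - p) * s / (1 - p * s)"

lemma \<rho>_bounds: "0 \<le> \<rho>" "\<rho> \<le> s" "\<rho> \<le> 1"
proof -
  show "0 \<le> \<rho>" using p_less s_nonneg ps_bounds by (simp add: \<rho>_def)
  have "(1 - p) * s \<le> (1 - p * s) * s" using ps_bounds s_nonneg by (intro mult_right_mono) auto
  then show "\<rho> \<le> s" using ps_bounds by (simp add: \<rho>_def divide_simps mult_ac)
  then show "\<rho> \<le> 1" using s_le by simp
qed

text \<open>
  Expanding both products of \<open>1 + c \<psi> \<psi>\<close> gives terms indexed by two sets \<open>S\<close>, \<open>T\<close> of edges; as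
  \<open>\<psi>\<close> is centred, a term has mean zero unless \<open>S = T\<close> and \<open>S = \<sigma> ` T\<close>.
\<close>

lemma expectation_likelihood_product:
  assumes \<sigma>: "\<sigma> permutes {1..n}" and E0: "E0 \<subseteq> hyperedges m n" "\<And>e. e \<in> E0 \<Longrightarrow> \<sigma> ` e = e"
  defines "E1 \<equiv> hyperedges m n - E0"
  shows "measure_pmf.expectation (ER_null m n p s) (\<lambda>(A1, A2).
      (\<Prod>e\<in>E0. h (A1 e) (A2 e)) * (\<Prod>e\<in>E1. ER_ratio p s (A1 e) (A2 e)) *
      (\<Prod>e\<in>E1. ER_ratio p s (A1 e) (A2 (\<sigma> ` e))))
    = edge_mean (p * s) h ^ card E0 * (\<Sum>S | S \<subseteq> E1 \<and> (`) \<sigma> ` S = S. (\<rho>\<^sup>2) ^ card S)"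
proof -
  let ?E = "hyperedges m n" and ?P = "ER_null m n p s"
  note int = integrable_measure_pmf_finite[OF finite_set_ER_null]
  define \<psi> :: "bool \<Rightarrow> real" where "\<psi> a = of_bool a - p * s" for a
  define c where "c = (1 - p) / (p * (1 - p * s)\<^sup>2)"
  define v where "v = p * s * (1 - p * s)"
  have r: "ER_ratio p s a b = 1 + c * \<psi> a * \<psi> b" for a b
    by (simp add: ER_ratio_def c_def \<psi>_def)
  have cv: "c * v = \<rho>"
    using p_pos ps_bounds by (simp add: c_def v_def \<rho>_def power2_eq_square)
  have fin1: "finite E1" by (simp add: E1_def)
  have finP: "finite (Pow E1)" using fin1 by simp
  have sig_E0: "\<sigma> ` e \<in> E0 \<longleftrightarrow> e \<in> E0" for e
  proof
    assume "\<sigma> ` e \<in> E0"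
    with E0(2) have "\<sigma> ` \<sigma> ` e = \<sigma> ` e" by simp
    then have "\<sigma> ` e = e" using permutes_inj[OF \<sigma>] by (simp add: inj_image_eq_iff)
    with \<open>\<sigma> ` e \<in> E0\<close> show "e \<in> E0" by simp
  qed (use E0(2) in simp)
  have sig_E1: "\<sigma> ` e \<in> E1 \<longleftrightarrow> e \<in> E1" for e
    using sig_E0[of e] image_mem_hyperedges_iff[OF \<sigma>] by (auto simp: E1_def)
  have injs: "inj_on ((`) \<sigma>) T" for T
    using permutes_inj[OF \<sigma>] by (auto simp: inj_on_def inj_image_eq_iff)
  have sub: "(`) \<sigma> ` T \<subseteq> E1" if "T \<subseteq> E1" for T using that sig_E1 by auto
  \<comment> \<open>\<open>F S T e\<close> collects what edge \<open>e\<close> contributes to the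
    term of \<open>S\<close> and \<open>T\<close>. The second ratio reads \<open>A2\<close> at the
    image of an edge and is booked there, hence the image of \<open>T\<close> in the last
    factor.\<close>
  define F where "F S T e a b = (if e \<in> E0 then h a b else 1) * (if e \<in> S then \<psi> a * \<psi> b else 1) *
      ((if e \<in> T then \<psi> a else 1) * (if e \<in> (`) \<sigma> ` T then \<psi> b else 1))" for S T e a b
  have expand: "(\<Prod>e\<in>E0. h (A1 e) (A2 e)) * (\<Prod>e\<in>E1. ER_ratio p s (A1 e) (A2 e)) *
      (\<Prod>e\<in>E1. ER_ratio p s (A1 e) (A2 (\<sigma> ` e))) =
      (\<Sum>S\<in>Pow E1. \<Sum>T\<in>Pow E1. c ^ card S * c ^ card T * (\<Prod>e\<in>?E. F S T e (A1 e) (A2 e)))" for A1 A2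
  proof -
    have pr: "(\<Prod>e\<in>E1. ER_ratio p s (a e) (b e)) = (\<Sum>S\<in>Pow E1. c ^ card S * (\<Prod>e\<in>S. \<psi> (a e) * \<psi> (b e)))" for a b
    proof -
      have "(\<Prod>e\<in>E1. ER_ratio p s (a e) (b e)) = (\<Prod>e\<in>E1. c * (\<psi> (a e) * \<psi> (b e)) + 1)"
        by (simp add: r mult_ac add_ac)
      also have "\<dots> = (\<Sum>S\<in>Pow E1. c ^ card S * (\<Prod>e\<in>S. \<psi> (a e) * \<psi> (b e)))"
        by (subst prod_add[OF fin1]) (simp only: prod.distrib prod_constant prod.neutral_const power_one mult_1_right)
      finally show ?thesis .
    qed
    have gen: "H * (\<Sum>S\<in>X. u S * x S) * (\<Sum>T\<in>X. u T * y T) =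
        (\<Sum>S\<in>X. \<Sum>T\<in>X. u S * u T * (H * (x S * y T)))"
      for H :: real and X :: "nat set set set" and u x y
      by (simp only: mult.assoc[of H] sum_product) (simp add: sum_distrib_left mult_ac)
    have tm: "(\<Prod>e\<in>E0. h (A1 e) (A2 e)) * ((\<Prod>e\<in>S. \<psi> (A1 e) * \<psi> (A2 e)) * (\<Prod>e\<in>T. \<psi> (A1 e) * \<psi> (A2 (\<sigma> ` e))))
       = (\<Prod>e\<in>?E. F S T e (A1 e) (A2 e))" if S: "S \<subseteq> E1" and T: "T \<subseteq> E1" for S T
    proof -
      have res: "(\<Prod>e\<in>?E. if e \<in> W then g e else 1) = (\<Prod>e\<in>W. g e)" if "W \<subseteq> ?E" for W and g :: "nat set \<Rightarrow> real"
        using that by (simp flip: prod.inter_restrict add: Int_absorb1)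
      have "(\<Prod>e\<in>T. \<psi> (A2 (\<sigma> ` e))) = (\<Prod>e\<in>(`) \<sigma> ` T. \<psi> (A2 e))"
        by (subst prod.reindex[OF injs]) simp
      moreover have "E0 \<subseteq> ?E" "S \<subseteq> ?E" "T \<subseteq> ?E" "(`) \<sigma> ` T \<subseteq> ?E"
        using E0 S T sub[OF T] by (auto simp: E1_def)
      ultimately show ?thesis
        by (simp add: F_def prod.distrib res)
    qed
    have "(\<Prod>e\<in>E0. h (A1 e) (A2 e)) * (\<Prod>e\<in>E1. ER_ratio p s (A1 e) (A2 e)) *
      (\<Prod>e\<in>E1. ER_ratio p s (A1 e) (A2 (\<sigma> ` e))) =
      (\<Sum>S\<in>Pow E1. \<Sum>T\<in>Pow E1. c ^ card S * c ^ card T * ((\<Prod>e\<in>E0. h (A1 e) (A2 e)) *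
         ((\<Prod>e\<in>S. \<psi> (A1 e) * \<psi> (A2 e)) * (\<Prod>e\<in>T. \<psi> (A1 e) * \<psi> (A2 (\<sigma> ` e))))))"
      unfolding pr by (rule gen)
    also have "\<dots> = (\<Sum>S\<in>Pow E1. \<Sum>T\<in>Pow E1. c ^ card S * c ^ card T * (\<Prod>e\<in>?E. F S T e (A1 e) (A2 e)))"
    proof (intro sum.cong refl)
      fix S T assume "S \<in> Pow E1" "T \<in> Pow E1"
      then show "c ^ card S * c ^ card T * ((\<Prod>e\<in>E0. h (A1 e) (A2 e)) *
         ((\<Prod>e\<in>S. \<psi> (A1 e) * \<psi> (A2 e)) * (\<Prod>e\<in>T. \<psi> (A1 e) * \<psi> (A2 (\<sigma> ` e))))) =
         c ^ card S * c ^ card T * (\<Prod>e\<in>?E. F S T e (A1 e) (A2 e))"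
        by (subst tm) auto
    qed
    finally show ?thesis .
  qed
  have mean: "(\<Prod>e\<in>?E. edge_mean (p * s) (F S T e)) =
      (if T = S \<and> (`) \<sigma> ` S = S then edge_mean (p * s) h ^ card E0 * v ^ card S * v ^ card S else 0)"
    if S: "S \<subseteq> E1" and T: "T \<subseteq> E1" for S T
  proof -
    have "(\<Prod>e\<in>?E. edge_mean (p * s) (F S T e)) =
        (\<Prod>e\<in>E0. edge_mean (p * s) (F S T e)) * (\<Prod>e\<in>E1. edge_mean (p * s) (F S T e))"
      using E0 by (simp add: E1_def prod.subset_diff[of E0 ?E] mult.commute)
    also have "(\<Prod>e\<in>E0. edge_mean (p * s) (F S T e)) = (\<Prod>e\<in>E0. edge_mean (p * s) h)"
    proof (intro prod.cong refl)
      fix e assume "e \<in> E0"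
      then have "e \<notin> E1" by (simp add: E1_def)
      then have "e \<notin> S" "e \<notin> T" "e \<notin> (`) \<sigma> ` T" using S T sub[OF T] by blast+
      with \<open>e \<in> E0\<close> have "F S T e = h" by (intro ext) (simp add: F_def)
      then show "edge_mean (p * s) (F S T e) = edge_mean (p * s) h" by simp
    qed
    also have "(\<Prod>e\<in>E1. edge_mean (p * s) (F S T e)) =
      (if T = S \<and> (`) \<sigma> ` S = S then v ^ card S * v ^ card S else 0)"
    proof -
      \<comment> \<open>Outside \<open>E0\<close> the mean factors into an \<open>a\<close> part and
        a \<open>b\<close> part. Each part is 0 if exactly one centred factor is present, 1 if none
        is, and the variance \<open>v\<close> if there are two.\<close>
      have em: "edge_mean (p * s) (F S T e) =
        (if (e \<in> T \<longleftrightarrow> e \<in> S) \<and> (e \<in> (`) \<sigma> ` T \<longleftrightarrow> e \<in> S) then (if e \<in> S then v * v else 1) else 0)"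
        if "e \<in> E1" for e
      proof -
        have "e \<notin> E0" using that by (simp add: E1_def)
        then have "F S T e = (\<lambda>a b. ((if e \<in> S then \<psi> a else 1) * (if e \<in> T then \<psi> a else 1)) *
            ((if e \<in> S then \<psi> b else 1) * (if e \<in> (`) \<sigma> ` T then \<psi> b else 1)))"
          by (intro ext) (simp add: F_def)
        moreover have "p * s * \<psi> True + (1 - p * s) * \<psi> False = 0"
          "p * s * (\<psi> True * \<psi> True) + (1 - p * s) * (\<psi> False * \<psi> False) = v"
          by (simp_all add: \<psi>_def v_def algebra_simps)
        ultimately show ?thesis
          by (simp add: edge_mean_mult del: image_eqI)
      qed
      show ?thesis
      proof (cases "T = S \<and> (`) \<sigma> ` S = S")
        case True
        then have "(\<Prod>e\<in>E1. edge_mean (p * s) (F S T e)) = (\<Prod>e\<in>E1. if e \<in> S then v * v else 1)"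
          using em by (intro prod.cong refl) simp
        also have "\<dots> = v ^ card S * v ^ card S"
          using S fin1 by (simp add: prod_if_mem_const power_mult_distrib)
        finally show ?thesis using True by simp
      next
        case False
        then have "T \<noteq> S \<or> (`) \<sigma> ` T \<noteq> S" by blast
        then have "\<exists>e\<in>E1. (e \<in> T) \<noteq> (e \<in> S) \<or> (e \<in> (`) \<sigma> ` T) \<noteq> (e \<in> S)"
          using S T sub[OF T] by blast
        then obtain e where "e \<in> E1" "\<not> ((e \<in> T \<longleftrightarrow> e \<in> S) \<and> (e \<in> (`) \<sigma> ` T \<longleftrightarrow> e \<in> S))"
          by (elim bexE) blast
        then have "\<exists>e\<in>E1. edge_mean (p * s) (F S T e) = 0" using em[of e] by (intro bexI[of _ e]) (simp only: if_False)
        then have "(\<Prod>e\<in>E1. edge_mean (p * s) (F S T e)) = 0" using fin1 by (simp add: prod_zero)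
        then show ?thesis by (simp only: if_not_P[OF False])
      qed
    qed
    finally show ?thesis
      by (simp only: prod_constant if_distrib[of "(*) _"] mult_zero_right mult.assoc)
  qed
  have "measure_pmf.expectation ?P (\<lambda>(A1, A2).
      (\<Prod>e\<in>E0. h (A1 e) (A2 e)) * (\<Prod>e\<in>E1. ER_ratio p s (A1 e) (A2 e)) *
      (\<Prod>e\<in>E1. ER_ratio p s (A1 e) (A2 (\<sigma> ` e)))) =
    measure_pmf.expectation ?P (\<lambda>\<omega>. \<Sum>S\<in>Pow E1. \<Sum>T\<in>Pow E1. c ^ card S * c ^ card T *
        (\<Prod>e\<in>?E. F S T e (fst \<omega> e) (snd \<omega> e)))"
    by (simp only: expand case_prod_unfold)
  also have "\<dots> = (\<Sum>S\<in>Pow E1. \<Sum>T\<in>Pow E1. c ^ card S * c ^ card T *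
        measure_pmf.expectation ?P (\<lambda>\<omega>. \<Prod>e\<in>?E. F S T e (fst \<omega> e) (snd \<omega> e)))"
    by (simp add: int)
  also have "\<dots> = (\<Sum>S\<in>Pow E1. \<Sum>T\<in>Pow E1. c ^ card S * c ^ card T * (\<Prod>e\<in>?E. edge_mean (p * s) (F S T e)))"
  proof -
    have "measure_pmf.expectation ?P (\<lambda>\<omega>. \<Prod>e\<in>?E. F S T e (fst \<omega> e) (snd \<omega> e)) =
       (\<Prod>e\<in>?E. edge_mean (p * s) (F S T e))" for S T
      using expectation_ER_null_prod[OF permutes_id, of m n "F S T"] by (simp add: case_prod_unfold)
    then show ?thesis by (simp only:)
  qed
  also have "\<dots> = (\<Sum>S\<in>Pow E1. \<Sum>T\<in>Pow E1. if T = S then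
      (if (`) \<sigma> ` S = S then edge_mean (p * s) h ^ card E0 * (\<rho>\<^sup>2) ^ card S else 0) else 0)"
  proof (intro sum.cong refl)
    fix S T assume ST: "S \<in> Pow E1" "T \<in> Pow E1"
    \<comment> \<open>Each edge of \<open>S\<close> yields \<open>c^2\<close> from the two ratios
      and \<open>v^2\<close> from the two hypergraphs, and \<open>c * v = \<rho>\<close>.\<close>
    have "c ^ card S * c ^ card S * (edge_mean (p * s) h ^ card E0 * v ^ card S * v ^ card S) =
        edge_mean (p * s) h ^ card E0 * (\<rho>\<^sup>2) ^ card S"
      by (simp add: cv[symmetric] power2_eq_square power_mult_distrib mult_ac)
    then show "c ^ card S * c ^ card T * (\<Prod>e\<in>?E. edge_mean (p * s) (F S T e)) = (if T = S then
      (if (`) \<sigma> ` S = S then edge_mean (p * s) h ^ card E0 * (\<rho>\<^sup>2) ^ card S else 0) else 0)"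
      using mean[of S T] ST by simp
  qed
  also have "\<dots> = (\<Sum>S\<in>Pow E1. if (`) \<sigma> ` S = S then edge_mean (p * s) h ^ card E0 * (\<rho>\<^sup>2) ^ card S else 0)"
    by (intro sum.cong refl) (simp add: sum.delta[OF finP])
  also have "\<dots> = (\<Sum>S\<in>{S\<in>Pow E1. (`) \<sigma> ` S = S}. edge_mean (p * s) h ^ card E0 * (\<rho>\<^sup>2) ^ card S)"
    by (rule sum.inter_filter[OF finP, symmetric])
  also have "\<dots> = edge_mean (p * s) h ^ card E0 * (\<Sum>S | S \<subseteq> E1 \<and> (`) \<sigma> ` S = S. (\<rho>\<^sup>2) ^ card S)"
    by (simp add: sum_distrib_left)
  finally show ?thesis .
qed

end

section \<open>Invariant sets and short cycles of permutations\<close>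

text \<open>Invariant sets are unions of orbits, so the sum is the product of
  \<open>1 + x ^ k\<close> over the orbits, \<open>k\<close> being their length, and
  \<open>1 + y \<le> exp y\<close>. Charging every point of an orbit with \<open>x\<close> or
  \<open>x ^ Suc d\<close> is more than needed, but lets the exponent be read off from points
  instead of orbits. The induction removes one orbit at a time.\<close>

lemma sum_invariant_subsets_le:
  fixes f :: "'a \<Rightarrow> 'a" and x :: real
  assumes "finite A" "inj f" "f ` A = A" and x: "0 \<le> x" "x \<le> 1"
  shows "(\<Sum>S | S \<subseteq> A \<and> f ` S = S. x ^ card S) \<le>
    exp (\<Sum>e\<in>A. if \<exists>j\<in>{1..d}. (f ^^ j) e = e then x else x ^ Suc d)"
  using assms(1,3)
proof (induction "card A" arbitrary: A rule: less_induct)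
  case less
  let ?w = "\<lambda>e. if \<exists>j\<in>{1..d}. (f ^^ j) e = e then x else x ^ Suc d"
  have fp: "(f ^^ a) ((f ^^ b) v) = (f ^^ (a + b)) v" for a b v
    by (simp add: funpow_add)
  show ?case
  proof (cases "A = {}")
    case True
    then have "{S. S \<subseteq> A \<and> f ` S = S} = {{}}" by auto
    then show ?thesis using True by simp
  next
    case False
    then obtain e where e: "e \<in> A" by auto
    have fA: "(f ^^ i) y \<in> A" if "y \<in> A" for i y
      by (induction i) (use that less.prems(2) in auto)
    have "finite {y. \<exists>n. y = (f ^^ n) e}"
      by (rule finite_subset[OF _ less.prems(1)]) (use fA e in auto)
    then obtain k0 where k0: "0 < k0 \<and> (f ^^ k0) e = e"
      using funpow_inj_finite[OF assms(2)] by metis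
    define k where "k = (LEAST k. 0 < k \<and> (f ^^ k) e = e)"
    have k: "0 < k" "(f ^^ k) e = e"
      using LeastI[where P="\<lambda>k. 0 < k \<and> (f ^^ k) e = e", OF k0] by (auto simp: k_def)
    have kmin: "\<not> (0 < i \<and> (f ^^ i) e = e)" if "i < k" for i
      using not_less_Least that unfolding k_def by blast
    define Ob where "Ob = (\<lambda>i. (f ^^ i) e) ` {..<k}"
    have memO: "(f ^^ i) e \<in> Ob" for i
    proof -
      have "(f ^^ i) e = (f ^^ (i mod k)) e" using funpow_mod_eq[OF k(2), of i] by simp
      moreover have "i mod k < k" using k(1) by simp
      ultimately show ?thesis unfolding Ob_def by blast
    qed
    have inj: "inj_on (\<lambda>i. (f ^^ i) e) {..<k}"
    proof (rule linorder_inj_onI)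
      fix a b assume ab: "a < b" "a \<in> {..<k}" "b \<in> {..<k}"
      show "(f ^^ a) e \<noteq> (f ^^ b) e"
      proof
        assume "(f ^^ a) e = (f ^^ b) e"
        then have "(f ^^ (b - a)) e = e" using ab by (intro funpow_diff[OF assms(2)]) auto
        then show False using kmin[of "b - a"] ab by (simp add: less_imp_diff_less)
      qed
    qed auto
    then have cO: "card Ob = k" by (simp add: Ob_def card_image)
    have finO: "finite Ob" by (simp add: Ob_def)
    have OA: "Ob \<subseteq> A" using fA e by (auto simp: Ob_def)
    have fO: "f ` Ob = Ob"
    proof (rule card_subset_eq[OF finO])
      show "f ` Ob \<subseteq> Ob"
      proof
        fix z assume "z \<in> f ` Ob"
        then obtain i where "z = (f ^^ Suc i) e" by (auto simp: Ob_def)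
        then show "z \<in> Ob" using memO[of "Suc i"] by simp
      qed
      show "card (f ` Ob) = card Ob" by (intro card_image inj_on_subset[OF assms(2)]) simp
    qed
    define B where "B = A - Ob"
    have fB: "f ` B = B" using assms(2) less.prems(2) fO by (simp add: B_def image_set_diff)
    have finB: "finite B" using less.prems by (simp add: B_def)
    have "e \<in> Ob" using memO[of 0] by simp
    with e less.prems(1) have "card B < card A" by (intro psubset_card_mono) (auto simp: B_def)
    then have IH: "(\<Sum>S | S \<subseteq> B \<and> f ` S = S. x ^ card S) \<le> exp (\<Sum>e\<in>B. ?w e)"
      by (rule less.hyps[OF _ finB fB])
    let ?I = "{S. S \<subseteq> B \<and> f ` S = S}"
    have finI: "finite ?I" by (rule finite_subset[of _ "Pow B"]) (use finB in auto)
    \<comment> \<open>An invariant set that meets the orbit contains it, so it is an invariant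
      subset of \<open>B\<close>, possibly with the whole orbit added. This gives the factor
      \<open>1 + x ^ k\<close>.\<close>
    have split: "{S. S \<subseteq> A \<and> f ` S = S} = ?I \<union> (\<lambda>S. S \<union> Ob) ` ?I"
    proof (intro equalityI subsetI)
      fix S assume "S \<in> {S. S \<subseteq> A \<and> f ` S = S}"
      then have S: "S \<subseteq> A" "f ` S = S" by auto
      have fS: "(f ^^ i) y \<in> S" if "y \<in> S" for i y
        by (induction i) (use that S(2) in auto)
      show "S \<in> ?I \<union> (\<lambda>S. S \<union> Ob) ` ?I"
      proof (cases "S \<inter> Ob = {}")
        case True
        with S show ?thesis by (auto simp: B_def)
      next
        case False
        then obtain i where i: "i < k" "(f ^^ i) e \<in> S" by (auto simp: Ob_def)
        have "(f ^^ (k - i)) ((f ^^ i) e) = e"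
          using i k by (simp add: fp)
        with fS[OF i(2), of "k - i"] have "e \<in> S" by simp
        then have "Ob \<subseteq> S" using fS by (auto simp: Ob_def)
        moreover have "f ` (S - Ob) = S - Ob"
          using assms(2) S(2) fO by (simp add: image_set_diff)
        ultimately have "S = (S - Ob) \<union> Ob" "S - Ob \<in> ?I" using S by (auto simp: B_def)
        then show ?thesis by blast
      qed
    next
      fix S assume "S \<in> ?I \<union> (\<lambda>S. S \<union> Ob) ` ?I"
      then show "S \<in> {S. S \<subseteq> A \<and> f ` S = S}"
        using OA fO by (auto simp: B_def image_Un)
    qed
    have disj: "?I \<inter> (\<lambda>S. S \<union> Ob) ` ?I = {}"
      using \<open>e \<in> Ob\<close> by (auto simp: B_def)
    have injU: "inj_on (\<lambda>S. S \<union> Ob) ?I"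
      by (rule inj_onI) (auto simp: B_def)
    have "(\<Sum>S | S \<subseteq> A \<and> f ` S = S. x ^ card S) =
        (\<Sum>S\<in>?I. x ^ card S) + (\<Sum>S\<in>?I. x ^ card (S \<union> Ob))"
      unfolding split using finI disj
      by (subst sum.union_disjoint) (auto simp: sum.reindex[OF injU])
    also have "(\<Sum>S\<in>?I. x ^ card (S \<union> Ob)) = x ^ k * (\<Sum>S\<in>?I. x ^ card S)"
      unfolding sum_distrib_left
    proof (intro sum.cong refl)
      fix S assume "S \<in> ?I"
      then have "S \<subseteq> B" by simp
      then have "card (S \<union> Ob) = card S + k"
        using finO finB finite_subset[of S B] by (subst card_Un_disjoint) (auto simp: B_def cO)
      then show "x ^ card (S \<union> Ob) = x ^ k * x ^ card S" by (simp add: power_add mult.commute)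
    qed
    also have "(\<Sum>S\<in>?I. x ^ card S) + x ^ k * (\<Sum>S\<in>?I. x ^ card S) = (1 + x ^ k) * (\<Sum>S\<in>?I. x ^ card S)"
      by (simp add: algebra_simps)
    also have "\<dots> \<le> exp (\<Sum>e\<in>Ob. ?w e) * exp (\<Sum>e\<in>B. ?w e)"
    proof (intro mult_mono IH)
      have "x ^ k \<le> (\<Sum>e\<in>Ob. ?w e)"
      proof (cases "k \<le> d")
        case True
        have "?w y = x" if y: "y \<in> Ob" for y
        proof -
          obtain i where "y = (f ^^ i) e" using y by (auto simp: Ob_def)
          then have "(f ^^ k) y = (f ^^ i) ((f ^^ k) e)"
            by (simp add: fp add.commute)
          then have "(f ^^ k) y = y" using k \<open>y = _\<close> by simp
          then show ?thesis using k True by (intro if_P bexI[of _ k]) auto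
        qed
        then have "(\<Sum>e\<in>Ob. ?w e) = k * x" by (simp add: cO)
        moreover have "x ^ k \<le> 1 * x" using k(1) x power_decreasing[of 1 k x] by simp
        moreover have "1 * x \<le> k * x" using k(1) x by (intro mult_right_mono) auto
        ultimately show ?thesis by linarith
      next
        case False
        have "k * x ^ Suc d = (\<Sum>e\<in>Ob. x ^ Suc d)" by (simp add: cO)
        also have "\<dots> \<le> (\<Sum>e\<in>Ob. ?w e)"
          using x power_decreasing[of 1 "Suc d" x] by (intro sum_mono) auto
        finally have "k * x ^ Suc d \<le> (\<Sum>e\<in>Ob. ?w e)" .
        moreover have "x ^ k \<le> 1 * x ^ Suc d" using False x power_decreasing[of "Suc d" k x] by simp
        moreover have "1 * x ^ Suc d \<le> k * x ^ Suc d" using k(1) x by (intro mult_right_mono) auto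
        ultimately show ?thesis by linarith
      qed
      then show "1 + x ^ k \<le> exp (\<Sum>e\<in>Ob. ?w e)"
        using exp_ge_add_one_self[of "\<Sum>e\<in>Ob. ?w e"] by linarith
    qed (use x in \<open>auto intro: sum_nonneg\<close>)
    also have "\<dots> = exp (\<Sum>e\<in>A. ?w e)"
      unfolding exp_add[symmetric] B_def using sum.subset_diff[OF OA less.prems(1), of ?w]
      by (simp only: add.commute)
    finally show ?thesis .
  qed
qed

section \<open>Permutations with many points on short cycles\<close>

definition cycle_points :: "('a \<Rightarrow> 'a) \<Rightarrow> 'a set \<Rightarrow> nat \<Rightarrow> 'a set" where
  "cycle_points \<sigma> A j = {v\<in>A. (\<sigma> ^^ j) v = v \<and> (\<forall>i\<in>{1..<j}. (\<sigma> ^^ i) v \<noteq> v)}"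

lemma cycle_representatives:
  fixes \<sigma> :: "nat \<Rightarrow> nat"
  assumes \<sigma>: "\<sigma> permutes A" and "finite A" "j \<ge> 1" and le: "j * u \<le> card (cycle_points \<sigma> A j)"
  obtains R where "R \<subseteq> cycle_points \<sigma> A j" "card R = u"
    "\<And>r i. r \<in> R \<Longrightarrow> i \<in> {1..<j} \<Longrightarrow> (\<sigma> ^^ i) r \<notin> R"
proof -
  have injf: "inj (\<sigma> ^^ i)" for i by (rule inj_fn[OF permutes_inj[OF \<sigma>]])
  have fp: "(\<sigma> ^^ a) ((\<sigma> ^^ b) v) = (\<sigma> ^^ (a + b)) v" for a b v
    by (simp add: funpow_add)
  have finA: "(\<sigma> ^^ i) v \<in> A" if "v \<in> A" for i v
    by (induction i) (use that permutes_in_image[OF \<sigma>] in auto)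
  let ?J = "cycle_points \<sigma> A j"
  \<comment> \<open>The least element of each \<open>j\<close>-cycle represents it. At most
    \<open>j\<close> steps from these minima reach every point of period \<open>j\<close>, so there
    are at least \<open>u\<close> of them.\<close>
  define M where "M = {v\<in>?J. \<forall>i. v \<le> (\<sigma> ^^ i) v}"
  have finM: "finite M" using assms(2) by (simp add: M_def cycle_points_def)
  have "?J \<subseteq> (\<lambda>(w, i). (\<sigma> ^^ i) w) ` (M \<times> {1..j})"
  proof
    fix v assume v: "v \<in> ?J"
    then have vj: "(\<sigma> ^^ j) v = v" "v \<in> A" by (auto simp: cycle_points_def)
    let ?S = "(\<lambda>i. (\<sigma> ^^ i) v) ` {..<j}"
    have all: "(\<sigma> ^^ i) v \<in> ?S" for i
    proof -
      have "(\<sigma> ^^ i) v = (\<sigma> ^^ (i mod j)) v" using funpow_mod_eq[OF vj(1), of i] by simp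
      moreover have "i mod j < j" using assms(3) by simp
      ultimately show ?thesis by blast
    qed
    have "?S \<noteq> {}" using assms(3) by (auto simp: lessThan_empty_iff)
    then have "Min ?S \<in> ?S" by (intro Min_in) auto
    then obtain i where i: "i < j" "Min ?S = (\<sigma> ^^ i) v" by auto
    define w where "w = (\<sigma> ^^ i) v"
    have "w \<le> (\<sigma> ^^ t) w" for t
      unfolding w_def i(2)[symmetric] unfolding i(2) fp using all[of "t + i"] by (subst i(2)[symmetric]) (intro Min_le, auto)
    moreover have "w \<in> ?J"
    proof -
      have "(\<sigma> ^^ j) w = w" using vj by (simp add: w_def fp add.commute[of j] flip: fp[of i j])
      moreover have "(\<sigma> ^^ t) w \<noteq> w" if "t \<in> {1..<j}" for t
      proof
        assume "(\<sigma> ^^ t) w = w"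
        then have "(\<sigma> ^^ i) ((\<sigma> ^^ t) v) = (\<sigma> ^^ i) v" by (simp add: w_def fp add.commute)
        then have "(\<sigma> ^^ t) v = v" using injf[of i] by (simp add: inj_eq)
        then show False using v that by (auto simp: cycle_points_def)
      qed
      moreover have "w \<in> A" using finA vj by (simp add: w_def)
      ultimately show ?thesis by (simp add: cycle_points_def)
    qed
    ultimately have "w \<in> M" by (simp add: M_def)
    \<comment> \<open>From the minimum back to \<open>v\<close>. If \<open>v\<close> is the minimum
      itself then \<open>i = 0\<close> and this is a full turn, hence the range
      \<open>{1..j}\<close>.\<close>
    moreover have "v = (\<sigma> ^^ (j - i)) w" using i vj by (simp add: w_def fp)
    moreover have "j - i \<in> {1..j}" using i by auto
    ultimately show "v \<in> (\<lambda>(w, i). (\<sigma> ^^ i) w) ` (M \<times> {1..j})" by force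
  qed
  then have "card ?J \<le> card M * j"
    using surj_card_le[of "M \<times> {1..j}" ?J "\<lambda>(w, i). (\<sigma> ^^ i) w"] finM by (simp add: card_cartesian_product)
  with le have "j * u \<le> j * card M" by (metis order.trans mult.commute)
  then have "u \<le> card M" using assms(3) by simp
  then obtain R where R: "R \<subseteq> M" "card R = u" using obtain_subset_with_card_n by metis
  show ?thesis
  proof
    show "R \<subseteq> ?J" "card R = u" using R by (auto simp: M_def)
    fix r i assume r: "r \<in> R" and i: "i \<in> {1..<j}"
    show "(\<sigma> ^^ i) r \<notin> R"
    proof
      assume "(\<sigma> ^^ i) r \<in> R"
      then have "(\<sigma> ^^ i) r \<le> (\<sigma> ^^ (j - i)) ((\<sigma> ^^ i) r)" using R by (auto simp: M_def)
      also have "\<dots> = r" using r R i by (auto simp: fp M_def cycle_points_def)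
      finally have "(\<sigma> ^^ i) r \<le> r" .
      moreover have "r \<le> (\<sigma> ^^ i) r" using r R by (auto simp: M_def)
      ultimately have "(\<sigma> ^^ i) r = r" by simp
      then show False using r R i by (auto simp: M_def cycle_points_def)
    qed
  qed
qed

lemma cycle_of_list_nth:
  assumes "distinct cs" "i < length cs"
  shows "cycle_of_list cs (cs ! i) = cs ! (Suc i mod length cs)"
proof -
  have "map (cycle_of_list cs) cs = rotate1 cs"
    using cyclic_rotation[of cs 1] assms by simp
  then have "cycle_of_list cs (cs ! i) = rotate1 cs ! i" using assms by (metis nth_map)
  then show ?thesis using nth_rotate1[OF assms(2)] by simp
qed

text \<open>
  Composing \<open>\<sigma>\<close> with a cyclic permutation of representatives of \<open>u\<close> of its \<open>j\<close>-cycles fuses these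
  into a single cycle. This loses no information: from one representative the others are found by
  steps of length \<open>j\<close>.
\<close>

lemma card_permutes_many_cycle_points:
  fixes A :: "nat set"
  assumes fin: "finite A" and j: "j \<ge> 1" and u: "u \<ge> 1"
  shows "card {\<sigma>. \<sigma> permutes A \<and> j * u \<le> card (cycle_points \<sigma> A j)} * fact u \<le> card A * fact (card A)"
proof -
  let ?B = "{\<sigma>. \<sigma> permutes A \<and> j * u \<le> card (cycle_points \<sigma> A j)}"
  have finB: "finite ?B" by (rule finite_subset[OF _ finite_permutations[OF fin]]) auto
  have "\<forall>\<sigma>\<in>?B. \<exists>R. R \<subseteq> cycle_points \<sigma> A j \<and> card R = u \<and> (\<forall>r\<in>R. \<forall>i\<in>{1..<j}. (\<sigma> ^^ i) r \<notin> R)"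
  proof
    fix \<sigma> assume "\<sigma> \<in> ?B"
    then have \<sigma>: "\<sigma> permutes A" "j * u \<le> card (cycle_points \<sigma> A j)" by auto
    show "\<exists>R. R \<subseteq> cycle_points \<sigma> A j \<and> card R = u \<and> (\<forall>r\<in>R. \<forall>i\<in>{1..<j}. (\<sigma> ^^ i) r \<notin> R)"
      by (rule cycle_representatives[OF \<sigma>(1) fin j \<sigma>(2)]) blast
  qed
  from bchoice[OF this] obtain R where R: "\<And>\<sigma>. \<sigma> \<in> ?B \<Longrightarrow> R \<sigma> \<subseteq> cycle_points \<sigma> A j \<and> card (R \<sigma>) = u \<and>
      (\<forall>r\<in>R \<sigma>. \<forall>i\<in>{1..<j}. (\<sigma> ^^ i) r \<notin> R \<sigma>)"
    by blast
  \<comment> \<open>The representatives are given an order as well, so each \<open>\<sigma>\<close>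
    has \<open>fact u\<close> companions in \<open>D\<close>, while the images under
    \<open>\<Phi>\<close> number at most \<open>card A * fact (card A)\<close>. The recorded head of
    the list tells where decoding starts.\<close>
  define D where "D = (SIGMA \<sigma>:?B. permutations_of_set (R \<sigma>))"
  define \<Phi> where "\<Phi> = (\<lambda>(\<sigma> :: nat \<Rightarrow> nat, rs). (\<sigma> \<circ> cycle_of_list rs, hd rs))"
  have finR: "finite (R \<sigma>)" if "\<sigma> \<in> ?B" for \<sigma>
    using R[OF that] u by (intro card_ge_0_finite) auto
  have rec: "rs ! i = (((\<sigma> \<circ> cycle_of_list rs) ^^ j) ^^ i) (hd rs)"
    if D: "(\<sigma>, rs) \<in> D" and i: "i < u" for \<sigma> rs i
  proof -
    have \<sigma>: "\<sigma> \<in> ?B" and rs: "set rs = R \<sigma>" "distinct rs"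
      using D by (auto simp: D_def permutations_of_set_def)
    have len: "length rs = u" using R[OF \<sigma>] rs by (metis distinct_card)
    let ?\<pi> = "\<sigma> \<circ> cycle_of_list rs"
    have step: "(?\<pi> ^^ j) (rs ! i) = rs ! (Suc i mod u)" if "i < u" for i
    proof -
      let ?r = "rs ! (Suc i mod u)"
      have rR: "?r \<in> R \<sigma>" using rs(1) len u by (metis mod_less_divisor nth_mem less_le_trans zero_less_one)
      \<comment> \<open>The first step jumps onto the \<open>\<sigma>\<close>-cycle of the next
        representative; no representative is met again before that cycle closes, so the walk follows
        \<open>\<sigma>\<close> from there.\<close>
      have "(?\<pi> ^^ t) (rs ! i) = (\<sigma> ^^ t) ?r" if "1 \<le> t" "t \<le> j" for t
        using that
      proof (induction t rule: dec_induct)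
        case base
        show ?case using cycle_of_list_nth[OF rs(2), of i] \<open>i < u\<close> len by simp
      next
        case (step t)
        have "(\<sigma> ^^ t) ?r \<notin> set rs" using R[OF \<sigma>] rR step rs by auto
        then have "cycle_of_list rs ((\<sigma> ^^ t) ?r) = (\<sigma> ^^ t) ?r"
          using cycle_permutes[of rs] by (simp add: permutes_def)
        then show ?case using step by simp
      qed
      then have "(?\<pi> ^^ j) (rs ! i) = (\<sigma> ^^ j) ?r" using j by simp
      also have "\<dots> = ?r" using R[OF \<sigma>] rR by (auto simp: cycle_points_def)
      finally show ?thesis .
    qed
    show ?thesis using i
    proof (induction i)
      case 0
      then show ?case using len by (cases rs) auto
    next
      case (Suc i)
      then show ?case using step[of i] by (simp add: o_def)
    qed
  qed
  have "inj_on \<Phi> D"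
  proof (rule inj_onI, clarify)
    fix \<sigma> rs \<sigma>' rs'
    assume D: "(\<sigma>, rs) \<in> D" "(\<sigma>', rs') \<in> D" and eq: "\<Phi> (\<sigma>, rs) = \<Phi> (\<sigma>', rs')"
    have len: "length rs = u" "length rs' = u"
      using D R by (auto simp: D_def permutations_of_set_def dest!: distinct_card)
    have e1: "\<sigma> \<circ> cycle_of_list rs = \<sigma>' \<circ> cycle_of_list rs'" and e2: "hd rs = hd rs'"
      using eq by (auto simp: \<Phi>_def)
    have rr: "rs = rs'"
      using rec[OF D(1)] rec[OF D(2)] e1 e2 by (intro nth_equalityI) (simp_all add: len)
    have "surj (cycle_of_list rs)" using cycle_permutes[of rs] by (rule permutes_surj)
    have "\<sigma> x = \<sigma>' x" for x
    proof -
      obtain y where "x = cycle_of_list rs y" using \<open>surj _\<close> by (rule surjE)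
      then show ?thesis using fun_cong[OF e1, of y] rr by simp
    qed
    then have "\<sigma> = \<sigma>'" by blast
    then show "\<sigma> = \<sigma>' \<and> rs = rs'" using rr by simp
  qed
  moreover have "\<Phi> ` D \<subseteq> {\<pi>. \<pi> permutes A} \<times> A"
  proof (rule subrelI)
    fix \<pi> h assume "(\<pi>, h) \<in> \<Phi> ` D"
    then obtain \<sigma> rs where D: "(\<sigma>, rs) \<in> D" and *: "\<pi> = \<sigma> \<circ> cycle_of_list rs" "h = hd rs"
      by (auto simp: \<Phi>_def)
    then have \<sigma>: "\<sigma> \<in> ?B" and rs: "set rs = R \<sigma>" by (auto simp: D_def permutations_of_set_def)
    have sub: "R \<sigma> \<subseteq> A" using R[OF \<sigma>] by (auto simp: cycle_points_def)
    have "rs \<noteq> []" using R[OF \<sigma>] rs u by auto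
    then have "h \<in> A" using rs sub * by auto
    moreover have "\<pi> permutes A"
      unfolding * using \<sigma> cycle_permutes[of rs] permutes_subset[of "cycle_of_list rs" "set rs" A] rs sub
      by (intro permutes_compose) auto
    ultimately show "(\<pi>, h) \<in> {\<pi>. \<pi> permutes A} \<times> A" by simp
  qed
  ultimately have "card D \<le> card ({\<pi>. \<pi> permutes A} \<times> A)"
    by (intro card_inj_on_le) (use fin in \<open>auto simp: finite_permutations\<close>)
  also have "\<dots> = card A * fact (card A)"
    using fin by (simp add: card_cartesian_product card_permutations)
  also have "card D = (\<Sum>\<sigma>\<in>?B. fact u)"
    unfolding D_def using finB finR R by (subst card_SigmaI) (auto intro!: sum.cong)
  finally show ?thesis by simp
qed

definition short_cycle_points :: "nat \<Rightarrow> ('a \<Rightarrow> 'a) \<Rightarrow> 'a set \<Rightarrow> 'a set" where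
  "short_cycle_points d \<sigma> A = {v\<in>A. \<exists>j\<in>{1..d}. (\<sigma> ^^ j) v = v}"

text \<open>Pigeonhole over the cycle lengths: some length \<open>j\<close> accounts for at least
  \<open>d * u \<ge> j * u\<close> of the points. The union over \<open>j\<close> costs the factor
  \<open>d\<close>.\<close>

lemma card_permutes_many_short_cycle_points:
  fixes A :: "nat set"
  assumes fin: "finite A" and d: "d \<ge> 1" and u: "u \<ge> 1"
  shows "card {\<sigma>. \<sigma> permutes A \<and> d * (d * u) \<le> card (short_cycle_points d \<sigma> A)} * fact u
    \<le> d * (card A * fact (card A))"
proof -
  let ?C = "\<lambda>j. {\<sigma>. \<sigma> permutes A \<and> j * u \<le> card (cycle_points \<sigma> A j)}"
  have finC: "finite (?C j)" for j by (rule finite_subset[OF _ finite_permutations[OF fin]]) auto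
  have "{\<sigma>. \<sigma> permutes A \<and> d * (d * u) \<le> card (short_cycle_points d \<sigma> A)} \<subseteq> (\<Union>j\<in>{1..d}. ?C j)"
  proof clarify
    fix \<sigma> assume \<sigma>: "\<sigma> permutes A" and le: "d * (d * u) \<le> card (short_cycle_points d \<sigma> A)"
    have "short_cycle_points d \<sigma> A \<subseteq> (\<Union>j\<in>{1..d}. cycle_points \<sigma> A j)"
    proof
      fix v assume "v \<in> short_cycle_points d \<sigma> A"
      then obtain j where j: "v \<in> A" "1 \<le> j \<and> (\<sigma> ^^ j) v = v" "j \<le> d"
        by (auto simp: short_cycle_points_def)
      define i where "i = (LEAST i. 1 \<le> i \<and> (\<sigma> ^^ i) v = v)"
      have i: "1 \<le> i \<and> (\<sigma> ^^ i) v = v" unfolding i_def by (rule LeastI[of _ j]) (rule j(2))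
      have "i \<le> j" unfolding i_def by (rule Least_le) (rule j(2))
      moreover have "(\<sigma> ^^ t) v \<noteq> v" if "t \<in> {1..<i}" for t
        using not_less_Least[of t "\<lambda>i. 1 \<le> i \<and> (\<sigma> ^^ i) v = v"] that by (auto simp: i_def)
      ultimately have "v \<in> cycle_points \<sigma> A i" "i \<in> {1..d}"
        using i j by (auto simp: cycle_points_def)
      then show "v \<in> (\<Union>j\<in>{1..d}. cycle_points \<sigma> A j)" by blast
    qed
    then have "card (short_cycle_points d \<sigma> A) \<le> card (\<Union>j\<in>{1..d}. cycle_points \<sigma> A j)"
      by (intro card_mono) (auto simp: cycle_points_def fin)
    also have "\<dots> \<le> (\<Sum>j\<in>{1..d}. card (cycle_points \<sigma> A j))" by (rule card_UN_le) simp
    finally have sum: "d * (d * u) \<le> (\<Sum>j\<in>{1..d}. card (cycle_points \<sigma> A j))" using le by simp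
    have "\<exists>j\<in>{1..d}. j * u \<le> card (cycle_points \<sigma> A j)"
    proof (rule ccontr)
      assume "\<not> ?thesis"
      then have "(\<Sum>j\<in>{1..d}. card (cycle_points \<sigma> A j)) < (\<Sum>j\<in>{1..d}. d * u)"
      proof (intro sum_strict_mono)
        fix j assume j: "j \<in> {1..d}"
        with \<open>\<not> _\<close> have "card (cycle_points \<sigma> A j) < j * u" by (auto simp: not_le)
        also have "\<dots> \<le> d * u" using j by (intro mult_right_mono) auto
        finally show "card (cycle_points \<sigma> A j) < d * u" .
      qed (use d in auto)
      then show False using sum by simp
    qed
    then show "\<sigma> \<in> (\<Union>j\<in>{1..d}. ?C j)" using \<sigma> by blast
  qed
  then have "card {\<sigma>. \<sigma> permutes A \<and> d * (d * u) \<le> card (short_cycle_points d \<sigma> A)} \<le> card (\<Union>j\<in>{1..d}. ?C j)"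
    by (intro card_mono) (use finC in auto)
  also have "\<dots> \<le> (\<Sum>j\<in>{1..d}. card (?C j))" by (rule card_UN_le) simp
  finally have "card {\<sigma>. \<sigma> permutes A \<and> d * (d * u) \<le> card (short_cycle_points d \<sigma> A)} * fact u
     \<le> (\<Sum>j\<in>{1..d}. card (?C j)) * fact u" by (rule mult_right_mono) simp
  also have "\<dots> = (\<Sum>j\<in>{1..d}. card (?C j) * fact u)" by (rule sum_distrib_right)
  also have "\<dots> \<le> (\<Sum>j\<in>{1..d}. card A * fact (card A))"
    using card_permutes_many_cycle_points[OF fin _ u] by (intro sum_mono) simp
  finally show ?thesis by simp
qed

section \<open>Fixed points and fixed edges of a permutation\<close>

definition fixed_points :: "nat \<Rightarrow> (nat \<Rightarrow> nat) \<Rightarrow> nat set" where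
  "fixed_points n \<sigma> = {v\<in>{1..n}. \<sigma> v = v}"

lemma fixed_points_subset: "fixed_points n \<sigma> \<subseteq> {1..n}" "finite (fixed_points n \<sigma>)" "card (fixed_points n \<sigma>) \<le> n"
proof -
  show 1: "fixed_points n \<sigma> \<subseteq> {1..n}" by (auto simp: fixed_points_def)
  then show "finite (fixed_points n \<sigma>)" by (rule finite_subset) simp
  show "card (fixed_points n \<sigma>) \<le> n" using card_mono[OF _ 1] by simp
qed

text \<open>The case of cycle length 1. As a probability this is \<open>n / fact u\<close>, weaker
  than the first-moment bound \<open>1 / fact u\<close> by a factor \<open>n\<close>, which
  exponential gains absorb.\<close>

lemma card_permutes_many_fixed_points:
  assumes u: "u \<ge> 1"
  shows "card {\<sigma>. \<sigma> permutes {1..n} \<and> u \<le> card (fixed_points n \<sigma>)} * fact u \<le> n * fact n"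
  using card_permutes_many_cycle_points[of "{1..n}" 1 u] u by (simp add: cycle_points_def fixed_points_def)

lemma card_subsets_of_card:
  assumes "finite V"
  shows "card {e\<in>hyperedges m n. e \<subseteq> V} \<le> card V choose m"
proof -
  have "card {e\<in>hyperedges m n. e \<subseteq> V} \<le> card {e. e \<subseteq> V \<and> card e = m}"
    by (rule card_mono) (use assms in \<open>auto simp: hyperedges_def intro!: finite_subset[of _ "Pow V"]\<close>)
  then show ?thesis by (simp add: n_subsets[OF assms])
qed

lemma funpow_image:
  fixes f :: "'a \<Rightarrow> 'a"
  shows "((`) f ^^ j) S = (f ^^ j) ` S"
  by (induction j) (simp_all add: image_comp)

text \<open>The map \<open>\<sigma> ^^ j\<close> keeps \<open>v\<close> inside \<open>e\<close>,
  which has \<open>m\<close> points, so two of its iterates number 0 to \<open>m\<close> coincide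
  and \<open>v\<close> has a period of at most \<open>j * m\<close>. This translates periods of
  edges into periods of vertices, for which permutations can be counted.\<close>

lemma periodic_edge_subset_short_cycle_points:
  assumes \<sigma>: "\<sigma> permutes {1..n}" and e: "e \<in> hyperedges m n" and j: "j \<in> {1..2}" "((`) \<sigma> ^^ j) e = e"
  shows "e \<subseteq> short_cycle_points (2 * m) \<sigma> {1..n}"
proof
  fix v assume v: "v \<in> e"
  have e': "e \<subseteq> {1..n}" "card e = m" using e by (auto simp: hyperedges_def)
  then have fin: "finite e" using finite_subset by blast
  have im: "(\<sigma> ^^ j) ` e = e" using j by (simp add: funpow_image)
  have mem: "(\<sigma> ^^ (j * t)) v \<in> e" for t
  proof (induction t)
    case (Suc t)
    then have "(\<sigma> ^^ j) ((\<sigma> ^^ (j * t)) v) \<in> e" using im by blast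
    then show ?case by (simp add: funpow_add)
  qed (simp add: v)
  have "\<not> inj_on (\<lambda>t. (\<sigma> ^^ (j * t)) v) {..m}"
  proof
    assume "inj_on (\<lambda>t. (\<sigma> ^^ (j * t)) v) {..m}"
    then have "card {..m} \<le> card e" using mem fin by (intro card_inj_on_le) auto
    then show False using e' by simp
  qed
  then obtain a b where ab: "a < b" "b \<le> m" "(\<sigma> ^^ (j * a)) v = (\<sigma> ^^ (j * b)) v"
    unfolding inj_on_def by (metis atMost_iff linorder_neqE_nat)
  have "(\<sigma> ^^ (j * b - j * a)) v = v"
    using ab by (intro funpow_diff[OF permutes_inj[OF \<sigma>]]) auto
  moreover have "j * b - j * a \<in> {1..2 * m}"
  proof -
    have "j * (b - a) \<le> 2 * m" using ab j by (intro mult_mono) auto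
    moreover have "1 * 1 \<le> j * (b - a)" using ab j by (intro mult_mono) auto
    ultimately show ?thesis by (simp add: diff_mult_distrib2)
  qed
  ultimately show "v \<in> short_cycle_points (2 * m) \<sigma> {1..n}"
    using v e' by (auto simp: short_cycle_points_def)
qed

text \<open>Such an edge contains some \<open>i\<close> and a different vertex
  \<open>\<sigma> i\<close>, so it can be recovered from its vertices other than
  \<open>\<sigma> i\<close> and the choice of \<open>i\<close> among them. The saving of a factor
  \<open>n\<close> against all edges leaves only a small power of \<open>n\<close> after
  multiplication by \<open>\<rho>^2\<close>.\<close>

lemma card_fixed_edges_outside:
  assumes \<sigma>: "\<sigma> permutes {1..n}" and m: "m \<ge> 1"
  shows "card {e\<in>hyperedges m n. \<sigma> ` e = e \<and> \<not> e \<subseteq> fixed_points n \<sigma>} \<le> m * n ^ (m - 1)"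
proof -
  have "{e\<in>hyperedges m n. \<sigma> ` e = e \<and> \<not> e \<subseteq> fixed_points n \<sigma>} \<subseteq>
      (\<Union>e'\<in>hyperedges (m - 1) n. (\<lambda>i. insert (\<sigma> i) e') ` e')"
  proof
    fix e assume "e \<in> {e\<in>hyperedges m n. \<sigma> ` e = e \<and> \<not> e \<subseteq> fixed_points n \<sigma>}"
    then obtain i where e: "e \<subseteq> {1..n}" "card e = m" "\<sigma> ` e = e" and i: "i \<in> e" "\<sigma> i \<noteq> i"
      by (auto simp: hyperedges_def fixed_points_def)
    have "\<sigma> i \<in> e" using e i by blast
    have fin: "finite e" using e finite_subset by blast
    have "e - {\<sigma> i} \<in> hyperedges (m - 1) n" using e \<open>\<sigma> i \<in> e\<close> fin by (auto simp: hyperedges_def)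
    moreover have "i \<in> e - {\<sigma> i}" "e = insert (\<sigma> i) (e - {\<sigma> i})" using i \<open>\<sigma> i \<in> e\<close> by auto
    ultimately show "e \<in> (\<Union>e'\<in>hyperedges (m - 1) n. (\<lambda>i. insert (\<sigma> i) e') ` e')" by blast
  qed
  then have "card {e\<in>hyperedges m n. \<sigma> ` e = e \<and> \<not> e \<subseteq> fixed_points n \<sigma>} \<le>
      card (\<Union>e'\<in>hyperedges (m - 1) n. (\<lambda>i. insert (\<sigma> i) e') ` e')"
    by (intro card_mono) (auto simp: hyperedges_def intro: finite_subset)
  also have "\<dots> \<le> (\<Sum>e'\<in>hyperedges (m - 1) n. card ((\<lambda>i. insert (\<sigma> i) e') ` e'))"
    by (rule card_UN_le) simp
  also have "\<dots> \<le> (\<Sum>e'\<in>hyperedges (m - 1) n. m - 1)"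
  proof (rule sum_mono)
    fix e' assume "e' \<in> hyperedges (m - 1) n"
    then have "finite e'" "card e' = m - 1" by (auto simp: hyperedges_def intro: finite_subset)
    then show "card ((\<lambda>i. insert (\<sigma> i) e') ` e') \<le> m - 1" using card_image_le by metis
  qed
  also have "\<dots> = (n choose (m - 1)) * (m - 1)" by simp
  also have "\<dots> \<le> n ^ (m - 1) * m"
  proof (intro mult_mono)
    show "n choose (m - 1) \<le> n ^ (m - 1)"
      by (cases "m - 1 \<le> n") (auto simp: binomial_le_pow binomial_eq_0)
  qed auto
  finally show ?thesis by (simp add: mult.commute)
qed

section \<open>Binomial ratios and Stirling bounds\<close>

lemma binomial_ratio_le:
  assumes "k \<le> n" "m \<ge> 1"
  shows "(k choose m) * n \<le> k * (n choose m)"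
proof (cases "k = 0")
  case False
  have a: "m * (j choose m) = j * ((j - 1) choose (m - 1))" for j
    using times_binomial_minus1_eq[of m j] assms by simp
  have "m * ((k choose m) * n) = n * (m * (k choose m))" by simp
  also have "\<dots> = k * (n * ((k - 1) choose (m - 1)))" by (simp add: a)
  also have "\<dots> \<le> k * (n * ((n - 1) choose (m - 1)))"
    using assms by (intro mult_left_mono binomial_right_mono) auto
  also have "\<dots> = k * (m * (n choose m))" by (simp only: a)
  also have "\<dots> = m * (k * (n choose m))" by simp
  finally show ?thesis using assms by simp
qed (use assms in simp)

text \<open>Absorbing twice, possible for \<open>m \<ge> 2\<close>, gains a further factor
  \<open>k / n\<close>, which makes small vertex sets harmless. The linear ratio of
  \<open>binomial_ratio_le\<close> is what turns the threshold \<open>n ln n\<close> into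
  \<open>k ln n\<close>.\<close>

lemma binomial_ratio_le_square:
  assumes "k \<le> n" "m \<ge> 2"
  shows "(k choose m) * n\<^sup>2 \<le> k\<^sup>2 * (n choose m)"
proof (cases "k \<le> 1")
  case True
  then have "k choose m = 0" using assms by (intro binomial_eq_0) simp
  then show ?thesis by (simp only: mult_0 le0)
next
  case False
  have a: "m * (j choose m) = j * ((j - 1) choose (m - 1))" for j
    using times_binomial_minus1_eq[of m j] assms by simp
  have "((k - 1) choose (m - 1)) * n * (n - 1) = n * (((k - 1) choose (m - 1)) * (n - 1))" by simp
  also have "\<dots> \<le> n * ((k - 1) * ((n - 1) choose (m - 1)))"
    using assms by (intro mult_left_mono binomial_ratio_le) auto
  also have "\<dots> = (n * (k - 1)) * ((n - 1) choose (m - 1))" by simp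
  also have "n * (k - 1) \<le> k * (n - 1)" using assms False by (simp add: diff_mult_distrib2 mult.commute)
  finally have "((k - 1) choose (m - 1)) * n * (n - 1) \<le> (k * ((n - 1) choose (m - 1))) * (n - 1)"
    by (simp add: mult_ac)
  then have c: "((k - 1) choose (m - 1)) * n \<le> k * ((n - 1) choose (m - 1))"
    using False assms by simp
  have "m * ((k choose m) * n\<^sup>2) = (m * (k choose m)) * n * n" by (simp add: power2_eq_square)
  also have "\<dots> = k * n * (((k - 1) choose (m - 1)) * n)" by (simp add: a)
  also have "\<dots> \<le> k * n * (k * ((n - 1) choose (m - 1)))" using c by (rule mult_left_mono) simp
  also have "\<dots> = k * k * (n * ((n - 1) choose (m - 1)))" by simp
  also have "\<dots> = k * k * (m * (n choose m))" by (simp only: a)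
  also have "\<dots> = m * (k\<^sup>2 * (n choose m))" by (simp add: power2_eq_square)
  finally show ?thesis using assms by simp
qed

text \<open>A single term of the series of \<open>exp (real k)\<close> is at most the whole
  sum.\<close>

lemma exp_le_fact: "exp (real k * ln (real k) - real k) \<le> fact k"
proof (cases "k = 0")
  case False
  have s: "summable (\<lambda>n. inverse (fact n) * real k ^ n)" by (rule summable_exp)
  have "inverse (fact k) * real k ^ k \<le> (\<Sum>n. inverse (fact n) * real k ^ n)"
    using sum_le_suminf[OF s, of "{k}"] by simp
  also have "\<dots> = exp (real k)" by (simp add: exp_def scaleR_conv_of_real divide_inverse)
  finally have "real k ^ k \<le> fact k * exp (real k)" by (simp add: field_simps)
  moreover have "exp (real k * ln (real k)) = real k ^ k"
    using False by (simp add: exp_of_nat_mult)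
  ultimately show ?thesis by (simp add: exp_diff field_simps)
qed simp

text \<open>The induction step is \<open>(n + 1) ln (1 + 1 / n) \<ge> 1\<close>. The spare factor
  \<open>n\<close> is harmless; the \<open>- n\<close> in the exponent is what detection relies
  on.\<close>

lemma fact_le_exp:
  assumes "n \<ge> 1"
  shows "fact n \<le> real n * exp (real n * ln (real n) - real n + 1)"
  using assms
proof (induction n rule: dec_induct)
  case (step n)
  have n: "0 < real n" using step by simp
  have "1 - 1 / (1 + 1 / real n) \<le> ln (1 + 1 / real n)"
    using ln_le_minus_one[of "1 / (1 + 1 / real n)"] n add_pos_pos[of 1 "1 / real n"]
    by (simp add: ln_div)
  then have "1 / (real n + 1) \<le> ln (1 + 1 / real n)" using n by (simp add: field_simps)
  then have "1 \<le> (real n + 1) * ln (1 + 1 / real n)" using n by (simp add: field_simps)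
  also have "1 + 1 / real n = (real n + 1) / real n" using n by (simp add: field_simps)
  finally have "1 \<le> (real n + 1) * (ln (real n + 1) - ln (real n))" using n by (simp add: ln_div)
  then have "ln (real n) + (real n * ln (real n) - real n + 1) \<le> (real n + 1) * ln (real n + 1) - (real n + 1) + 1"
    by (simp add: algebra_simps)
  then have "exp (ln (real n)) * exp (real n * ln (real n) - real n + 1) \<le> exp ((real n + 1) * ln (real n + 1) - (real n + 1) + 1)"
    unfolding exp_add[symmetric] by simp
  then have "real n * exp (real n * ln (real n) - real n + 1) \<le> exp (real (Suc n) * ln (real (Suc n)) - real (Suc n) + 1)"
    using n by (simp add: add.commute)
  with step.IH have "(fact n :: real) \<le> exp (real (Suc n) * ln (real (Suc n)) - real (Suc n) + 1)" by simp
  then have "real (Suc n) * (fact n :: real) \<le> real (Suc n) * exp (real (Suc n) * ln (real (Suc n)) - real (Suc n) + 1)"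
    by (intro mult_left_mono) auto
  then show ?case by (simp only: fact_Suc of_nat_mult)
qed simp

section \<open>The truncated second moment\<close>

definition inner_edges :: "nat \<Rightarrow> nat \<Rightarrow> nat set \<Rightarrow> nat set set" where
  "inner_edges m n S = {e\<in>hyperedges m n. e \<subseteq> S}"

lemma inner_edges_subset: "inner_edges m n S \<subseteq> hyperedges m n"
  by (auto simp: inner_edges_def)

lemma card_inner_edges:
  assumes "S \<subseteq> {1..n}"
  shows "card (inner_edges m n S) = card S choose m"
proof -
  have "inner_edges m n S = {e. e \<subseteq> S \<and> card e = m}"
    using assms by (auto simp: inner_edges_def hyperedges_def)
  then show ?thesis using n_subsets[of S m] finite_subset[OF assms] by simp
qed

text \<open>
  Under \<open>ER_alt_given m n p s \<pi>\<close> the edges that the two hypergraphs share after relabelling form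
  an Erdos-Renyi hypergraph with edge probability \<open>p s\<^sup>2\<close>; sparse overlap bounds its edge counts on
  all vertex subsets.
\<close>

definition sparse_overlap ::
    "nat \<Rightarrow> nat \<Rightarrow> (nat \<Rightarrow> real) \<Rightarrow> (nat \<Rightarrow> nat) \<Rightarrow> (hypergraph \<times> hypergraph) set" where
  "sparse_overlap m n \<zeta> \<pi> = {(A1, A2). \<forall>S\<subseteq>{1..n}.
     real (card {e\<in>inner_edges m n S. A1 e \<and> A2 (\<pi> ` e)}) \<le> \<zeta> (card S)}"

lemma sum_if_le:
  fixes x z :: real
  assumes "finite A" "0 \<le> x" "0 \<le> z"
  shows "(\<Sum>e\<in>A. if P e then x else z) \<le> x * card {e\<in>A. P e} + z * card A"
proof -
  have "(\<Sum>e\<in>A. if P e then x else z) \<le> (\<Sum>e\<in>A. (if P e then x else 0) + z)"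
    using assms by (intro sum_mono) auto
  also have "\<dots> = x * card {e\<in>A. P e} + z * card A"
    using assms by (simp add: sum.distrib flip: sum.inter_filter)
  finally show ?thesis .
qed

context ER_params
begin

text \<open>Of the two truncations in the square only the one for the identity is kept; dropping the
  other gives an upper bound.\<close>

definition overlap_moment :: "nat \<Rightarrow> nat \<Rightarrow> (nat \<Rightarrow> real) \<Rightarrow> (nat \<Rightarrow> nat) \<Rightarrow> real" where
  "overlap_moment m n \<zeta> \<sigma> = measure_pmf.expectation (ER_null m n p s)
     (\<lambda>\<omega>. ER_likelihood m n p s id \<omega> * ER_likelihood m n p s \<sigma> \<omega> * indicator (sparse_overlap m n \<zeta> id) \<omega>)"

text \<open>Each relabelling is truncated by its own event, so the sum stays below the likelihood
  ratio and the lost mass is an average of probabilities under \<open>ER_alt_given\<close>.\<close>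

definition truncated_likelihood :: "nat \<Rightarrow> nat \<Rightarrow> (nat \<Rightarrow> real) \<Rightarrow> hypergraph \<times> hypergraph \<Rightarrow> real" where
  "truncated_likelihood m n \<zeta> \<omega> =
     (\<Sum>\<pi> | \<pi> permutes {1..n}. ER_likelihood m n p s \<pi> \<omega> * indicator (sparse_overlap m n \<zeta> \<pi>) \<omega>) / fact n"

text \<open>Undoing \<open>\<pi>\<close> in the second hypergraph turns the pair of
  \<open>\<pi>\<close> and \<open>\<pi>'\<close> into the identity and
  \<open>inv \<pi> \<circ> \<pi>'\<close>, which runs through all permutations as
  \<open>\<pi>'\<close> does.\<close>

lemma expectation_truncated_likelihood_square:
  "measure_pmf.expectation (ER_null m n p s) (\<lambda>\<omega>. (truncated_likelihood m n \<zeta> \<omega>)\<^sup>2)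
    \<le> (\<Sum>\<sigma> | \<sigma> permutes {1..n}. overlap_moment m n \<zeta> \<sigma>) / fact n"
proof -
  let ?E = "measure_pmf.expectation (ER_null m n p s)"
  let ?S = "{\<pi>. \<pi> permutes {1..n}}"
  let ?L = "ER_likelihood m n p s"
  let ?I = "\<lambda>\<pi>. indicator (sparse_overlap m n \<zeta> \<pi>) :: _ \<Rightarrow> real"
  note int = integrable_measure_pmf_finite[OF finite_set_ER_null]
  have pair: "?E (\<lambda>\<omega>. (?L \<pi> \<omega> * ?I \<pi> \<omega>) * (?L \<pi>' \<omega> * ?I \<pi>' \<omega>)) \<le> overlap_moment m n \<zeta> (inv \<pi> \<circ> \<pi>')"
    if \<pi>: "\<pi> permutes {1..n}" for \<pi> \<pi>'
  proof -
    let ?\<sigma> = "inv \<pi> \<circ> \<pi>'"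
    let ?F = "\<lambda>\<omega>. ?L id \<omega> * ?L ?\<sigma> \<omega> * ?I id \<omega>"
    have im: "\<pi> ` inv \<pi> ` e = e" for e
      using permutes_inv_o[OF \<pi>] by (simp add: image_comp)
    have im': "\<pi> ` ?\<sigma> ` e = \<pi>' ` e" for e
      by (simp only: image_comp[symmetric] im)
    have F: "?F (A1, \<lambda>e. A2 (\<pi> ` e)) = ?L \<pi> (A1, A2) * ?L \<pi>' (A1, A2) * ?I \<pi> (A1, A2)" for A1 A2
      by (simp only: ER_likelihood_def sparse_overlap_def indicator_def im' case_prod_conv mem_Collect_eq image_id id_apply)
    have "?E (\<lambda>\<omega>. (?L \<pi> \<omega> * ?I \<pi> \<omega>) * (?L \<pi>' \<omega> * ?I \<pi>' \<omega>)) \<le> ?E (\<lambda>\<omega>. ?L \<pi> \<omega> * ?L \<pi>' \<omega> * ?I \<pi> \<omega>)"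
      by (intro integral_mono int) (auto simp: indicator_def ER_likelihood_nonneg)
    also have "\<dots> = ?E (\<lambda>(A1, A2). ?F (A1, \<lambda>e. A2 (\<pi> ` e)))"
      by (simp only: F case_prod_unfold prod.collapse)
    also have "\<dots> = ?E ?F" by (rule expectation_ER_null_reindex[OF \<pi>])
    finally show ?thesis by (simp add: overlap_moment_def)
  qed
  have "?E (\<lambda>\<omega>. (truncated_likelihood m n \<zeta> \<omega>)\<^sup>2) =
      ?E (\<lambda>\<omega>. (\<Sum>\<pi>\<in>?S. \<Sum>\<pi>'\<in>?S. (?L \<pi> \<omega> * ?I \<pi> \<omega>) * (?L \<pi>' \<omega> * ?I \<pi>' \<omega>)) / (fact n)\<^sup>2)"
    by (simp only: truncated_likelihood_def power_divide power2_eq_square times_divide_times_eq sum_product)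
  also have "\<dots> = (\<Sum>\<pi>\<in>?S. \<Sum>\<pi>'\<in>?S. ?E (\<lambda>\<omega>. (?L \<pi> \<omega> * ?I \<pi> \<omega>) * (?L \<pi>' \<omega> * ?I \<pi>' \<omega>))) / (fact n)\<^sup>2"
    by (simp add: int)
  also have "\<dots> \<le> (\<Sum>\<pi>\<in>?S. \<Sum>\<pi>'\<in>?S. overlap_moment m n \<zeta> (inv \<pi> \<circ> \<pi>')) / (fact n)\<^sup>2"
    by (intro divide_right_mono sum_mono pair) auto
  also have "(\<Sum>\<pi>\<in>?S. \<Sum>\<pi>'\<in>?S. overlap_moment m n \<zeta> (inv \<pi> \<circ> \<pi>')) = (\<Sum>\<pi>\<in>?S. \<Sum>\<sigma>\<in>?S. overlap_moment m n \<zeta> \<sigma>)"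
    by (intro sum.cong refl setum_permutations_compose_left[symmetric]) (simp add: permutes_inv)
  also have "\<dots> = fact n * (\<Sum>\<sigma>\<in>?S. overlap_moment m n \<zeta> \<sigma>)"
    by (simp add: card_permutations)
  also have "\<dots> / (fact n)\<^sup>2 = (\<Sum>\<sigma>\<in>?S. overlap_moment m n \<zeta> \<sigma>) / fact n"
    by (simp add: power2_eq_square)
  finally show ?thesis .
qed

lemma inner_edges_fixed_points:
  assumes "e \<in> inner_edges m n (fixed_points n \<sigma>)"
  shows "\<sigma> ` e = e"
proof -
  have "\<sigma> v = v" if "v \<in> e" for v using assms that by (auto simp: inner_edges_def fixed_points_def)
  then show ?thesis by force
qed

lemma sum_invariant_edges_le:
  assumes \<sigma>: "\<sigma> permutes {1..n}" and E0: "\<And>e. e \<in> E0 \<Longrightarrow> \<sigma> ` e = e"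
  shows "(\<Sum>S | S \<subseteq> hyperedges m n - E0 \<and> (`) \<sigma> ` S = S. (\<rho>\<^sup>2) ^ card S) \<le>
    exp (\<rho>\<^sup>2 * card {e\<in>hyperedges m n - E0. \<exists>j\<in>{1..d}. ((`) \<sigma> ^^ j) e = e} + (\<rho>\<^sup>2) ^ Suc d * (n choose m))"
proof -
  let ?A = "hyperedges m n - E0"
  have inj: "inj ((`) \<sigma>)" using permutes_inj[OF \<sigma>] by (auto simp: inj_def inj_image_eq_iff)
  have x: "0 \<le> \<rho>\<^sup>2" "\<rho>\<^sup>2 \<le> 1" using \<rho>_bounds by (auto simp: power_le_one)
  have im: "(`) \<sigma> ` ?A = ?A"
  proof -
    have "(`) \<sigma> ` E0 = E0" using E0 by force
    then show ?thesis
      using bij_betw_image_hyperedges[OF \<sigma>, of m] inj by (simp add: image_set_diff bij_betw_def)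
  qed
  have "(\<Sum>S | S \<subseteq> ?A \<and> (`) \<sigma> ` S = S. (\<rho>\<^sup>2) ^ card S) \<le>
      exp (\<Sum>e\<in>?A. if \<exists>j\<in>{1..d}. ((`) \<sigma> ^^ j) e = e then \<rho>\<^sup>2 else (\<rho>\<^sup>2) ^ Suc d)"
    by (rule sum_invariant_subsets_le[OF _ inj im x]) simp
  also have "\<dots> \<le> exp (\<rho>\<^sup>2 * card {e\<in>?A. \<exists>j\<in>{1..d}. ((`) \<sigma> ^^ j) e = e} + (\<rho>\<^sup>2) ^ Suc d * card ?A)"
    unfolding exp_le_cancel_iff by (rule sum_if_le) (use x in auto)
  also have "\<dots> \<le> exp (\<rho>\<^sup>2 * card {e\<in>?A. \<exists>j\<in>{1..d}. ((`) \<sigma> ^^ j) e = e} + (\<rho>\<^sup>2) ^ Suc d * (n choose m))"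
    unfolding exp_le_cancel_iff using x card_mono[of "hyperedges m n" ?A]
    by (intro add_mono mult_left_mono) auto
  finally show ?thesis .
qed

lemma overlap_moment_le:
  assumes \<sigma>: "\<sigma> permutes {1..n}"
  shows "overlap_moment m n \<zeta> \<sigma> \<le> (\<Sum>S | S \<subseteq> hyperedges m n - {} \<and> (`) \<sigma> ` S = S. (\<rho>\<^sup>2) ^ card S)"
proof -
  note int = integrable_measure_pmf_finite[OF finite_set_ER_null]
  have "overlap_moment m n \<zeta> \<sigma> \<le> measure_pmf.expectation (ER_null m n p s)
      (\<lambda>\<omega>. ER_likelihood m n p s id \<omega> * ER_likelihood m n p s \<sigma> \<omega>)"
    unfolding overlap_moment_def
    by (intro integral_mono int) (auto simp: indicator_def ER_likelihood_nonneg)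
  also have "\<dots> = (\<Sum>S | S \<subseteq> hyperedges m n - {} \<and> (`) \<sigma> ` S = S. (\<rho>\<^sup>2) ^ card S)"
    using expectation_likelihood_product[OF \<sigma>, of "{}" m "\<lambda>_ _. 1"]
    by (simp add: ER_likelihood_def case_prod_unfold)
  finally show ?thesis .
qed

text \<open>Here \<open>d = 2\<close>: cycles of three or more edges cost only
  \<open>\<rho>^6 (n choose m)\<close>, which will vanish. So permutations with few short-cycle
  points get a moment close to 1.\<close>

lemma overlap_moment_le_short_cycles:
  assumes \<sigma>: "\<sigma> permutes {1..n}"
  shows "overlap_moment m n \<zeta> \<sigma> \<le>
    exp (\<rho>\<^sup>2 * (card (short_cycle_points (2 * m) \<sigma> {1..n}) choose m) + (\<rho>\<^sup>2) ^ 3 * (n choose m))"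
proof -
  let ?V = "short_cycle_points (2 * m) \<sigma> {1..n}"
  have finV: "finite ?V" by (simp add: short_cycle_points_def)
  have "{e\<in>hyperedges m n - {}. \<exists>j\<in>{1..2}. ((`) \<sigma> ^^ j) e = e} \<subseteq> {e\<in>hyperedges m n. e \<subseteq> ?V}"
    using periodic_edge_subset_short_cycle_points[OF \<sigma>] by blast
  then have "card {e\<in>hyperedges m n - {}. \<exists>j\<in>{1..2}. ((`) \<sigma> ^^ j) e = e} \<le> card {e\<in>hyperedges m n. e \<subseteq> ?V}"
    by (intro card_mono) auto
  also have "\<dots> \<le> card ?V choose m" by (rule card_subsets_of_card[OF finV])
  finally have c: "card {e\<in>hyperedges m n - {}. \<exists>j\<in>{1..2}. ((`) \<sigma> ^^ j) e = e} \<le> card ?V choose m" .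
  have "overlap_moment m n \<zeta> \<sigma> \<le> exp (\<rho>\<^sup>2 * card {e\<in>hyperedges m n - {}. \<exists>j\<in>{1..2}. ((`) \<sigma> ^^ j) e = e}
      + (\<rho>\<^sup>2) ^ Suc 2 * (n choose m))"
    by (rule order.trans[OF overlap_moment_le[OF \<sigma>] sum_invariant_edges_le[OF \<sigma>]]) simp_all
  also have "\<dots> \<le> exp (\<rho>\<^sup>2 * (card ?V choose m) + (\<rho>\<^sup>2) ^ 3 * (n choose m))"
    using c by (simp add: mult_left_mono numeral_3_eq_3)
  finally show ?thesis .
qed

text \<open>Here \<open>d = 1\<close>, so that only fixed points need to be known. The remainder
  \<open>\<rho>^4 (n choose m)\<close> may grow, which is affordable because the bound is applied to
  unlikely permutations.\<close>

lemma overlap_moment_le_fixed_points: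
  assumes \<sigma>: "\<sigma> permutes {1..n}" and m: "m \<ge> 1"
  shows "overlap_moment m n \<zeta> \<sigma> \<le>
    exp (\<rho>\<^sup>2 * (card (fixed_points n \<sigma>) choose m) + (\<rho>\<^sup>2 * (m * n ^ (m - 1)) + \<rho> ^ 4 * (n choose m)))"
proof -
  let ?F = "fixed_points n \<sigma>"
  have "{e\<in>hyperedges m n - {}. \<exists>j\<in>{1..1}. ((`) \<sigma> ^^ j) e = e} \<subseteq>
      {e\<in>hyperedges m n. e \<subseteq> ?F} \<union> {e\<in>hyperedges m n. \<sigma> ` e = e \<and> \<not> e \<subseteq> ?F}"
    by auto
  then have "card {e\<in>hyperedges m n - {}. \<exists>j\<in>{1..1}. ((`) \<sigma> ^^ j) e = e} \<le>
      card ({e\<in>hyperedges m n. e \<subseteq> ?F} \<union> {e\<in>hyperedges m n. \<sigma> ` e = e \<and> \<not> e \<subseteq> ?F})"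
    by (intro card_mono) auto
  also have "\<dots> \<le> card {e\<in>hyperedges m n. e \<subseteq> ?F} + card {e\<in>hyperedges m n. \<sigma> ` e = e \<and> \<not> e \<subseteq> ?F}"
    by (rule card_Un_le)
  also have "\<dots> \<le> (card ?F choose m) + m * n ^ (m - 1)"
    by (intro add_mono card_subsets_of_card card_fixed_edges_outside[OF \<sigma> m] fixed_points_subset)
  finally have c: "card {e\<in>hyperedges m n - {}. \<exists>j\<in>{1..1}. ((`) \<sigma> ^^ j) e = e} \<le> (card ?F choose m) + m * n ^ (m - 1)" .
  have "overlap_moment m n \<zeta> \<sigma> \<le> exp (\<rho>\<^sup>2 * card {e\<in>hyperedges m n - {}. \<exists>j\<in>{1..1}. ((`) \<sigma> ^^ j) e = e}
      + (\<rho>\<^sup>2) ^ Suc 1 * (n choose m))"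
    by (rule order.trans[OF overlap_moment_le[OF \<sigma>] sum_invariant_edges_le[OF \<sigma>]]) simp_all
  also have "\<dots> \<le> exp (\<rho>\<^sup>2 * real ((card ?F choose m) + m * n ^ (m - 1)) + (\<rho>\<^sup>2) ^ Suc 1 * (n choose m))"
    unfolding exp_le_cancel_iff using c by (intro add_mono mult_left_mono order_refl) (simp_all only: of_nat_le_iff, simp)
  also have "\<dots> = exp (\<rho>\<^sup>2 * (card ?F choose m) + (\<rho>\<^sup>2 * (m * n ^ (m - 1)) + \<rho> ^ 4 * (n choose m)))"
    by (simp add: algebra_simps flip: power_mult power_add)
  finally show ?thesis .
qed

text \<open>
  On the truncation event \<open>p powr (\<zeta> k) \<le> p ^ N\<close> for the number \<open>N\<close> of shared edges on the \<open>k\<close> fixed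
  points, and inserting the factor \<open>p ^ N\<close> keeps the product structure.
\<close>

lemma overlap_moment_le_truncated:
  assumes \<sigma>: "\<sigma> permutes {1..n}" and m: "m \<ge> 1"
  defines "k \<equiv> card (fixed_points n \<sigma>)"
  shows "overlap_moment m n \<zeta> \<sigma> \<le> p powr (- \<zeta> k) *
    edge_mean (p * s) (\<lambda>a b. (ER_ratio p s a b)\<^sup>2 * (if a \<and> b then p else 1)) ^ (k choose m) *
    exp (\<rho>\<^sup>2 * (m * n ^ (m - 1)) + \<rho> ^ 4 * (n choose m))"
proof -
  note int = integrable_measure_pmf_finite[OF finite_set_ER_null]
  let ?F = "fixed_points n \<sigma>"
  let ?W = "inner_edges m n ?F" and ?E = "hyperedges m n"
  let ?h = "\<lambda>a b. (ER_ratio p s a b)\<^sup>2 * (if a \<and> b then p else 1)"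
  let ?r = "ER_ratio p s"
  let ?G = "\<lambda>(A1, A2). (\<Prod>e\<in>?W. ?h (A1 e) (A2 e)) * (\<Prod>e\<in>?E - ?W. ?r (A1 e) (A2 e)) *
      (\<Prod>e\<in>?E - ?W. ?r (A1 e) (A2 (\<sigma> ` e)))"
  have E0: "?W \<subseteq> ?E" by (rule inner_edges_subset)
  have fin0: "finite ?W" using E0 finite_subset by blast
  have cE0: "card ?W = k choose m" unfolding k_def by (rule card_inner_edges[OF fixed_points_subset(1)])
  have split: "(\<Prod>e\<in>?E. g e) = (\<Prod>e\<in>?W. g e) * (\<Prod>e\<in>?E - ?W. g e)" for g :: "nat set \<Rightarrow> real"
    using prod.subset_diff[OF E0 finite_hyperedges] by (simp add: mult.commute)
  have LL: "ER_likelihood m n p s id (A1, A2) * ER_likelihood m n p s \<sigma> (A1, A2) * p ^ card {e\<in>?W. A1 e \<and> A2 e} = ?G (A1, A2)"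
    for A1 A2
  proof -
    have "p ^ card {e\<in>?W. A1 e \<and> A2 e} = (\<Prod>e\<in>?W. if A1 e \<and> A2 e then p else 1)"
      using fin0 by (simp flip: prod.inter_filter)
    moreover have "(\<Prod>e\<in>?W. ?r (A1 e) (A2 (\<sigma> ` e))) = (\<Prod>e\<in>?W. ?r (A1 e) (A2 e))"
      by (intro prod.cong refl) (simp add: inner_edges_fixed_points)
    ultimately show ?thesis
      by (simp add: ER_likelihood_def split prod.distrib power2_eq_square mult_ac)
  qed
  have G0: "0 \<le> ?G \<omega>" for \<omega>
    using p_pos by (auto simp: case_prod_unfold intro!: mult_nonneg_nonneg prod_nonneg ER_ratio_nonneg)
  have pt: "ER_likelihood m n p s id \<omega> * ER_likelihood m n p s \<sigma> \<omega> * indicator (sparse_overlap m n \<zeta> id) \<omega>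
      \<le> p powr (- \<zeta> k) * ?G \<omega>" for \<omega>
  proof (cases "\<omega> \<in> sparse_overlap m n \<zeta> id")
    case True
    obtain A1 A2 where \<omega>: "\<omega> = (A1, A2)" by (cases \<omega>)
    let ?N = "card {e\<in>?W. A1 e \<and> A2 e}"
    have "real ?N \<le> \<zeta> k"
      using True fixed_points_subset(1)[of n \<sigma>] by (auto simp: sparse_overlap_def \<omega> k_def)
    then have "p powr 0 \<le> p powr (- \<zeta> k + real ?N)"
      using p_pos p_less by (intro powr_mono') auto
    then have "1 \<le> p powr (- \<zeta> k) * p powr real ?N"
      using p_pos by (simp only: powr_add) simp
    then have "1 \<le> p powr (- \<zeta> k) * p ^ ?N"
      using p_pos by (simp only: powr_realpow)
    then have "ER_likelihood m n p s id \<omega> * ER_likelihood m n p s \<sigma> \<omega> * 1 \<le>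
        ER_likelihood m n p s id \<omega> * ER_likelihood m n p s \<sigma> \<omega> * (p powr (- \<zeta> k) * p ^ ?N)"
      by (intro mult_left_mono) (auto simp: ER_likelihood_nonneg)
    also have "\<dots> = p powr (- \<zeta> k) * ?G \<omega>"
      unfolding \<omega> LL[symmetric] by (simp only: mult_ac)
    finally show ?thesis using True by simp
  next
    case False
    then show ?thesis using G0[of \<omega>] by simp
  qed
  have y0: "0 \<le> edge_mean (p * s) ?h"
    using ps_bounds p_pos by (auto simp: edge_mean_def)
  have "overlap_moment m n \<zeta> \<sigma> \<le> measure_pmf.expectation (ER_null m n p s) (\<lambda>\<omega>. p powr (- \<zeta> k) * ?G \<omega>)"
    unfolding overlap_moment_def by (intro integral_mono int pt)
  also have "\<dots> = p powr (- \<zeta> k) * measure_pmf.expectation (ER_null m n p s) ?G"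
    by simp
  also have "measure_pmf.expectation (ER_null m n p s) ?G =
      edge_mean (p * s) ?h ^ card ?W * (\<Sum>S | S \<subseteq> ?E - ?W \<and> (`) \<sigma> ` S = S. (\<rho>\<^sup>2) ^ card S)"
    by (rule expectation_likelihood_product[OF \<sigma> E0 inner_edges_fixed_points])
  also have "\<dots> \<le> edge_mean (p * s) ?h ^ (k choose m) * exp (\<rho>\<^sup>2 * (m * n ^ (m - 1)) + \<rho> ^ 4 * (n choose m))"
    unfolding cE0
  proof (intro mult_left_mono)
    have "{e\<in>?E - ?W. \<exists>j\<in>{1..1}. ((`) \<sigma> ^^ j) e = e} = {e\<in>?E. \<sigma> ` e = e \<and> \<not> e \<subseteq> ?F}"
      by (auto simp: inner_edges_def)
    then have "card {e\<in>?E - ?W. \<exists>j\<in>{1..1}. ((`) \<sigma> ^^ j) e = e} \<le> m * n ^ (m - 1)"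
      using card_fixed_edges_outside[OF \<sigma> m] by simp
    then have c: "real (card {e\<in>?E - ?W. \<exists>j\<in>{1..1}. ((`) \<sigma> ^^ j) e = e}) \<le> real (m * n ^ (m - 1))"
      by (simp only: of_nat_le_iff)
    have "(\<Sum>S | S \<subseteq> ?E - ?W \<and> (`) \<sigma> ` S = S. (\<rho>\<^sup>2) ^ card S) \<le>
       exp (\<rho>\<^sup>2 * card {e\<in>?E - ?W. \<exists>j\<in>{1..1}. ((`) \<sigma> ^^ j) e = e} + (\<rho>\<^sup>2) ^ Suc 1 * (n choose m))"
      by (rule sum_invariant_edges_le[OF \<sigma> inner_edges_fixed_points])
    also have "\<dots> \<le> exp (\<rho>\<^sup>2 * real (m * n ^ (m - 1)) + (\<rho>\<^sup>2) ^ Suc 1 * (n choose m))"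
      unfolding exp_le_cancel_iff by (intro add_mono mult_left_mono[OF c] order_refl) simp
    finally show "(\<Sum>S | S \<subseteq> ?E - ?W \<and> (`) \<sigma> ` S = S. (\<rho>\<^sup>2) ^ card S) \<le>
        exp (\<rho>\<^sup>2 * (m * n ^ (m - 1)) + \<rho> ^ 4 * (n choose m))"
      by (simp flip: power_mult power_add)
  qed (use y0 in simp)
  finally show ?thesis by (simp add: mult.assoc mult_left_mono)
qed

end

text \<open>The three estimates play different roles: \<open>e1\<close> is meant to be near 1 for
  typical permutations, \<open>e2\<close> may be large since many short-cycle points have
  probability at most \<open>2 * m * n / fact u\<close>, and \<open>g k\<close> competes with the
  probability \<open>n / fact k\<close> of \<open>k\<close> fixed points.\<close>

lemma average_over_permutations_le:
  fixes G :: "(nat \<Rightarrow> nat) \<Rightarrow> real"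
  assumes m: "m \<ge> 1" and u: "u \<ge> 1" and k0: "k0 \<ge> 1"
    and nonneg: "0 \<le> e1" "0 \<le> e2" "\<And>k. 0 \<le> g k"
    and A: "\<And>\<sigma>. \<sigma> permutes {1..n} \<Longrightarrow>
      card (short_cycle_points (2 * m) \<sigma> {1..n}) < (2 * m) * ((2 * m) * u) \<Longrightarrow> G \<sigma> \<le> e1"
    and B: "\<And>\<sigma>. \<sigma> permutes {1..n} \<Longrightarrow> card (fixed_points n \<sigma>) < k0 \<Longrightarrow> G \<sigma> \<le> e2"
    and C: "\<And>\<sigma>. \<sigma> permutes {1..n} \<Longrightarrow> k0 \<le> card (fixed_points n \<sigma>) \<Longrightarrow> G \<sigma> \<le> g (card (fixed_points n \<sigma>))"
  shows "(\<Sum>\<sigma> | \<sigma> permutes {1..n}. G \<sigma>) / fact n \<le>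
    e1 + e2 * (2 * m * n) / fact u + (\<Sum>k\<in>{k0..n}. g k * n / fact k)"
proof -
  let ?S = "{\<sigma>. \<sigma> permutes {1..n}}"
  let ?B = "{\<sigma>\<in>?S. (2 * m) * ((2 * m) * u) \<le> card (short_cycle_points (2 * m) \<sigma> {1..n})}"
  let ?C = "\<lambda>k. {\<sigma>\<in>?S. k = card (fixed_points n \<sigma>)}"
  have finS: "finite ?S" by (simp add: finite_permutations)
  have "real (card ?B) * fact u \<le> real (2 * m * n) * fact n"
  proof -
    have "card ?B * fact u \<le> 2 * m * (n * fact n)"
      using card_permutes_many_short_cycle_points[of "{1..n}" "2 * m" u] m u by simp
    then have "real (card ?B * fact u) \<le> real (2 * m * (n * fact n))" by (simp only: of_nat_le_iff)
    then show ?thesis by simp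
  qed
  then have cB: "real (card ?B) / fact n \<le> real (2 * m * n) / fact u" by (simp add: divide_simps mult_ac)
  have cC: "real (card (?C k)) / fact n \<le> real n / fact k" if "k \<ge> 1" for k
  proof -
    have "card (?C k) \<le> card {\<sigma>. \<sigma> permutes {1..n} \<and> k \<le> card (fixed_points n \<sigma>)}"
      by (rule card_mono) (use finS in \<open>auto intro: finite_subset[OF _ finS]\<close>)
    then have "card (?C k) * fact k \<le> n * fact n"
      using card_permutes_many_fixed_points[OF that, of n] by (meson le_trans mult_le_mono1)
    then have "real (card (?C k) * fact k) \<le> real (n * fact n)" by (simp only: of_nat_le_iff)
    then show ?thesis by (simp add: divide_simps mult_ac)
  qed
  \<comment> \<open>Many fixed points, otherwise many short-cycle points, otherwise neither: one of
    the three terms always applies. All terms are nonnegative, so they may simply be added.\<close>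
  have pt: "G \<sigma> \<le> e1 + (if (2 * m) * ((2 * m) * u) \<le> card (short_cycle_points (2 * m) \<sigma> {1..n}) then e2 else 0)
      + (\<Sum>k\<in>{k0..n}. if k = card (fixed_points n \<sigma>) then g k else 0)" if \<sigma>: "\<sigma> \<in> ?S" for \<sigma>
  proof -
    let ?k = "card (fixed_points n \<sigma>)"
    have s0: "0 \<le> (\<Sum>k\<in>{k0..n}. if k = ?k then g k else 0)" by (intro sum_nonneg) (simp add: nonneg)
    show ?thesis
    proof (cases "k0 \<le> ?k")
      case True
      then have "(\<Sum>k\<in>{k0..n}. if k = ?k then g k else 0) = g ?k"
        using fixed_points_subset(3)[of n \<sigma>] by (subst sum.delta) auto
      then show ?thesis using C[of \<sigma>] \<sigma> True nonneg by (auto intro: add_increasing)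
    next
      case False
      show ?thesis
      proof (cases "(2 * m) * ((2 * m) * u) \<le> card (short_cycle_points (2 * m) \<sigma> {1..n})")
        case True
        have "G \<sigma> \<le> e2" using B[of \<sigma>] \<sigma> False by simp
        then show ?thesis using True nonneg s0 by simp
      next
        case short: False
        have "G \<sigma> \<le> e1" using A[of \<sigma>] \<sigma> short by simp
        then show ?thesis using short nonneg s0 by simp
      qed
    qed
  qed
  have "(\<Sum>\<sigma>\<in>?S. G \<sigma>) \<le> (\<Sum>\<sigma>\<in>?S. e1
      + (if (2 * m) * ((2 * m) * u) \<le> card (short_cycle_points (2 * m) \<sigma> {1..n}) then e2 else 0)
      + (\<Sum>k\<in>{k0..n}. if k = card (fixed_points n \<sigma>) then g k else 0))"
    by (rule sum_mono[OF pt])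
  also have "\<dots> = e1 * fact n + e2 * card ?B + (\<Sum>k\<in>{k0..n}. \<Sum>\<sigma>\<in>?S. if k = card (fixed_points n \<sigma>) then g k else 0)"
    using finS by (subst sum.swap) (simp add: sum.distrib card_permutations flip: sum.inter_filter)
  also have "(\<Sum>k\<in>{k0..n}. \<Sum>\<sigma>\<in>?S. if k = card (fixed_points n \<sigma>) then g k else 0) = (\<Sum>k\<in>{k0..n}. g k * card (?C k))"
  proof (intro sum.cong refl)
    fix k
    have "(\<Sum>\<sigma>\<in>?S. if k = card (fixed_points n \<sigma>) then g k else 0) = (\<Sum>\<sigma>\<in>?C k. g k)"
      by (rule sum.inter_filter[OF finS, symmetric])
    also have "\<dots> = card (?C k) * g k" by (rule sum_constant)
    finally show "(\<Sum>\<sigma>\<in>?S. if k = card (fixed_points n \<sigma>) then g k else 0) = g k * card (?C k)"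
      by (simp only: mult.commute)
  qed
  finally have "(\<Sum>\<sigma>\<in>?S. G \<sigma>) / fact n \<le> (e1 * fact n + e2 * card ?B + (\<Sum>k\<in>{k0..n}. g k * card (?C k))) / fact n"
    by (rule divide_right_mono) simp
  also have "\<dots> = e1 + e2 * (card ?B / fact n) + (\<Sum>k\<in>{k0..n}. g k * (card (?C k) / fact n))"
    by (simp add: add_divide_distrib sum_divide_distrib)
  also have "\<dots> \<le> e1 + e2 * (real (2 * m * n) / fact u) + (\<Sum>k\<in>{k0..n}. g k * (real n / fact k))"
    using cB cC k0 nonneg by (intro add_mono mult_left_mono sum_mono order_refl) auto
  finally show ?thesis by simp
qed

section \<open>Mass lost by the truncation\<close>

context ER_params
begin

text \<open>Markov's inequality with tilt \<open>\<theta>\<close> for the number of shared edges,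
  which is binomial under H1 and dominated by the Poisson generating function.\<close>

lemma prob_many_common_edges_le:
  assumes \<pi>: "\<pi> permutes {1..n}" and S: "S \<subseteq> {1..n}" and \<theta>: "0 \<le> \<theta>"
  shows "measure_pmf.prob (ER_alt_given m n p s \<pi>)
      {(A1, A2). z < real (card {e\<in>inner_edges m n S. A1 e \<and> A2 (\<pi> ` e)})}
    \<le> exp (- \<theta> * z + real (card S choose m) * p * s\<^sup>2 * (exp \<theta> - 1))"
proof -
  let ?W = "inner_edges m n S" and ?L = "ER_likelihood m n p s \<pi>"
  let ?N = "\<lambda>A1 A2. card {e\<in>?W. A1 e \<and> A2 (\<pi> ` e)}"
  note int = integrable_measure_pmf_finite[OF finite_set_ER_null]
  have "measure_pmf.prob (ER_alt_given m n p s \<pi>) {(A1, A2). z < real (?N A1 A2)} =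
    measure_pmf.expectation (ER_null m n p s) (\<lambda>\<omega>. ?L \<omega> * indicator {(A1, A2). z < real (?N A1 A2)} \<omega>)"
    by (rule prob_ER_alt_given[OF \<pi>])
  also have "\<dots> \<le> measure_pmf.expectation (ER_null m n p s)
      (\<lambda>\<omega>. exp (- \<theta> * z) * (?L \<omega> * (case \<omega> of (A1, A2) \<Rightarrow> exp \<theta> ^ ?N A1 A2)))"
  proof (intro integral_mono int)
    fix \<omega> :: "hypergraph \<times> hypergraph"
    obtain A1 A2 where \<omega>: "\<omega> = (A1, A2)" by (cases \<omega>)
    have "indicator {(A1, A2). z < real (?N A1 A2)} \<omega> \<le> exp (- \<theta> * z) * exp \<theta> ^ ?N A1 A2"
    proof (cases "z < real (?N A1 A2)")
      case True
      then have "\<theta> * z \<le> \<theta> * real (?N A1 A2)" using \<theta> by (intro mult_left_mono) auto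
      then have "1 \<le> exp (- \<theta> * z + real (?N A1 A2) * \<theta>)" by (simp add: mult.commute)
      also have "\<dots> = exp (- \<theta> * z) * exp \<theta> ^ ?N A1 A2" by (simp only: exp_add exp_of_nat_mult)
      finally show ?thesis using True by (simp add: \<omega>)
    qed (simp add: \<omega>)
    from mult_left_mono[OF this ER_likelihood_nonneg[of m n \<pi> \<omega>]]
    show "?L \<omega> * indicator {(A1, A2). z < real (?N A1 A2)} \<omega> \<le>
        exp (- \<theta> * z) * (?L \<omega> * (case \<omega> of (A1, A2) \<Rightarrow> exp \<theta> ^ ?N A1 A2))"
      by (simp add: \<omega> mult.left_commute)
  qed
  also have "\<dots> = exp (- \<theta> * z) * (1 + p * s\<^sup>2 * (exp \<theta> - 1)) ^ card ?W"
    using ER_alt_common_mgf[OF \<pi> inner_edges_subset] by simp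
  also have "\<dots> \<le> exp (- \<theta> * z) * exp (p * s\<^sup>2 * (exp \<theta> - 1)) ^ card ?W"
    using p_pos \<theta> by (intro mult_left_mono power_mono exp_ge_add_one_self) auto
  also have "\<dots> = exp (- \<theta> * z + real (card S choose m) * p * s\<^sup>2 * (exp \<theta> - 1))"
    unfolding card_inner_edges[OF S] exp_add by (simp add: mult_ac flip: exp_of_nat_mult)
  finally show ?thesis .
qed

text \<open>Union bound over all vertex sets: those of size \<open>k\<close> contribute at most
  \<open>r ^ k\<close> together, and the geometric series with \<open>r \<le> 1 / 2\<close> sums to
  at most \<open>2 * r\<close>. The tilt may depend on \<open>k\<close>.\<close>

lemma prob_not_sparse_overlap_le:
  assumes \<pi>: "\<pi> permutes {1..n}" and m: "m \<ge> 1" and \<zeta>0: "0 \<le> \<zeta> 0" and \<theta>: "\<And>k. k \<in> {1..n} \<Longrightarrow> 0 \<le> \<theta> k"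
    and r: "0 \<le> r" "r \<le> 1 / 2"
    and tail: "\<And>k. k \<in> {1..n} \<Longrightarrow>
      (n choose k) * exp (- \<theta> k * \<zeta> k + real (k choose m) * p * s\<^sup>2 * (exp (\<theta> k) - 1)) \<le> r ^ k"
  shows "measure_pmf.prob (ER_alt_given m n p s \<pi>) (- sparse_overlap m n \<zeta> \<pi>) \<le> 2 * r"
proof -
  let ?Q = "measure_pmf.prob (ER_alt_given m n p s \<pi>)"
  let ?bad = "\<lambda>S. {(A1, A2). \<zeta> (card S) < real (card {e\<in>inner_edges m n S. A1 e \<and> A2 (\<pi> ` e)})}"
  let ?P = "\<lambda>k. {S. S \<subseteq> {1..n} \<and> card S = k}"
  have finP: "finite (?P k)" for k by (rule finite_subset[of _ "Pow {1..n}"]) auto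
  \<comment> \<open>The empty set is excluded by hand, since \<open>r ^ 0\<close> gives no
    decay.\<close>
  have empty: "?bad {} = {}"
  proof -
    have "inner_edges m n {} = {}" using m by (auto simp: inner_edges_def hyperedges_def)
    then show ?thesis using \<zeta>0 by auto
  qed
  have "- sparse_overlap m n \<zeta> \<pi> \<subseteq> (\<Union>k\<in>{1..n}. \<Union>S\<in>?P k. ?bad S)"
  proof
    fix \<omega> assume "\<omega> \<in> - sparse_overlap m n \<zeta> \<pi>"
    moreover obtain A1 A2 where \<omega>: "\<omega> = (A1, A2)" by (cases \<omega>)
    ultimately have "\<exists>S\<subseteq>{1..n}. \<not> real (card {e\<in>inner_edges m n S. A1 e \<and> A2 (\<pi> ` e)}) \<le> \<zeta> (card S)"
      unfolding sparse_overlap_def by blast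
    then obtain S where S: "S \<subseteq> {1..n}" "\<omega> \<in> ?bad S"
      unfolding \<omega> not_le by blast
    then have "S \<noteq> {}" using empty by blast
    then have "card S \<ge> 1" using finite_subset[OF S(1)] by (simp add: Suc_le_eq card_gt_0_iff)
    moreover have "card S \<le> n" using card_mono[OF _ S(1)] by simp
    ultimately have "card S \<in> {1..n}" "S \<in> ?P (card S)" using S(1) by simp_all
    then show "\<omega> \<in> (\<Union>k\<in>{1..n}. \<Union>S\<in>?P k. ?bad S)" using S(2) by (intro UN_I)
  qed
  then have "?Q (- sparse_overlap m n \<zeta> \<pi>) \<le> ?Q (\<Union>k\<in>{1..n}. \<Union>S\<in>?P k. ?bad S)"
    by (intro measure_pmf.finite_measure_mono) auto
  also have "\<dots> \<le> (\<Sum>k\<in>{1..n}. ?Q (\<Union>S\<in>?P k. ?bad S))"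
    by (intro measure_pmf.finite_measure_subadditive_finite) auto
  also have "\<dots> \<le> (\<Sum>k\<in>{1..n}. r ^ k)"
  proof (rule sum_mono)
    fix k assume k: "k \<in> {1..n}"
    have "?Q (\<Union>S\<in>?P k. ?bad S) \<le> (\<Sum>S\<in>?P k. ?Q (?bad S))"
      by (intro measure_pmf.finite_measure_subadditive_finite finP) auto
    also have "\<dots> \<le> (\<Sum>S\<in>?P k. exp (- \<theta> k * \<zeta> k + real (k choose m) * p * s\<^sup>2 * (exp (\<theta> k) - 1)))"
      using prob_many_common_edges_le[OF \<pi>, of _ "\<theta> k"] \<theta>[OF k] by (intro sum_mono) auto
    also have "\<dots> = (n choose k) * exp (- \<theta> k * \<zeta> k + real (k choose m) * p * s\<^sup>2 * (exp (\<theta> k) - 1))"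
      using n_subsets[of "{1..n}" k] by simp
    also have "\<dots> \<le> r ^ k" by (rule tail[OF k])
    finally show "?Q (\<Union>S\<in>?P k. ?bad S) \<le> r ^ k" .
  qed
  also have "\<dots> \<le> 2 * r"
  proof -
    have "(\<Sum>k\<in>{1..n}. r ^ k) = r * (\<Sum>k<n. r ^ k)"
      by (simp add: sum_distrib_left sum.atLeast1_atMost_eq)
    also have "\<dots> \<le> r * (\<Sum>k<n. (1 / 2) ^ k)"
      using r by (intro mult_left_mono sum_mono power_mono) auto
    also have "\<dots> \<le> r * 2"
      using sum_gp_strict[of "1/2 :: real" n] r by (intro mult_left_mono) simp_all
    finally show ?thesis by (simp only: mult.commute)
  qed
  finally show ?thesis .
qed

lemma ER_TV_le_truncated:
  assumes lost: "\<And>\<pi>. \<pi> permutes {1..n} \<Longrightarrow> measure_pmf.prob (ER_alt_given m n p s \<pi>) (- sparse_overlap m n \<zeta> \<pi>) \<le> d"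
    and var: "(\<Sum>\<sigma> | \<sigma> permutes {1..n}. overlap_moment m n \<zeta> \<sigma>) / fact n \<le> 1 + v"
  shows "ER_TV m n p s \<le> d + sqrt (v + 2 * d)"
  unfolding ER_TV_def
proof (rule TV_truncated_second_moment[where L' = "truncated_likelihood m n \<zeta>"])
  let ?S = "{\<pi>. \<pi> permutes {1..n}}"
  note int = integrable_measure_pmf_finite[OF finite_set_ER_null]
  show "finite (set_pmf (ER_null m n p s))" by simp
  show "pmf (ER_alt m n p s) \<omega> = pmf (ER_null m n p s) \<omega> * ((\<Sum>\<pi>\<in>?S. ER_likelihood m n p s \<pi> \<omega>) / fact n)" for \<omega>
    by (rule pmf_ER_alt)
  show "0 \<le> truncated_likelihood m n \<zeta> \<omega>" for \<omega>
    by (auto simp: truncated_likelihood_def intro!: sum_nonneg divide_nonneg_nonneg mult_nonneg_nonneg ER_likelihood_nonneg)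
  show "truncated_likelihood m n \<zeta> \<omega> \<le> (\<Sum>\<pi>\<in>?S. ER_likelihood m n p s \<pi> \<omega>) / fact n" for \<omega>
    unfolding truncated_likelihood_def
    by (intro divide_right_mono sum_mono) (auto simp: indicator_def ER_likelihood_nonneg)
  show "measure_pmf.expectation (ER_null m n p s) (\<lambda>\<omega>. (truncated_likelihood m n \<zeta> \<omega>)\<^sup>2) \<le> 1 + v"
    using expectation_truncated_likelihood_square var by (rule order.trans)
  have "measure_pmf.expectation (ER_null m n p s) (truncated_likelihood m n \<zeta>) =
      (\<Sum>\<pi>\<in>?S. measure_pmf.prob (ER_alt_given m n p s \<pi>) (sparse_overlap m n \<zeta> \<pi>)) / fact n"
    unfolding truncated_likelihood_def[abs_def] by (simp add: int prob_ER_alt_given)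
  also have "\<dots> \<ge> (\<Sum>\<pi>\<in>?S. 1 - d) / fact n"
  proof (intro divide_right_mono sum_mono)
    fix \<pi> assume "\<pi> \<in> ?S"
    then have "measure_pmf.prob (ER_alt_given m n p s \<pi>) (- sparse_overlap m n \<zeta> \<pi>) \<le> d" using lost by simp
    then show "1 - d \<le> measure_pmf.prob (ER_alt_given m n p s \<pi>) (sparse_overlap m n \<zeta> \<pi>)"
      using measure_pmf.prob_compl[of "sparse_overlap m n \<zeta> \<pi>" "ER_alt_given m n p s \<pi>"]
      by (simp add: Compl_eq_Diff_UNIV)
  qed simp
  also have "(\<Sum>\<pi>\<in>?S. 1 - d) / fact n = 1 - d" by (simp add: card_permutations)
  finally show "1 - measure_pmf.expectation (ER_null m n p s) (truncated_likelihood m n \<zeta>) \<le> d" by simp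
qed

text \<open>
  To second order in \<open>s\<close>, the three types of pairs contribute \<open>p s\<^sup>2\<close>, \<open>2 q (1 - q) - 4 d\<close> and
  \<open>(1 - q)\<^sup>2 + 2 d\<close>, where \<open>q = p s\<close> and \<open>d = p s\<^sup>2 (1 - p)\<close>; in sum \<open>1 - d\<close>.
\<close>

lemma edge_mean_ratio_square_le:
  "edge_mean (p * s) (\<lambda>a b. (ER_ratio p s a b)\<^sup>2 * (if a \<and> b then p else 1))
    \<le> exp (- (p * s\<^sup>2 * ((1 - p) - 2 * s - s\<^sup>2)))"
proof -
  define r where "r = 1 - p * s"
  define d where "d = p * s\<^sup>2 * (1 - p)"
  have r: "0 < r" "r \<ge> 1 - p" "r \<noteq> 0" and p1: "0 < 1 - p" using ps_bounds p_less by (auto simp: r_def)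
  have d0: "0 \<le> d" using p_pos p_less by (simp add: d_def)
  have v: "ER_ratio p s False False = (r\<^sup>2 + d) / r\<^sup>2" "ER_ratio p s True False = (r - s * (1 - p)) / r"
      "ER_ratio p s False True = (r - s * (1 - p)) / r"
    unfolding ER_ratio_values by (simp_all add: r_def d_def power2_eq_square algebra_simps)
  have "edge_mean (p * s) (\<lambda>a b. (ER_ratio p s a b)\<^sup>2 * (if a \<and> b then p else 1)) =
      (p * s)\<^sup>2 * ((1 / p)\<^sup>2 * p) + 2 * (p * s) * r * ((r - s * (1 - p)) / r)\<^sup>2 + r\<^sup>2 * ((r\<^sup>2 + d) / r\<^sup>2)\<^sup>2"
    by (simp add: edge_mean_def ER_ratio_values(1) v r_def[symmetric])
  also have "(p * s)\<^sup>2 * ((1 / p)\<^sup>2 * p) = p * s\<^sup>2"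
    using p_pos by (simp add: power2_eq_square)
  also have "2 * (p * s) * r * ((r - s * (1 - p)) / r)\<^sup>2 = 2 * (p * s) * r - 4 * d + 2 * s * d * ((1 - p) / r)"
    using r by (simp add: d_def power2_eq_square field_simps)
  also have "r\<^sup>2 * ((r\<^sup>2 + d) / r\<^sup>2)\<^sup>2 = r\<^sup>2 + 2 * d + d * (d / r\<^sup>2)"
    using r by (simp add: power2_eq_square field_simps)
  also have "p * s\<^sup>2 + (2 * (p * s) * r - 4 * d + 2 * s * d * ((1 - p) / r)) + (r\<^sup>2 + 2 * d + d * (d / r\<^sup>2)) =
      1 - d + 2 * s * d * ((1 - p) / r) + d * (d / r\<^sup>2)"
    by (simp add: r_def d_def power2_eq_square algebra_simps)
  \<comment> \<open>The leading \<open>1 - d\<close> is kept; the other two terms are of third and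
    fourth order in \<open>s\<close>, uniformly in \<open>p\<close> because
    \<open>(1 - p) / r \<le> 1\<close>.\<close>
  also have "\<dots> \<le> 1 - d + 2 * s * (p * s\<^sup>2) * 1 + (p * s\<^sup>2) * s\<^sup>2"
  proof (intro add_mono order_refl)
    have dle: "d \<le> p * s\<^sup>2" unfolding d_def using p_pos p_less by (intro mult_left_le) auto
    show "2 * s * d * ((1 - p) / r) \<le> 2 * s * (p * s\<^sup>2) * 1"
      using r p1 s_nonneg d0 p_pos dle by (intro mult_mono) auto
    have "d * d \<le> p * s\<^sup>2 * s\<^sup>2 * r\<^sup>2"
    proof -
      have "d * d = (p * s\<^sup>2 * s\<^sup>2) * (p * (1 - p)\<^sup>2)" by (simp add: d_def power2_eq_square mult_ac)
      also have "\<dots> \<le> (p * s\<^sup>2 * s\<^sup>2) * (1 * r\<^sup>2)"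
        using p_pos p_less r p1 by (intro mult_left_mono mult_mono power_mono) auto
      finally show ?thesis by simp
    qed
    then show "d * (d / r\<^sup>2) \<le> (p * s\<^sup>2) * s\<^sup>2" using r by (simp add: field_simps)
  qed
  also have "\<dots> = 1 + - (p * s\<^sup>2 * ((1 - p) - 2 * s - s\<^sup>2))"
    by (simp add: d_def algebra_simps)
  also have "\<dots> \<le> exp (- (p * s\<^sup>2 * ((1 - p) - 2 * s - s\<^sup>2)))" by (rule exp_ge_add_one_self)
  finally show ?thesis .
qed

end

section \<open>Detection above the threshold\<close>

text \<open>The Cramer rate of a Poisson variable with mean \<open>p\<close> at the value 1. It is
  the exponent per expected shared edge, since the mean number of shared edges under H0 is
  \<open>p\<close> times that under H1.\<close>

definition rate :: "real \<Rightarrow> real" where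
  "rate p = ln (1 / p) - 1 + p"

text \<open>With \<open>L = ln (1 / p)\<close> the rate is \<open>L - 1 + exp (- L)\<close>, and its
  derivative \<open>1 - exp (- t)\<close> is at least \<open>t / (1 + t)\<close>. The bound is
  quadratic for small \<open>L\<close> and linear for large \<open>L\<close>, hence of the right
  order for \<open>p\<close> near 1 as well as near 0.\<close>

lemma rate_ge:
  assumes "0 < p" "p < 1"
  shows "(ln (1 / p))\<^sup>2 / (2 * (1 + ln (1 / p))) \<le> rate p"
proof -
  define L where "L = ln (1 / p)"
  have L: "0 < L" using assms by (simp add: L_def)
  have p: "p = exp (- L)" using assms by (simp add: L_def ln_div)
  define c where "c = 1 / (2 * (1 + L))"
  define f where "f t = t - 1 + exp (- t) - c * t\<^sup>2" for t
  have "f 0 \<le> f L"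
  proof (rule DERIV_nonneg_imp_nondecreasing[OF less_imp_le[OF L]])
    fix t assume t: "0 \<le> t" "t \<le> L"
    have "(f has_real_derivative (1 - exp (- t) - c * (2 * t))) (at t)"
      unfolding f_def by (auto intro!: derivative_eq_intros)
    moreover have c: "c * (2 * t) = t / (1 + L)" using L by (simp add: c_def field_simps)
    moreover have "0 \<le> 1 - exp (- t) - c * (2 * t)"
    proof -
      have "exp (- t) * (1 + t) \<le> exp (- t) * exp t"
        by (intro mult_left_mono exp_ge_add_one_self) auto
      then have "exp (- t) \<le> 1 / (1 + t)" using t by (simp add: field_simps flip: exp_add)
      also have "\<dots> = 1 - t / (1 + t)" using t by (simp add: field_simps)
      also have "\<dots> \<le> 1 - t / (1 + L)" using t L by (intro diff_left_mono divide_left_mono) auto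
      finally show ?thesis by (simp add: c)
    qed
    ultimately show "\<exists>y. (f has_real_derivative y) (at t) \<and> 0 \<le> y" by blast
  qed
  then have "L\<^sup>2 / (2 * (1 + L)) \<le> L - 1 + exp (- L)" by (simp add: f_def c_def)
  then have "L\<^sup>2 / (2 * (1 + L)) \<le> L - 1 + p" using p by simp
  then show ?thesis by (simp add: rate_def L_def)
qed

lemma rate_pos:
  assumes "0 < p" "p < 1"
  shows "0 < rate p"
proof -
  have "0 < ln (1 / p)" using assms by simp
  then have "0 < (ln (1 / p))\<^sup>2 / (2 * (1 + ln (1 / p)))" by simp
  then show ?thesis using rate_ge[OF assms] by linarith
qed

lemma rate_less: "p < 1 \<Longrightarrow> rate p < ln (1 / p)"
  by (simp add: rate_def)

context ER_params
begin

text \<open>Lower Chernoff tail with tilt \<open>- d\<close>; the estimate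
  \<open>exp (- d) \<le> 1 - d + d^2 / 2\<close> gives the Gaussian exponent.\<close>

lemma prob_few_common_edges_le:
  fixes m n :: nat
  assumes \<pi>: "\<pi> permutes {1..n}" and d: "0 \<le> d"
  defines "\<mu> \<equiv> (n choose m) * p * s\<^sup>2"
  shows "measure_pmf.prob (ER_alt_given m n p s \<pi>)
      {(A1, A2). real (card {e\<in>hyperedges m n. A1 e \<and> A2 (\<pi> ` e)}) < (1 - d) * \<mu>}
    \<le> exp (- (\<mu> * d\<^sup>2 / 2))"
proof -
  let ?E = "hyperedges m n" and ?L = "ER_likelihood m n p s \<pi>"
  let ?N = "\<lambda>A1 A2. card {e\<in>?E. A1 e \<and> A2 (\<pi> ` e)}"
  let ?z = "(1 - d) * \<mu>"
  note int = integrable_measure_pmf_finite[OF finite_set_ER_null]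
  have "measure_pmf.prob (ER_alt_given m n p s \<pi>) {(A1, A2). real (?N A1 A2) < ?z} =
    measure_pmf.expectation (ER_null m n p s) (\<lambda>\<omega>. ?L \<omega> * indicator {(A1, A2). real (?N A1 A2) < ?z} \<omega>)"
    by (rule prob_ER_alt_given[OF \<pi>])
  also have "\<dots> \<le> measure_pmf.expectation (ER_null m n p s)
      (\<lambda>\<omega>. exp (d * ?z) * (?L \<omega> * (case \<omega> of (A1, A2) \<Rightarrow> exp (- d) ^ ?N A1 A2)))"
  proof (intro integral_mono int)
    fix \<omega> :: "hypergraph \<times> hypergraph"
    obtain A1 A2 where \<omega>: "\<omega> = (A1, A2)" by (cases \<omega>)
    have "indicator {(A1, A2). real (?N A1 A2) < ?z} \<omega> \<le> exp (d * ?z) * exp (- d) ^ ?N A1 A2"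
    proof (cases "real (?N A1 A2) < ?z")
      case True
      then have "d * real (?N A1 A2) \<le> d * ?z" using d by (intro mult_left_mono) auto
      then have "1 \<le> exp (d * ?z + real (?N A1 A2) * (- d))" by (simp add: mult.commute)
      also have "\<dots> = exp (d * ?z) * exp (- d) ^ ?N A1 A2" by (simp only: exp_add exp_of_nat_mult)
      finally show ?thesis using True by (simp add: \<omega>)
    qed (simp add: \<omega>)
    from mult_left_mono[OF this ER_likelihood_nonneg[of m n \<pi> \<omega>]]
    show "?L \<omega> * indicator {(A1, A2). real (?N A1 A2) < ?z} \<omega> \<le>
        exp (d * ?z) * (?L \<omega> * (case \<omega> of (A1, A2) \<Rightarrow> exp (- d) ^ ?N A1 A2))"
      by (simp add: \<omega> mult.left_commute)
  qed
  also have "\<dots> = exp (d * ?z) * (1 + p * s\<^sup>2 * (exp (- d) - 1)) ^ (n choose m)"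
    using ER_alt_common_mgf[OF \<pi> order_refl, of m "exp (- d)"] by simp
  also have "\<dots> \<le> exp (d * ?z) * exp (p * s\<^sup>2 * (- d + d\<^sup>2 / 2)) ^ (n choose m)"
  proof (intro mult_left_mono power_mono)
    have "exp (- d) \<le> 1 + (- d + d\<^sup>2 / 2)"
    proof -
      define f where "f t = 1 - t + t\<^sup>2 / 2 - exp (- t)" for t :: real
      have "f 0 \<le> f d"
      proof (rule DERIV_nonneg_imp_nondecreasing[OF d])
        fix t :: real assume "0 \<le> t" "t \<le> d"
        have "(f has_real_derivative (- 1 + t + exp (- t))) (at t)"
          unfolding f_def by (auto intro!: derivative_eq_intros)
        moreover have "0 \<le> - 1 + t + exp (- t)" using exp_ge_add_one_self[of "- t"] by simp
        ultimately show "\<exists>y. (f has_real_derivative y) (at t) \<and> 0 \<le> y" by blast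
      qed
      then show ?thesis by (simp add: f_def)
    qed
    then have "p * s\<^sup>2 * (exp (- d) - 1) \<le> p * s\<^sup>2 * (- d + d\<^sup>2 / 2)"
      using p_pos by (intro mult_left_mono) auto
    then show "1 + p * s\<^sup>2 * (exp (- d) - 1) \<le> exp (p * s\<^sup>2 * (- d + d\<^sup>2 / 2))"
      using exp_ge_add_one_self[of "p * s\<^sup>2 * (- d + d\<^sup>2 / 2)"] by linarith
    \<comment> \<open>\<open>power_mono\<close> asks for a nonnegative base, which is not automatic
      with a negative tilt.\<close>
    have "p * s\<^sup>2 * 1 \<le> 1 * 1 * 1"
      using p_pos p_less s_nonneg s_le by (intro mult_mono) (auto simp: power_le_one)
    moreover have "p * s\<^sup>2 * (1 - exp (- d)) \<le> p * s\<^sup>2 * 1" using p_pos by (intro mult_left_mono) auto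
    ultimately have "p * s\<^sup>2 * (1 - exp (- d)) \<le> 1" by linarith
    then show "0 \<le> 1 + p * s\<^sup>2 * (exp (- d) - 1)" by (simp add: algebra_simps)
  qed simp
  also have "\<dots> = exp (d * ?z + real (n choose m) * (p * s\<^sup>2 * (- d + d\<^sup>2 / 2)))"
    by (simp only: exp_add exp_of_nat_mult)
  also have "d * ?z + real (n choose m) * (p * s\<^sup>2 * (- d + d\<^sup>2 / 2)) = - (\<mu> * d\<^sup>2 / 2)"
    by (simp add: \<mu>_def power2_eq_square algebra_simps)
  finally show ?thesis .
qed

text \<open>The tilt \<open>1 / p\<close>, the likelihood ratio of a common edge, is optimal for the
  Poisson tail at level \<open>\<mu>\<close>: it gives
  \<open>- \<mu> ln (1 / p) + \<mu> (1 - p) = - \<mu> * rate p\<close>. Stopping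
  \<open>d * \<mu>\<close> short of that level costs the last term.\<close>

lemma prob_null_many_common_edges_le:
  fixes m n :: nat
  assumes \<pi>: "\<pi> permutes {1..n}"
  defines "\<mu> \<equiv> (n choose m) * p * s\<^sup>2"
  shows "measure_pmf.prob (ER_null m n p s)
      {(A1, A2). (1 - d) * \<mu> \<le> real (card {e\<in>hyperedges m n. A1 e \<and> A2 (\<pi> ` e)})}
    \<le> exp (- (\<mu> * rate p) + d * \<mu> * ln (1 / p))"
proof -
  let ?E = "hyperedges m n"
  let ?N = "\<lambda>A1 A2. card {e\<in>?E. A1 e \<and> A2 (\<pi> ` e)}"
  let ?z = "(1 - d) * \<mu>"
  define L where "L = ln (1 / p)"
  have L: "0 < L" "exp L = 1 / p" using p_pos p_less by (auto simp: L_def)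
  note int = integrable_measure_pmf_finite[OF finite_set_ER_null]
  have "measure_pmf.prob (ER_null m n p s) {(A1, A2). ?z \<le> real (?N A1 A2)} =
    measure_pmf.expectation (ER_null m n p s) (\<lambda>\<omega>. indicator {(A1, A2). ?z \<le> real (?N A1 A2)} \<omega>)"
    by simp
  also have "\<dots> \<le> measure_pmf.expectation (ER_null m n p s)
      (\<lambda>\<omega>. exp (- (L * ?z)) * (case \<omega> of (A1, A2) \<Rightarrow> exp L ^ ?N A1 A2))"
  proof (intro integral_mono int)
    fix \<omega> :: "hypergraph \<times> hypergraph"
    obtain A1 A2 where \<omega>: "\<omega> = (A1, A2)" by (cases \<omega>)
    show "indicator {(A1, A2). ?z \<le> real (?N A1 A2)} \<omega> \<le>
        exp (- (L * ?z)) * (case \<omega> of (A1, A2) \<Rightarrow> exp L ^ ?N A1 A2)"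
    proof (cases "?z \<le> real (?N A1 A2)")
      case True
      then have "L * ?z \<le> L * real (?N A1 A2)" using L by (intro mult_left_mono) auto
      then have "1 \<le> exp (- (L * ?z) + real (?N A1 A2) * L)" by (simp add: mult.commute)
      also have "\<dots> = exp (- (L * ?z)) * exp L ^ ?N A1 A2" by (simp only: exp_add exp_of_nat_mult)
      finally show ?thesis using True by (simp add: \<omega>)
    qed (simp add: \<omega>)
  qed
  also have "\<dots> = exp (- (L * ?z)) * (1 + (p * s)\<^sup>2 * (exp L - 1)) ^ (n choose m)"
    using ER_null_common_mgf[OF \<pi> order_refl, of m "exp L"] by simp
  also have "\<dots> \<le> exp (- (L * ?z)) * exp ((p * s)\<^sup>2 * (exp L - 1)) ^ (n choose m)"
  proof (intro mult_left_mono power_mono exp_ge_add_one_self)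
    have "0 \<le> (p * s)\<^sup>2 * (exp L - 1)" using L(1) by simp
    then show "0 \<le> 1 + (p * s)\<^sup>2 * (exp L - 1)" by linarith
  qed simp
  also have "\<dots> = exp (- (L * ?z) + real (n choose m) * ((p * s)\<^sup>2 * (exp L - 1)))"
    by (simp only: exp_add exp_of_nat_mult)
  also have "- (L * ?z) + real (n choose m) * ((p * s)\<^sup>2 * (exp L - 1)) = - (\<mu> * rate p) + d * \<mu> * L"
    unfolding L(2) using p_pos by (simp add: \<mu>_def rate_def flip: L_def) (simp add: power2_eq_square field_simps)
  finally show ?thesis by (simp add: L_def)
qed

text \<open>
  Scan test: \<open>H0\<close> is rejected if some relabelling produces at least \<open>(1 - d) \<mu>\<close> shared edges,
  where \<open>\<mu>\<close> is the mean number of shared edges under \<open>H1\<close>.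
\<close>

lemma ER_TV_ge:
  fixes n m :: nat
  assumes d: "0 \<le> d"
  defines "\<mu> \<equiv> (n choose m) * p * s\<^sup>2"
  shows "1 - exp (- (\<mu> * d\<^sup>2 / 2)) - fact n * exp (- (\<mu> * rate p) + d * \<mu> * ln (1 / p)) \<le> ER_TV m n p s"
proof -
  let ?S = "{\<pi>. \<pi> permutes {1..n}}"
  let ?T = "\<lambda>\<pi>. {(A1, A2). (1 - d) * \<mu> \<le> real (card {e\<in>hyperedges m n. A1 e \<and> A2 (\<pi> ` e)})}"
  define T where "T = (\<Union>\<pi>\<in>?S. ?T \<pi>)"
  have finS: "finite ?S" by (simp add: finite_permutations)
  have cS: "card ?S = fact n" by (simp add: card_permutations)
  have "measure_pmf.prob (ER_null m n p s) T \<le> (\<Sum>\<pi>\<in>?S. measure_pmf.prob (ER_null m n p s) (?T \<pi>))"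
    unfolding T_def by (rule measure_pmf.finite_measure_subadditive_finite[OF finS]) auto
  also have "\<dots> \<le> (\<Sum>\<pi>\<in>?S. exp (- (\<mu> * rate p) + d * \<mu> * ln (1 / p)))"
    unfolding \<mu>_def by (intro sum_mono prob_null_many_common_edges_le) simp
  finally have 0: "measure_pmf.prob (ER_null m n p s) T \<le> fact n * exp (- (\<mu> * rate p) + d * \<mu> * ln (1 / p))"
    by (simp only: sum_constant cS of_nat_fact)
  have "(\<Sum>\<pi>\<in>?S. 1 - exp (- (\<mu> * d\<^sup>2 / 2))) \<le> (\<Sum>\<pi>\<in>?S. measure_pmf.prob (ER_alt_given m n p s \<pi>) T)"
  proof (rule sum_mono)
    fix \<pi> assume \<pi>: "\<pi> \<in> ?S"
    let ?Q = "measure_pmf.prob (ER_alt_given m n p s \<pi>)"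
    have "- ?T \<pi> = {(A1, A2). real (card {e\<in>hyperedges m n. A1 e \<and> A2 (\<pi> ` e)}) < (1 - d) * \<mu>}"
      by auto
    then have "?Q (- ?T \<pi>) \<le> exp (- (\<mu> * d\<^sup>2 / 2))"
      using prob_few_common_edges_le[OF _ d, of \<pi> n m] \<pi> by (simp add: \<mu>_def)
    then have "1 - exp (- (\<mu> * d\<^sup>2 / 2)) \<le> ?Q (?T \<pi>)"
      using measure_pmf.prob_compl[of "?T \<pi>" "ER_alt_given m n p s \<pi>"] by (simp add: Compl_eq_Diff_UNIV)
    also have "\<dots> \<le> ?Q T"
      using \<pi> by (intro measure_pmf.finite_measure_mono) (auto simp: T_def)
    finally show "1 - exp (- (\<mu> * d\<^sup>2 / 2)) \<le> ?Q T" .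
  qed
  then have "(\<Sum>\<pi>\<in>?S. 1 - exp (- (\<mu> * d\<^sup>2 / 2))) / fact n \<le> measure_pmf.prob (ER_alt m n p s) T"
    unfolding prob_ER_alt by (rule divide_right_mono) simp
  then have 1: "1 - exp (- (\<mu> * d\<^sup>2 / 2)) \<le> measure_pmf.prob (ER_alt m n p s) T"
    by (simp only: sum_constant cS of_nat_fact) simp
  have "measure_pmf.prob (ER_alt m n p s) T - measure_pmf.prob (ER_null m n p s) T \<le> ER_TV m n p s"
    using TV_ge[of "ER_null m n p s" T "ER_alt m n p s"] unfolding ER_TV_def by linarith
  with 0 1 show ?thesis by linarith
qed

end

lemma ER_TV_tendsto_1:
  fixes p s :: "nat \<Rightarrow> real"
  assumes m: "m \<ge> 1" and p: "\<And>n. 0 < p n \<and> p n < 1" and s: "\<And>n. 0 \<le> s n \<and> s n \<le> 1"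
    and ge: "\<forall>\<^sub>F n in sequentially. ER_threshold m n (p n) \<le> (s n)\<^sup>2"
  shows "(\<lambda>n. ER_TV m n (p n) (s n)) \<longlonglongrightarrow> 1"
proof (rule tendsto_sandwich[OF _ always_eventually])
  let ?lower = "\<lambda>n. 1 - exp (- (real n / (16 * ln n * (1 + 2 * real m * ln n)))) - real n * exp (1 - real n / 2)"
  have "(\<lambda>n :: nat. 1 - exp (- (real n / (16 * ln n * (1 + 2 * c * ln n)))) - real n * exp (1 - real n / 2)) \<longlonglongrightarrow> 1"
    if "c > 0" for c :: real
    using that by real_asymp
  then show "?lower \<longlonglongrightarrow> 1" using m by simp
  have "\<forall>\<^sub>F n :: nat in sequentially. ln (real n) \<ge> 1" by real_asymp
  then show "\<forall>\<^sub>F n in sequentially. ?lower n \<le> ER_TV m n (p n) (s n)"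
    using ge eventually_ge_at_top[of "max m 1"]
  proof eventually_elim
    case (elim n)
    then have n: "n \<ge> m" "n \<ge> 1" "0 < real n" and ln1: "1 \<le> ln (real n)" by auto
    interpret ER_params "p n" "s n" using p[of n] s[of n] by unfold_locales auto
    define h where "h = rate (p n)"
    define L where "L = ln (1 / p n)"
    define N where "N = real (n choose m)"
    define \<mu> where "\<mu> = N * p n * (s n)\<^sup>2"
    \<comment> \<open>Lowering the level costs \<open>d \<mu> L = \<mu> h / (2 ln n)\<close>. At
      \<open>\<mu> h = n ln n\<close> this is \<open>n / 2\<close>, half of the \<open>n\<close>
      that \<open>fact n\<close> leaves. The fluctuations under H1 require in addition that
      \<open>\<mu> d^2\<close> be large.\<close>
    define d where "d = h / (2 * ln n * L)"
    have h: "0 < h" using rate_pos p_pos p_less by (simp add: h_def)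
    have L: "0 < L" "p n = exp (- L)" using p_pos p_less by (simp_all add: L_def ln_div)
    have hL: "h < L" using rate_less p_less by (simp add: h_def L_def)
    have N: "0 < N" using n by (simp add: N_def)
    have "real n * ln n / (N * h * p n) \<le> (s n)\<^sup>2"
      using elim by (simp add: ER_threshold_def N_def h_def rate_def)
    then have \<mu>h: "real n * ln n \<le> \<mu> * h"
      using N h p_pos by (simp add: \<mu>_def field_simps)
    have \<mu>0: "0 \<le> \<mu>" using N p_pos by (simp add: \<mu>_def)
    have d0: "0 \<le> d" using h L ln1 by (simp add: d_def)
    \<comment> \<open>As \<open>s \<le> 1\<close>, reaching the threshold forces \<open>p\<close>
      not to be too small: \<open>n ln n \<le> n ^ m * p * L\<close>, and
      \<open>p * L \<le> exp (- L / 2)\<close>.\<close>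
    have Lle: "L \<le> 2 * m * ln n"
    proof -
      have "real n * ln n \<le> N * p n * L"
      proof -
        have "\<mu> * h \<le> (N * p n * 1) * L"
          unfolding \<mu>_def using N p_pos h hL s_nonneg s_le
          by (intro mult_mono mult_left_mono) (auto simp: power_le_one)
        then show ?thesis using \<mu>h by simp
      qed
      also have "\<dots> \<le> real n ^ m * (exp (- L) * L)"
      proof -
        have "n choose m \<le> n ^ m" using binomial_le_pow[OF n(1)] by simp
        then have "N \<le> real n ^ m" unfolding N_def by (metis of_nat_le_iff of_nat_power)
        then show ?thesis using L by (simp add: mult_right_mono mult.assoc)
      qed
      also have "exp (- L) * L \<le> exp (- (L / 2))"
      proof -
        have "L \<le> exp (L / 2)"
        proof -
          have "1 + L / 2 + (L / 2)\<^sup>2 / 2 \<le> exp (L / 2)" using exp_lower_Taylor_quadratic[of "L / 2"] L by simp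
          moreover have "L \<le> 1 + L / 2 + (L / 2)\<^sup>2 / 2"
            using zero_le_power2[of "L / 2 - 1"] by (simp add: power2_eq_square algebra_simps)
          ultimately show ?thesis by linarith
        qed
        then have "exp (- L) * L \<le> exp (- L) * exp (L / 2)" by (rule mult_left_mono) simp
        also have "\<dots> = exp (- (L / 2))" by (simp flip: exp_add)
        finally show ?thesis .
      qed
      finally have "real n * ln n \<le> real n ^ m * exp (- (L / 2))" using n by (simp add: mult_left_mono)
      moreover have "real n ^ m = exp (m * ln n)" using n by (simp add: exp_of_nat_mult)
      moreover have "1 * 1 \<le> real n * ln n" using n ln1 by (intro mult_mono) auto
      ultimately have "exp 0 \<le> exp (m * ln n + - (L / 2))" unfolding exp_add by simp
      then show ?thesis by simp
    qed
    \<comment> \<open>Up to the factor \<open>4 (ln n)^2\<close>, \<open>\<mu> d^2\<close> is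
      \<open>(\<mu> h) (h / L^2)\<close>. The first factor is at least \<open>n ln n\<close> and
      \<open>rate_ge\<close> bounds the second from below, so \<open>\<mu> d^2\<close> is at least
      of order \<open>n / (ln n)^2\<close>.\<close>
    have \<mu>d: "n / (8 * ln n * (1 + 2 * m * ln n)) \<le> \<mu> * d\<^sup>2"
    proof -
      have "1 / (2 * (1 + 2 * m * ln n)) \<le> 1 / (2 * (1 + L))"
        using L Lle by (intro divide_left_mono) auto
      also have "\<dots> \<le> h / L\<^sup>2"
        using rate_ge[OF p_pos p_less] L(1) by (simp add: h_def[symmetric] L_def[symmetric] field_simps)
      finally have hL2: "1 / (2 * (1 + 2 * m * ln n)) \<le> h / L\<^sup>2" .
      have "n / (8 * ln n * (1 + 2 * m * ln n)) = (n * ln n) * (1 / (2 * (1 + 2 * m * ln n))) / (4 * (ln n)\<^sup>2)"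
        using ln1 by (simp add: power2_eq_square)
      moreover have "(n * ln n) * (1 / (2 * (1 + 2 * m * ln n))) / (4 * (ln n)\<^sup>2) \<le> (\<mu> * h) * (h / L\<^sup>2) / (4 * (ln n)\<^sup>2)"
      proof (rule divide_right_mono)
        show "(n * ln n) * (1 / (2 * (1 + 2 * m * ln n))) \<le> (\<mu> * h) * (h / L\<^sup>2)"
          by (rule mult_mono[OF \<mu>h hL2]) (use \<mu>0 h ln1 in auto)
      qed simp
      moreover have "(\<mu> * h) * (h / L\<^sup>2) / (4 * (ln n)\<^sup>2) = \<mu> * d\<^sup>2"
        by (simp add: d_def power2_eq_square mult_ac)
      ultimately show ?thesis by linarith
    qed
    have "exp (- (\<mu> * d\<^sup>2 / 2)) \<le> exp (- (real n / (16 * ln n * (1 + 2 * real m * ln n))))"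
      using \<mu>d by simp
    moreover have "fact n * exp (- (\<mu> * h) + d * \<mu> * L) \<le> real n * exp (1 - real n / 2)"
    proof -
      have "d * \<mu> * L = \<mu> * h * (1 / (2 * ln n))" using L by (simp add: d_def)
      then have "- (\<mu> * h) + d * \<mu> * L = - (\<mu> * h) * (1 - 1 / (2 * ln n))" by (simp add: algebra_simps)
      also have "\<dots> \<le> - (real n * ln n) * (1 - 1 / (2 * ln n))"
        using \<mu>h ln1 by (intro mult_right_mono) auto
      also have "\<dots> = - (real n * ln n) + real n / 2" using ln1 by (simp add: algebra_simps)
      finally have "fact n * exp (- (\<mu> * h) + d * \<mu> * L) \<le>
          (real n * exp (real n * ln n - real n + 1)) * exp (- (real n * ln n) + real n / 2)"
        using fact_le_exp[OF n(2)] by (intro mult_mono) auto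
      also have "\<dots> = real n * exp ((real n * ln n - real n + 1) + (- (real n * ln n) + real n / 2))"
        by (simp only: exp_add mult.assoc)
      finally show ?thesis by (simp add: algebra_simps)
    qed
    ultimately show ?case
      using ER_TV_ge[OF d0, of n m] by (simp only: \<mu>_def N_def h_def L_def)
  qed
  show "\<forall>n. ER_TV m n (p n) (s n) \<le> 1" unfolding ER_TV_def by (intro allI TV_le_1)
  show "(\<lambda>n. 1) \<longlonglongrightarrow> (1 :: real)" by simp
qed

section \<open>Impossibility below the threshold\<close>

lemma binomial_ratio_real_le:
  assumes "k \<le> n" "m \<ge> 2" "n \<ge> 1"
  shows "real (k choose m) \<le> (k / n)\<^sup>2 * real (n choose m)"
proof -
  have "real ((k choose m) * n\<^sup>2) \<le> real (k\<^sup>2 * (n choose m))"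
    using binomial_ratio_le_square[OF assms(1,2)] by (simp only: of_nat_le_iff)
  then show ?thesis using assms by (simp add: field_simps)
qed

lemma binomial_le_exp:
  assumes "k \<in> {1..n}"
  shows "real (n choose k) \<le> exp (k * (1 + ln (n / k)))"
proof -
  have k: "0 < real k" "0 < real n" using assms by auto
  have "(n choose k) * fact k \<le> n ^ k" using assms by (intro binomial_fact_pow)
  then have "real ((n choose k) * fact k) \<le> real (n ^ k)" by (simp only: of_nat_le_iff)
  then have "real (n choose k) * fact k \<le> exp (k * ln n)" using k by (simp add: exp_of_nat_mult)
  moreover have "real (n choose k) * exp (k * ln k - k) \<le> real (n choose k) * fact k"
    by (intro mult_left_mono exp_le_fact) simp
  ultimately have "real (n choose k) \<le> exp (k * ln n) / exp (k * ln k - k)" by (simp add: field_simps)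
  also have "\<dots> = exp (k * (1 + ln (n / k)))"
    using k by (simp add: exp_diff[symmetric] ln_div algebra_simps)
  finally show ?thesis .
qed

lemma exp_quadratic_le:
  fixes t :: real
  assumes "0 \<le> t"
  shows "exp t - 1 - t \<le> t\<^sup>2 * exp t"
proof -
  have "exp t * (1 - t) \<le> exp t * exp (- t)"
    using exp_ge_add_one_self[of "- t"] by (intro mult_left_mono) auto
  then have e: "exp t - 1 \<le> t * exp t" by (simp add: algebra_simps flip: exp_add)
  then have "t * (exp t - 1) \<le> t * (t * exp t)" by (rule mult_left_mono) (rule assms)
  then have "t * exp t - t \<le> t\<^sup>2 * exp t" by (simp add: power2_eq_square algebra_simps)
  with e show ?thesis by linarith
qed

context ER_params
begin

text \<open>
  The exponential tilt \<open>\<theta>\<close> has to grow like \<open>ln (n / k)\<close>, since \<open>ln n / ln (1 / p)\<close> may tend to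
  infinity arbitrarily slowly and must beat the entropy \<open>k (1 + ln (n / k))\<close> of the choice of a \<open>k\<close>-set.
\<close>

lemma truncation_tail_le:
  fixes m n k :: nat and c a C :: real
  defines "L \<equiv> ln (1 / p)" and "\<theta> \<equiv> c * (1 + ln (n / k))" and "\<mu> \<equiv> real (k choose m) * p * s\<^sup>2"
  assumes k: "k \<in> {1..n}" and m: "m \<ge> 2"
    and C: "0 \<le> C" "L \<le> C * rate p" and sp: "(n choose m) * p * s\<^sup>2 * rate p \<le> n * ln n"
    and c: "0 < c" "c \<le> 1 / 2" "4 * C * c \<le> a" and K: "1 \<le> c * a / 2 * (ln n / L)"
  shows "(n choose k) * exp (- \<theta> * (\<mu> + a * (k * ln n / L)) + \<mu> * (exp \<theta> - 1))
    \<le> exp (1 - c * a / 2 * (ln n / L)) ^ k"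
proof -
  define w where "w = 1 + ln (n / k)"
  define B where "B = k * ln n / L"
  have kn: "0 < real k" "real k \<le> real n" "0 < real n" "1 \<le> n" using k by auto
  have L: "0 < L" using p_pos p_less by (simp add: L_def)
  have h: "0 < rate p" using rate_pos p_pos p_less .
  have w: "1 \<le> w" using kn by (simp add: w_def)
  have \<theta>: "\<theta> = c * w" "0 \<le> \<theta>" using c w by (simp_all add: \<theta>_def w_def)
  have B: "0 \<le> B" using kn L by (simp add: B_def)
  have \<mu>0: "0 \<le> \<mu>" using p_pos by (simp add: \<mu>_def)
  have "(n choose m) * p * s\<^sup>2 \<le> n * ln n / rate p" using sp h by (simp add: field_simps)
  also have "\<dots> \<le> C * (n * ln n) / L"
  proof -
    have "(n * ln n) * L \<le> (n * ln n) * (C * rate p)" using C kn by (intro mult_left_mono) auto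
    then show ?thesis using h L by (simp add: field_simps)
  qed
  finally have Np: "(n choose m) * p * s\<^sup>2 \<le> C * (n * ln n) / L" .
  \<comment> \<open>The quadratic binomial ratio leaves a factor \<open>k / n = exp (1 - w)\<close>
    beyond the scale \<open>B\<close> of the slack; it pays for \<open>exp \<theta>\<close> in the
    second-order error of the tilt.\<close>
  have "\<mu> \<le> (k / n)\<^sup>2 * real (n choose m) * p * s\<^sup>2"
    unfolding \<mu>_def using binomial_ratio_real_le[of k n m] k m p_pos by (intro mult_right_mono) auto
  also have "\<dots> = (k / n)\<^sup>2 * (real (n choose m) * p * s\<^sup>2)" by simp
  also have "\<dots> \<le> (k / n)\<^sup>2 * (C * (n * ln n) / L)" by (intro mult_left_mono Np) simp
  also have "\<dots> = (k / n) * (C * B)" using kn by (simp add: B_def power2_eq_square)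
  also have "real k / n = exp (1 - w)" using kn by (simp add: w_def ln_div exp_diff)
  finally have \<mu>: "\<mu> \<le> exp (1 - w) * (C * B)" .
  \<comment> \<open>Since \<open>\<theta> = c w\<close> with \<open>c \<le> 1 / 2\<close>,
    \<open>exp \<theta>\<close> uses up at most half of the decay in \<open>w\<close>, and
    \<open>w exp (1 - w / 2) \<le> 2\<close>.\<close>
  have wexp: "\<theta> * exp \<theta> * exp (1 - w) \<le> 2 * c"
  proof -
    have "w \<le> 2 * exp (w / 2 - 1)" using exp_ge_add_one_self[of "w / 2 - 1"] by linarith
    then have "w * exp (1 - w / 2) \<le> 2 * exp (w / 2 - 1) * exp (1 - w / 2)" by (rule mult_right_mono) simp
    also have "\<dots> = 2" by (simp flip: exp_add)
    finally have w2: "w * exp (1 - w / 2) \<le> 2" .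
    have "c * w \<le> 1 / 2 * w" using c w by (intro mult_right_mono) auto
    then have "exp (\<theta> + (1 - w)) \<le> exp (1 - w / 2)" by (simp add: \<theta>)
    then have "\<theta> * exp (\<theta> + (1 - w)) \<le> \<theta> * exp (1 - w / 2)" using \<theta> by (intro mult_left_mono) auto
    also have "\<dots> = c * (w * exp (1 - w / 2))" by (simp add: \<theta>)
    also have "\<dots> \<le> c * 2" using w2 c by (intro mult_left_mono) auto
    finally show ?thesis by (simp add: exp_add mult_ac)
  qed
  have "\<mu> * (exp \<theta> - 1 - \<theta>) \<le> \<mu> * (\<theta>\<^sup>2 * exp \<theta>)"
    by (intro mult_left_mono exp_quadratic_le \<theta> \<mu>0)
  also have "\<dots> \<le> exp (1 - w) * (C * B) * (\<theta>\<^sup>2 * exp \<theta>)" by (intro mult_right_mono \<mu>) simp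
  also have "\<dots> = (\<theta> * exp \<theta> * exp (1 - w)) * (\<theta> * (C * B))" by (simp add: power2_eq_square)
  also have "\<dots> \<le> 2 * c * (\<theta> * (C * B))" using wexp \<theta> C B by (intro mult_right_mono) auto
  \<comment> \<open>The bound on \<open>4 C c\<close> is imposed so that the second-order error
    takes at most half of the gain \<open>a \<theta> B\<close>.\<close>
  also have "\<dots> = (4 * C * c) * (\<theta> * B / 2)" by simp
  also have "\<dots> \<le> a * (\<theta> * B / 2)" using c \<theta> B by (intro mult_right_mono) auto
  finally have "- \<theta> * (\<mu> + a * B) + \<mu> * (exp \<theta> - 1) \<le> - (a * \<theta> * B / 2)" by (simp add: algebra_simps)
  also have "a * \<theta> * B / 2 = k * w * (c * a / 2 * (ln n / L))" by (simp add: \<theta> B_def mult_ac)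
  finally have "(n choose k) * exp (- \<theta> * (\<mu> + a * B) + \<mu> * (exp \<theta> - 1)) \<le>
      exp (k * w) * exp (- (k * w * (c * a / 2 * (ln n / L))))"
    using binomial_le_exp[OF k] by (intro mult_mono) (auto simp: w_def)
  also have "\<dots> = exp (k * (w * (1 - c * a / 2 * (ln n / L))))"
    by (simp add: algebra_simps flip: exp_add)
  \<comment> \<open>\<open>K\<close> makes the bracket nonpositive, so \<open>w \<ge> 1\<close> may
    be replaced by 1: the entropy \<open>k w\<close> is paid for.\<close>
  also have "\<dots> \<le> exp (k * (1 * (1 - c * a / 2 * (ln n / L))))"
    using K w unfolding exp_le_cancel_iff by (intro mult_left_mono mult_right_mono_neg) auto
  also have "\<dots> = exp (1 - c * a / 2 * (ln n / L)) ^ k" by (simp add: exp_of_nat_mult)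
  finally show ?thesis by (simp add: B_def)
qed

text \<open>\<open>ln (1 / p)\<close> from the truncation and \<open>- (1 - p)\<close> from the
  tilted second moment combine to \<open>rate p\<close>. Of the margin \<open>\<epsilon>\<close>,
  one quarter goes to the error \<open>2 s + s^2\<close>, one quarter to the slack in
  \<open>\<zeta>\<close>, and \<open>\<epsilon> / 2\<close> remains.\<close>

lemma truncated_moment_le:
  fixes m n k :: nat and \<epsilon> :: real
  defines "L \<equiv> ln (1 / p)"
  defines "\<zeta> \<equiv> \<lambda>k. real (k choose m) * p * s\<^sup>2 + \<epsilon> / 4 * (k * ln n / L)"
  assumes k: "k \<in> {1..n}" and m: "m \<ge> 2" and \<epsilon>: "0 < \<epsilon>" "\<epsilon> \<le> 1"
    and sp: "(n choose m) * p * s\<^sup>2 * rate p \<le> (1 - \<epsilon>) * (n * ln n)" and s: "3 * s \<le> \<epsilon> / 4 * rate p"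
  shows "p powr (- \<zeta> k) *
    edge_mean (p * s) (\<lambda>a b. (ER_ratio p s a b)\<^sup>2 * (if a \<and> b then p else 1)) ^ (k choose m)
    \<le> exp ((1 - \<epsilon> / 2) * (k * ln n))"
proof -
  let ?c = "real (k choose m)"
  have L: "0 < L" "ln p = - L" using p_pos p_less by (simp_all add: L_def ln_div)
  have h: "0 < rate p" using rate_pos p_pos p_less .
  have kn: "0 < real k" "real k \<le> real n" "0 < real n" using k by auto
  have y0: "0 \<le> edge_mean (p * s) (\<lambda>a b. (ER_ratio p s a b)\<^sup>2 * (if a \<and> b then p else 1))"
    using ps_bounds p_pos by (auto simp: edge_mean_def)
  have "p powr (- \<zeta> k) = exp (\<zeta> k * L)" using p_pos L by (simp add: powr_def)
  then have "p powr (- \<zeta> k) *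
    edge_mean (p * s) (\<lambda>a b. (ER_ratio p s a b)\<^sup>2 * (if a \<and> b then p else 1)) ^ (k choose m)
    \<le> exp (\<zeta> k * L) * exp (- (p * s\<^sup>2 * ((1 - p) - 2 * s - s\<^sup>2))) ^ (k choose m)"
    using y0 edge_mean_ratio_square_le by (auto intro!: mult_left_mono power_mono)
  also have "\<dots> = exp (\<zeta> k * L + ?c * - (p * s\<^sup>2 * ((1 - p) - 2 * s - s\<^sup>2)))"
    by (simp only: exp_add exp_of_nat_mult)
  also have "\<zeta> k * L = ?c * p * s\<^sup>2 * L + \<epsilon> / 4 * (k * ln n)"
    using L by (simp add: \<zeta>_def algebra_simps)
  also have "?c * p * s\<^sup>2 * L + \<epsilon> / 4 * (k * ln n) + ?c * - (p * s\<^sup>2 * ((1 - p) - 2 * s - s\<^sup>2)) =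
      (?c * p * s\<^sup>2) * (rate p + 2 * s + s\<^sup>2) + \<epsilon> / 4 * (k * ln n)"
    by (simp add: rate_def algebra_simps flip: L_def)
  also have "\<dots> \<le> (1 - \<epsilon> / 2) * (k * ln n)"
  proof -
    have "s\<^sup>2 \<le> s * 1" unfolding power2_eq_square using s_nonneg s_le by (intro mult_left_mono) auto
    then have "rate p + 2 * s + s\<^sup>2 \<le> (1 + \<epsilon> / 4) * rate p" using s by (simp add: algebra_simps)
    then have "(?c * p * s\<^sup>2) * (rate p + 2 * s + s\<^sup>2) \<le> (?c * p * s\<^sup>2) * ((1 + \<epsilon> / 4) * rate p)"
      using p_pos by (intro mult_left_mono) auto
    also have "\<dots> = ?c * (p * s\<^sup>2 * rate p * (1 + \<epsilon> / 4))" by simp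
    also have "\<dots> \<le> (k / n * (n choose m)) * (p * s\<^sup>2 * rate p * (1 + \<epsilon> / 4))"
    proof (rule mult_right_mono)
      have "(k choose m) * n \<le> k * (n choose m)" using k m by (intro binomial_ratio_le) auto
      then have "real ((k choose m) * n) \<le> real (k * (n choose m))" by (simp only: of_nat_le_iff)
      then show "?c \<le> k / n * (n choose m)" using kn by (simp add: field_simps)
      show "0 \<le> p * s\<^sup>2 * rate p * (1 + \<epsilon> / 4)" using p_pos h \<epsilon> by simp
    qed
    also have "\<dots> = (k / n * (1 + \<epsilon> / 4)) * ((n choose m) * p * s\<^sup>2 * rate p)" by simp
    also have "\<dots> \<le> (k / n * (1 + \<epsilon> / 4)) * ((1 - \<epsilon>) * (n * ln n))"
      using \<epsilon> by (intro mult_left_mono sp) auto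
    also have "\<dots> = ((1 + \<epsilon> / 4) * (1 - \<epsilon>)) * (k * ln n)" using kn by simp
    also have "\<dots> \<le> (1 - 3 * \<epsilon> / 4) * (k * ln n)"
      using \<epsilon> kn by (intro mult_right_mono) (auto simp: algebra_simps)
    finally show ?thesis by (simp add: algebra_simps)
  qed
  finally show ?thesis by simp
qed


text \<open>All exponents come from \<open>\<rho>^2 (n choose m) \<le> n powr (33 / 32)\<close> and
  \<open>n ^ m \<le> M (n choose m)\<close>: then \<open>\<rho>^2\<close>,
  \<open>\<rho>^4 (n choose m)\<close> and \<open>\<rho>^6 (n choose m)\<close> are bounded by
  multiples of the powers \<open>- 31 / 32\<close>, \<open>1 / 16\<close> and
  \<open>- 29 / 32\<close> of \<open>n\<close>. The result is useful if \<open>a^2\<close> is small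
  against \<open>n powr (31 / 32)\<close> while \<open>fact u\<close> and \<open>exp k0\<close>
  outweigh \<open>exp\<close> of a multiple of \<open>n powr (1 / 16)\<close>.\<close>

lemma overlap_average_le:
  fixes m n u k0 a :: nat and \<epsilon> \<nu> M :: real
  defines "L \<equiv> ln (1 / p)"
  defines "\<zeta> \<equiv> \<lambda>k. real (k choose m) * p * s\<^sup>2 + \<epsilon> / 4 * (k * ln n / L)"
    and "M \<equiv> real m ^ m" and "a \<equiv> (2 * m) * ((2 * m) * u)"
  assumes m: "m \<ge> 2" and n: "n \<ge> m" and \<epsilon>: "0 < \<epsilon>" "\<epsilon> \<le> 1"
    and sp: "(n choose m) * p * s\<^sup>2 * rate p \<le> (1 - \<epsilon>) * (n * ln n)" and s: "3 * s \<le> \<epsilon> / 4 * rate p"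
    and \<nu>: "\<nu> \<le> \<epsilon> / 4" "\<nu> \<le> 1 / 32" and sN: "s\<^sup>2 * (n choose m) \<le> n powr (1 + \<nu>)"
    and u: "u \<ge> 1" "a \<le> n" and k0: "k0 \<ge> 1" "ln k0 \<ge> 3" "k0 \<le> n" "real k0 ^ 2 \<le> n powr (31 / 32)"
    and ln: "\<epsilon> / 4 * ln n \<ge> 2"
  shows "(\<Sum>\<sigma> | \<sigma> permutes {1..n}. overlap_moment m n \<zeta> \<sigma>) / fact n \<le>
    exp (real a ^ 2 * n powr - (31 / 32) + M\<^sup>2 * n powr - (29 / 32))
    + exp (1 + 2 * m * M * n powr (1 / 16)) * (2 * m * n) / fact u
    + n\<^sup>2 * exp (2 * m * M * n powr (1 / 16) - k0)"
proof -
  define N where "N = real (n choose m)"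
  define cr where "cr = \<rho>\<^sup>2 * (m * n ^ (m - 1)) + \<rho> ^ 4 * N"
  define cr' where "cr' = 2 * m * M * n powr (1 / 16)"
  have n1: "n \<ge> 1" "1 \<le> real n" "0 < real n" and m0: "1 \<le> real m" using n m by auto
  have N: "0 < N" using n by (simp add: N_def)
  have M1: "1 \<le> M" using m0 by (simp add: M_def one_le_power)
  have rs: "\<rho>\<^sup>2 \<le> s\<^sup>2" using \<rho>_bounds by (intro power_mono) auto
  have pw: "n powr x \<le> n powr y" if "x \<le> y" for x y using that n1 by (intro powr_mono) auto
  have rN: "\<rho>\<^sup>2 * N \<le> n powr (33 / 32)"
  proof -
    have "\<rho>\<^sup>2 * N \<le> s\<^sup>2 * N" using rs N by (intro mult_right_mono) auto
    also have "\<dots> \<le> n powr (1 + \<nu>)" using sN by (simp add: N_def)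
    also have "\<dots> \<le> n powr (33 / 32)" using \<nu> by (intro pw) simp
    finally show ?thesis .
  qed
  have Nlow: "n powr m \<le> M * N"
  proof -
    have "(real n / real m) ^ m \<le> N" unfolding N_def using n by (rule binomial_ge_n_over_k_pow_k)
    then have "real n ^ m \<le> M * N" using m0 by (simp add: M_def power_divide field_simps)
    then show ?thesis using n1 by (simp add: powr_realpow)
  qed
  have r1: "\<rho>\<^sup>2 \<le> M * n powr (33 / 32 - m)"
  proof -
    have "\<rho>\<^sup>2 * n powr m \<le> \<rho>\<^sup>2 * (M * N)" using Nlow by (intro mult_left_mono) auto
    also have "\<dots> = M * (\<rho>\<^sup>2 * N)" by simp
    also have "\<dots> \<le> M * n powr (33 / 32)" using rN M1 by (intro mult_left_mono) auto
    finally have "\<rho>\<^sup>2 \<le> M * n powr (33 / 32) / n powr m" using n1 by (simp add: pos_le_divide_eq)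
    then show ?thesis by (simp only: powr_diff times_divide_eq_right)
  qed
  have r2: "\<rho>\<^sup>2 \<le> M * n powr - (31 / 32)"
  proof -
    have "M * n powr (33 / 32 - m) \<le> M * n powr - (31 / 32)" using M1 m by (intro mult_left_mono pw) auto
    with r1 show ?thesis by linarith
  qed
  \<comment> \<open>\<open>cr\<close> collects the edges not spanned by fixed points: those mapped
    to themselves cost \<open>n powr (1 / 32)\<close>, those moved cost
    \<open>n powr (1 / 16)\<close>, up to constants.\<close>
  have cr: "cr \<le> cr'"
  proof -
    have "\<rho>\<^sup>2 * (m * n ^ (m - 1)) \<le> (M * n powr (33 / 32 - m)) * (m * n powr (real m - 1))"
    proof -
      have "real n ^ (m - 1) = n powr (real m - 1)" using n1 m by (simp add: powr_realpow[symmetric] of_nat_diff)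
      then show ?thesis using r1 by (simp add: mult_right_mono)
    qed
    also have "\<dots> = m * M * (n powr (33 / 32 - m) * n powr (real m - 1))" by simp
    also have "n powr (33 / 32 - m) * n powr (real m - 1) = n powr (1 / 32)" by (simp flip: powr_add)
    also have "real m * M * n powr (1 / 32) \<le> m * M * n powr (1 / 16)"
      using M1 m0 by (intro mult_left_mono pw) auto
    finally have 1: "\<rho>\<^sup>2 * (m * n ^ (m - 1)) \<le> m * M * n powr (1 / 16)" .
    have "\<rho> ^ 4 * N = \<rho>\<^sup>2 * (\<rho>\<^sup>2 * N)" by (simp add: power_numeral_reduce power2_eq_square)
    also have "\<dots> \<le> (M * n powr - (31 / 32)) * n powr (33 / 32)"
      using r2 rN N M1 by (intro mult_mono) auto
    also have "\<dots> = M * n powr (1 / 16)" by (simp flip: powr_add)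
    also have "\<dots> = 1 * (M * n powr (1 / 16))" by simp
    also have "\<dots> \<le> m * (M * n powr (1 / 16))" using m0 M1 by (intro mult_right_mono) auto
    finally show ?thesis using 1 by (simp add: cr_def cr'_def)
  qed
  have rC: "\<rho>\<^sup>2 * (k choose m) \<le> (k / n)\<^sup>2 * n powr (1 + \<nu>)" if "k \<le> n" for k
  proof -
    have "\<rho>\<^sup>2 * (k choose m) \<le> s\<^sup>2 * ((k / n)\<^sup>2 * N)"
      unfolding N_def using rs binomial_ratio_real_le[OF that m n1(1)] by (intro mult_mono) auto
    also have "\<dots> = (k / n)\<^sup>2 * (s\<^sup>2 * N)" by simp
    also have "\<dots> \<le> (k / n)\<^sup>2 * n powr (1 + \<nu>)" using sN by (intro mult_left_mono) (auto simp: N_def)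
    finally show ?thesis .
  qed
  have rC': "\<rho>\<^sup>2 * (k choose m) \<le> real k ^ 2 * n powr - (31 / 32)" if "k \<le> n" for k
  proof -
    have "(k / n)\<^sup>2 * n powr (1 + \<nu>) \<le> (k / n)\<^sup>2 * n powr (33 / 32)" using \<nu> by (intro mult_left_mono pw) auto
    also have "\<dots> = real k ^ 2 * (n powr (33 / 32) / n powr 2)" using n1 by (simp add: power_divide powr_realpow[of _ 2, simplified])
    also have "n powr (33 / 32) / n powr 2 = n powr - (31 / 32)" by (simp only: powr_diff[symmetric]) simp
    finally show ?thesis using rC[OF that] by linarith
  qed
  have avg: "(\<Sum>\<sigma> | \<sigma> permutes {1..n}. overlap_moment m n \<zeta> \<sigma>) / fact n \<le>
      exp (real a ^ 2 * n powr - (31 / 32) + M\<^sup>2 * n powr - (29 / 32)) + exp (1 + cr') * (2 * m * n) / fact u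
      + (\<Sum>k\<in>{k0..n}. (fact k * exp (cr' - k)) * n / fact k)"
  proof (rule average_over_permutations_le)
    show "1 \<le> m" "1 \<le> u" "1 \<le> k0" using m u k0 by auto
    fix \<sigma> assume \<sigma>: "\<sigma> permutes {1..n}"
    {
      assume short: "card (short_cycle_points (2 * m) \<sigma> {1..n}) < (2 * m) * ((2 * m) * u)"
      let ?v = "card (short_cycle_points (2 * m) \<sigma> {1..n})"
      have "overlap_moment m n \<zeta> \<sigma> \<le> exp (\<rho>\<^sup>2 * (?v choose m) + (\<rho>\<^sup>2) ^ 3 * N)"
        unfolding N_def by (rule overlap_moment_le_short_cycles[OF \<sigma>])
      also have "\<dots> \<le> exp (real a ^ 2 * n powr - (31 / 32) + M\<^sup>2 * n powr - (29 / 32))"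
        unfolding exp_le_cancel_iff
      proof (rule add_mono)
        have "\<rho>\<^sup>2 * (?v choose m) \<le> \<rho>\<^sup>2 * (a choose m)"
          using short binomial_right_mono[of ?v a m] by (intro mult_left_mono) (auto simp: a_def)
        also have "\<dots> \<le> real a ^ 2 * n powr - (31 / 32)" by (rule rC'[OF u(2)])
        finally show "\<rho>\<^sup>2 * (?v choose m) \<le> real a ^ 2 * n powr - (31 / 32)" .
        have "(\<rho>\<^sup>2) ^ 3 * N = (\<rho>\<^sup>2 * \<rho>\<^sup>2) * (\<rho>\<^sup>2 * N)" by (simp add: power_numeral_reduce)
        also have "\<dots> \<le> ((M * n powr - (31 / 32)) * (M * n powr - (31 / 32))) * n powr (33 / 32)"
          using r2 rN N M1 by (intro mult_mono) auto
        also have "\<dots> = M\<^sup>2 * (n powr - (31 / 32) * n powr - (31 / 32) * n powr (33 / 32))"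
          by (simp add: power2_eq_square)
        also have "n powr - (31 / 32) * n powr - (31 / 32) * n powr (33 / 32) = n powr - (29 / 32)"
          by (simp flip: powr_add)
        finally show "(\<rho>\<^sup>2) ^ 3 * N \<le> M\<^sup>2 * n powr - (29 / 32)" .
      qed
      finally show "overlap_moment m n \<zeta> \<sigma> \<le> exp (real a ^ 2 * n powr - (31 / 32) + M\<^sup>2 * n powr - (29 / 32))" .
    }
    let ?k = "card (fixed_points n \<sigma>)"
    have kn: "?k \<le> n" by (rule fixed_points_subset)
    have fixed: "overlap_moment m n \<zeta> \<sigma> \<le> exp (\<rho>\<^sup>2 * (?k choose m) + cr)"
      unfolding cr_def N_def using m by (intro overlap_moment_le_fixed_points[OF \<sigma>]) simp
    {
      \<comment> \<open>Edges spanned by fewer than \<open>k0\<close> fixed points are worth at most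
        1 in the exponent.\<close>
      assume k: "?k < k0"
      have "\<rho>\<^sup>2 * (?k choose m) \<le> real ?k ^ 2 * n powr - (31 / 32)" by (rule rC'[OF kn])
      also have "\<dots> \<le> real k0 ^ 2 * n powr - (31 / 32)" using k by (intro mult_right_mono power_mono) auto
      also have "\<dots> \<le> n powr (31 / 32) * n powr - (31 / 32)" using k0 by (intro mult_right_mono) auto
      also have "\<dots> = 1" using n1 by (simp flip: powr_add)
      finally have "exp (\<rho>\<^sup>2 * (?k choose m) + cr) \<le> exp (1 + cr')" using cr by simp
      with fixed show "overlap_moment m n \<zeta> \<sigma> \<le> exp (1 + cr')" by linarith
    }
    {
      assume k: "k0 \<le> ?k"
      have k1: "?k \<ge> 1" "0 < real ?k" using k k0 by auto
      have lnk: "3 \<le> ln ?k"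
      proof -
        have "ln (real k0) \<le> ln (real ?k)" using k k0(1) by (intro ln_mono) auto
        then show ?thesis using k0(2) by linarith
      qed
      \<comment> \<open>Of the \<open>- 2 k\<close>, half is consumed by \<open>exp_le_fact\<close>
        and half is left against \<open>cr'\<close>. Up to
        \<open>k = n powr (1 - \<epsilon> / 4)\<close> the plain second moment is enough, because
        edges spanned by the fixed points contribute at most \<open>k\<close>. Beyond that, the
        truncated bound \<open>(1 - \<epsilon> / 2) k ln n\<close> lies at least
        \<open>(\<epsilon> / 4) k ln n \<ge> 2 k\<close> below \<open>k ln k\<close>.\<close>
      have "overlap_moment m n \<zeta> \<sigma> \<le> exp (?k * ln ?k - 2 * ?k + cr)"
      proof (cases "ln ?k \<le> (1 - \<epsilon> / 4) * ln n")
        case True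
        have "real ?k = exp (ln ?k)" using k1 by simp
        also have "\<dots> \<le> n powr (1 - \<epsilon> / 4)" using True n1 by (simp add: powr_def)
        finally have kle: "real ?k \<le> n powr (1 - \<epsilon> / 4)" .
        have "\<rho>\<^sup>2 * (?k choose m) \<le> (?k / n)\<^sup>2 * n powr (1 + \<nu>)" by (rule rC[OF kn])
        also have "\<dots> = ?k * (?k * (n powr (1 + \<nu>) / n powr 2))"
          using n1 by (simp add: power2_eq_square powr_realpow[of _ 2, simplified])
        also have "\<dots> \<le> ?k * (n powr (1 - \<epsilon> / 4) * (n powr (1 + \<nu>) / n powr 2))"
          using kle by (intro mult_left_mono mult_right_mono) auto
        also have "n powr (1 - \<epsilon> / 4) * (n powr (1 + \<nu>) / n powr 2) = n powr (\<nu> - \<epsilon> / 4)"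
          by (simp only: powr_diff[symmetric] powr_add[symmetric]) (simp add: algebra_simps)
        also have "?k * n powr (\<nu> - \<epsilon> / 4) \<le> ?k * n powr 0" using \<nu> by (intro mult_left_mono pw) auto
        also have "\<dots> = 1 * real ?k" using n1 by simp
        also have "\<dots> \<le> (ln ?k - 2) * ?k" using lnk by (intro mult_right_mono) auto
        finally have "\<rho>\<^sup>2 * (?k choose m) \<le> ?k * ln ?k - 2 * ?k" by (simp add: algebra_simps)
        then have "exp (\<rho>\<^sup>2 * (?k choose m) + cr) \<le> exp (?k * ln ?k - 2 * ?k + cr)" by simp
        with fixed show ?thesis by linarith
      next
        case False
        have "overlap_moment m n \<zeta> \<sigma> \<le> p powr (- \<zeta> ?k) *
          edge_mean (p * s) (\<lambda>a b. (ER_ratio p s a b)\<^sup>2 * (if a \<and> b then p else 1)) ^ (?k choose m) * exp cr"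
          unfolding cr_def N_def using m by (intro overlap_moment_le_truncated[OF \<sigma>]) simp
        also have "\<dots> \<le> exp ((1 - \<epsilon> / 2) * (?k * ln n)) * exp cr"
          unfolding \<zeta>_def L_def using k1 kn m \<epsilon> sp s
          by (intro mult_right_mono truncated_moment_le) auto
        also have "\<dots> \<le> exp (?k * ln ?k - 2 * ?k) * exp cr"
        proof -
          have "(1 - \<epsilon> / 2) * ln n \<le> ln ?k - 2" using False ln by (simp add: algebra_simps)
          then have "?k * ((1 - \<epsilon> / 2) * ln n) \<le> ?k * (ln ?k - 2)" by (intro mult_left_mono) auto
          then show ?thesis by (simp add: algebra_simps)
        qed
        finally show ?thesis by (simp add: exp_add)
      qed
      also have "\<dots> \<le> exp (?k * ln ?k - 2 * ?k + cr')" using cr by simp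
      also have "\<dots> = exp (?k * ln ?k - ?k) * exp (cr' - ?k)" by (simp flip: exp_add)
      also have "\<dots> \<le> fact ?k * exp (cr' - ?k)" by (intro mult_right_mono exp_le_fact) simp
      finally show "overlap_moment m n \<zeta> \<sigma> \<le> fact ?k * exp (cr' - ?k)" .
    }
  qed auto
  have "(\<Sum>k\<in>{k0..n}. (fact k * exp (cr' - k)) * n / fact k) \<le> (\<Sum>k\<in>{k0..n}. n * exp (cr' - k0))"
    by (intro sum_mono) (simp add: mult_left_mono mult.commute)
  also have "\<dots> = real (card {k0..n}) * (n * exp (cr' - k0))" by (rule sum_constant)
  also have "\<dots> \<le> n * (n * exp (cr' - k0))" using k0 by (intro mult_right_mono) auto
  finally show ?thesis using avg by (simp add: cr'_def power2_eq_square)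
qed

end

text \<open>The two assumptions on \<open>p\<close> act separately. Distance from 1 gives
  \<open>L n \<le> C * rate (p n)\<close> and the lower bound \<open>h0\<close> for the rate;
  \<open>ln (1 / p) = o(ln n)\<close> gives \<open>1 / p \<le> n powr (\<nu> / 2)\<close> and lets
  the truncation tail \<open>r\<close> vanish.\<close>

lemma ER_TV_tendsto_0:
  fixes p s :: "nat \<Rightarrow> real"
  assumes m: "m \<ge> 2" and p: "\<And>n. 0 < p n \<and> p n < 1" and s: "\<And>n. 0 \<le> s n \<and> s n \<le> 1"
    and \<delta>: "\<delta> > 0" "\<And>n. p n \<le> 1 - \<delta>" and o: "(\<lambda>n. ln (1 / p n)) \<in> o(\<lambda>n. ln (real n))"
    and \<epsilon>: "0 < \<epsilon>" "\<epsilon> \<le> 1"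
    and less: "\<forall>\<^sub>F n in sequentially. (s n)\<^sup>2 < (1 - \<epsilon>) * ER_threshold m n (p n)"
  shows "(\<lambda>n. ER_TV m n (p n) (s n)) \<longlonglongrightarrow> 0"
proof -
  define L where "L n = ln (1 / p n)" for n
  define L0 where "L0 = ln (1 / (1 - \<delta>))"
  \<comment> \<open>\<open>rate_ge\<close> bounds \<open>L / rate\<close> by
    \<open>2 (1 + L) / L\<close>, which decreases in \<open>L\<close>, so its value at the lower
    bound \<open>L0\<close> of all \<open>L n\<close> serves.\<close>
  define C where "C = 2 * (1 + L0) / L0"
  define h0 where "h0 = L0 / C"
  define \<nu> where "\<nu> = min (1 / 32) (\<epsilon> / 4)"
  define a where "a = \<epsilon> / 4"
  \<comment> \<open>The largest value allowed by the two upper bounds on \<open>c\<close> in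
    \<open>truncation_tail_le\<close>.\<close>
  define c where "c = min (1 / 2) (a / (4 * C))"
  define M where "M = real m ^ m"
  define r where "r n = exp (1 - c * a / 2 * (ln n / L n))" for n :: nat
  \<comment> \<open>Both \<open>u\<close> and \<open>k0\<close> must dominate
    \<open>n powr (1 / 16)\<close>, while the squares of \<open>4 m^2 u\<close> and
    \<open>k0\<close> must stay below \<open>n powr (31 / 32)\<close>, the former by a vanishing
    factor.\<close>
  define u where "u n = nat \<lfloor>real n powr (1 / 4)\<rfloor>" for n :: nat
  define k0 where "k0 n = nat \<lceil>real n powr (1 / 8)\<rceil>" for n :: nat
  define V where "V n = exp ((4 * real m ^ 2 * n powr (1 / 4))\<^sup>2 * n powr - (31 / 32) + M\<^sup>2 * n powr - (29 / 32)) - 1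
    + exp (1 + 2 * m * M * n powr (1 / 16)) * (2 * m * n) * exp (1 - n powr (1 / 4))
    + n\<^sup>2 * exp (2 * m * M * n powr (1 / 16) - n powr (1 / 8))" for n :: nat
  have \<delta>1: "\<delta> < 1" using p[of 0] \<delta>(2)[of 0] by linarith
  have L0: "0 < L0" using \<delta>(1) \<delta>1 by (simp add: L0_def)
  have Lpos: "0 < L n" for n using p[of n] by (simp add: L_def)
  have C: "0 < C" using L0 by (simp add: C_def)
  have h0: "0 < h0" using L0 C by (simp add: h0_def)
  have LC: "L n \<le> C * rate (p n)" for n
  proof -
    have "1 / (1 - \<delta>) \<le> 1 / p n" using p[of n] \<delta>(2)[of n] \<delta>1 by (intro divide_left_mono) auto
    then have LL: "L0 \<le> L n" unfolding L0_def L_def using \<delta>1 by (intro ln_mono) auto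
    have "L n * (L0 * (1 + L n)) \<le> L n * (L n * (1 + L0))"
      using LL Lpos[of n] L0 by (intro mult_left_mono) (auto simp: algebra_simps)
    then have "L n \<le> L n * (L n * (1 + L0)) / (L0 * (1 + L n))"
      using L0 Lpos[of n] by (subst pos_le_divide_eq) auto
    moreover have "x * (x * y) / (l * z) = (2 * y / l) * (x\<^sup>2 / (2 * z))" for x y z l :: real
      by (simp add: power2_eq_square)
    ultimately have "L n \<le> C * ((L n)\<^sup>2 / (2 * (1 + L n)))" unfolding C_def by metis
    also have "C * ((L n)\<^sup>2 / (2 * (1 + L n))) \<le> C * rate (p n)"
      unfolding L_def using rate_ge[of "p n"] p[of n] C by (intro mult_left_mono) auto
    finally show ?thesis .
  qed
  have rate_h0: "h0 \<le> rate (p n)" for n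
  proof -
    have "1 / (1 - \<delta>) \<le> 1 / p n" using p[of n] \<delta>(2)[of n] \<delta>1 by (intro divide_left_mono) auto
    then have "L0 \<le> L n" unfolding L0_def L_def using \<delta>1 by (intro ln_mono) auto
    then have "L0 \<le> C * rate (p n)" using LC[of n] by linarith
    then show ?thesis using C by (simp add: h0_def field_simps)
  qed
  have \<nu>: "0 < \<nu>" "\<nu> \<le> \<epsilon> / 4" "\<nu> \<le> 1 / 32" using \<epsilon> by (auto simp: \<nu>_def)
  have a: "0 < a" using \<epsilon> by (simp add: a_def)
  have c: "0 < c" "c \<le> 1 / 2" "4 * C * c \<le> a"
  proof -
    show "0 < c" "c \<le> 1 / 2" using a C by (auto simp: c_def)
    have "4 * C * c \<le> 4 * C * (a / (4 * C))" using C by (intro mult_left_mono) (auto simp: c_def)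
    then show "4 * C * c \<le> a" using C by simp
  qed
  have M: "0 < M" using m by (simp add: M_def)
  have m0: "0 < real m" using m by simp
  have ratio: "filterlim (\<lambda>n. ln n / L n) at_top sequentially"
  proof -
    have "(\<lambda>n. L n / ln (real n)) \<longlonglongrightarrow> 0" using smalloD_tendsto[OF o] by (simp add: L_def)
    moreover have "\<forall>\<^sub>F n :: nat in sequentially. 1 < n" by (rule eventually_gt_at_top)
    then have "\<forall>\<^sub>F n :: nat in sequentially. 0 < L n / ln n"
      by eventually_elim (use Lpos in simp)
    ultimately have "filterlim (\<lambda>n. inverse (L n / ln n)) at_top sequentially"
      by (rule filterlim_inverse_at_top)
    then show ?thesis by simp
  qed
  have Kinf: "filterlim (\<lambda>n. c * a / 2 * (ln n / L n)) at_top sequentially"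
    using c a by (intro filterlim_tendsto_pos_mult_at_top[OF tendsto_const _ ratio]) simp
  have r0: "r \<longlonglongrightarrow> 0"
  proof -
    have "(\<lambda>n. exp (- (c * a / 2 * (ln n / L n)))) \<longlonglongrightarrow> 0"
      by (rule filterlim_compose[OF exp_at_bot Kinf[unfolded filterlim_uminus_at_top]])
    then have "(\<lambda>n. exp 1 * exp (- (c * a / 2 * (ln n / L n)))) \<longlonglongrightarrow> 0"
      by (rule tendsto_mult_right_zero)
    then show ?thesis unfolding r_def[abs_def] by (simp only: diff_conv_add_uminus exp_add)
  qed
  have V0: "V \<longlonglongrightarrow> 0"
    unfolding V_def[abs_def] using M m0 by real_asymp
  have lim: "(\<lambda>n. 2 * r n + sqrt (V n + 2 * (2 * r n))) \<longlonglongrightarrow> 0"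
    using r0 V0 by (auto intro!: tendsto_eq_intros)
  have ev_small: "\<forall>\<^sub>F n :: nat in sequentially. 1 \<le> real n powr (1 / 4) \<and> exp 2 \<le> real n powr (1 / 4) - 1 \<and>
     exp 3 \<le> real n powr (1 / 8) \<and> real n powr (1 / 8) + 1 \<le> n \<and> (real n powr (1 / 8) + 1)\<^sup>2 \<le> n powr (31 / 32)"
    by (intro eventually_conj; real_asymp)
  have ev_a: "\<forall>\<^sub>F n :: nat in sequentially. 4 * real m ^ 2 * real n powr (1 / 4) \<le> n"
    using m0 by real_asymp
  have ev_ln: "\<forall>\<^sub>F n :: nat in sequentially. 2 \<le> \<epsilon> / 4 * ln n"
    using \<epsilon>(1) by real_asymp
  have ev_lnh: "\<forall>\<^sub>F n :: nat in sequentially. ln n \<le> h0 * n powr (\<nu> / 2)"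
    using h0 \<nu>(1) by real_asymp
  have ev_s: "\<forall>\<^sub>F n :: nat in sequentially. real m ^ 2 * n powr - (31 / 32) \<le> (\<epsilon> * h0 / 12)\<^sup>2"
  proof -
    have "(\<lambda>n :: nat. real m ^ 2 * n powr - (31 / 32)) \<longlonglongrightarrow> 0" using m0 by real_asymp
    moreover have "0 < (\<epsilon> * h0 / 12)\<^sup>2" using \<epsilon> h0 by simp
    ultimately have "\<forall>\<^sub>F n in sequentially. real m ^ 2 * real n powr - (31 / 32) < (\<epsilon> * h0 / 12)\<^sup>2"
      by (rule order_tendstoD)
    then show ?thesis by eventually_elim simp
  qed
  have ev_L: "\<forall>\<^sub>F n :: nat in sequentially. L n \<le> \<nu> / 2 * ln n"
  proof -
    have "\<forall>\<^sub>F n in sequentially. norm (L n) \<le> \<nu> / 2 * norm (ln (real n))"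
      using landau_o.smallD[OF o, of "\<nu> / 2"] \<nu> by (simp add: L_def)
    then show ?thesis using eventually_gt_at_top[of 1]
      by eventually_elim (use Lpos in \<open>simp add: abs_of_pos\<close>)
  qed
  have ev_K: "\<forall>\<^sub>F n in sequentially. 1 \<le> c * a / 2 * (ln n / L n)"
    using Kinf by (simp add: filterlim_at_top)
  have ev_r: "\<forall>\<^sub>F n in sequentially. r n < 1 / 2"
    using r0 by (rule order_tendstoD) simp
  have "\<forall>\<^sub>F n in sequentially. ER_TV m n (p n) (s n) \<le> 2 * r n + sqrt (V n + 2 * (2 * r n))"
    using less ev_small ev_a ev_ln ev_lnh ev_s ev_L ev_K ev_r eventually_ge_at_top[of m]
  proof eventually_elim
    case (elim n)
    note less = elim(1) and small = elim(2) and big = elim(3) and ln = elim(4) and lnh = elim(5)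
      and ss = elim(6) and Lle = elim(7) and K = elim(8) and r = elim(9) and nm = elim(10)
    interpret ER_params "p n" "s n" using p[of n] s[of n] by unfold_locales auto
    define N where "N = real (n choose m)"
    define \<zeta> where "\<zeta> k = real (k choose m) * p n * (s n)\<^sup>2 + \<epsilon> / 4 * (k * ln n / L n)" for k
    have n1: "1 \<le> real n" "0 < real n" using nm m by auto
    have N: "0 < N" using nm by (simp add: N_def)
    have h: "0 < rate (p n)" using rate_pos p_pos p_less .
    have lnn: "0 \<le> real n * ln n" using n1 by simp
    have "(s n)\<^sup>2 \<le> (1 - \<epsilon>) * (n * ln n) / (N * rate (p n) * p n)"
      using less by (simp add: ER_threshold_def N_def rate_def)
    then have sp: "(n choose m) * p n * (s n)\<^sup>2 * rate (p n) \<le> (1 - \<epsilon>) * (n * ln n)"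
      using N h p_pos by (simp add: N_def field_simps)
    also have "\<dots> \<le> 1 * (n * ln n)" using \<epsilon> lnn by (intro mult_right_mono) auto
    finally have sp': "(n choose m) * p n * (s n)\<^sup>2 * rate (p n) \<le> n * ln n" by simp
    \<comment> \<open>Removing \<open>p\<close> and the rate from the threshold condition costs
      \<open>1 / p\<close> and \<open>1 / h0\<close>; \<open>1 / p\<close> and
      \<open>ln n / h0\<close> are at most \<open>n powr (\<nu> / 2)\<close> each.\<close>
    have sN: "(s n)\<^sup>2 * (n choose m) \<le> n powr (1 + \<nu>)"
    proof -
      have "1 / p n = exp (L n)" using p_pos by (simp add: L_def)
      also have "\<dots> \<le> n powr (\<nu> / 2)" using Lle n1 by (simp add: powr_def)
      finally have "1 \<le> p n * n powr (\<nu> / 2)" using p_pos by (simp add: field_simps)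
      then have "((s n)\<^sup>2 * N * h0) * 1 \<le> ((s n)\<^sup>2 * N * h0) * (p n * n powr (\<nu> / 2))"
        using N h0 by (intro mult_left_mono) auto
      also have "\<dots> = (N * p n * (s n)\<^sup>2 * h0) * n powr (\<nu> / 2)" by simp
      also have "\<dots> \<le> (N * p n * (s n)\<^sup>2 * rate (p n)) * n powr (\<nu> / 2)"
        using N p_pos rate_h0 by (intro mult_right_mono mult_left_mono) auto
      also have "\<dots> \<le> (n * ln n) * n powr (\<nu> / 2)" using sp' by (intro mult_right_mono) (auto simp: N_def)
      also have "\<dots> \<le> (n * (h0 * n powr (\<nu> / 2))) * n powr (\<nu> / 2)"
        using lnh n1 by (intro mult_right_mono mult_left_mono) auto
      also have "\<dots> = h0 * (n powr 1 * n powr (\<nu> / 2) * n powr (\<nu> / 2))" using n1 by simp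
      also have "n powr 1 * n powr (\<nu> / 2) * n powr (\<nu> / 2) = n powr (1 + \<nu>)" by (simp only: powr_add[symmetric]) (simp add: add.commute)
      finally have "h0 * ((s n)\<^sup>2 * N) \<le> h0 * n powr (1 + \<nu>)" by (simp add: mult_ac)
      then show ?thesis using h0 by (simp add: N_def)
    qed
    \<comment> \<open>For \<open>m \<ge> 2\<close>, \<open>n choose m\<close> is at least of order
      \<open>n^2\<close>, so \<open>sN\<close> makes \<open>s n\<close> small, whereas the rate
      stays above \<open>h0\<close>.\<close>
    have s3: "3 * s n \<le> \<epsilon> / 4 * rate (p n)"
    proof -
      have "(real n / m) ^ 2 \<le> (real n / m) ^ m"
        using nm m0 m by (intro power_increasing) (auto simp: field_simps)
      also have "\<dots> \<le> N" unfolding N_def using nm by (rule binomial_ge_n_over_k_pow_k)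
      finally have "(s n)\<^sup>2 * (real n / m)\<^sup>2 \<le> (s n)\<^sup>2 * N" by (rule mult_left_mono) simp
      also have "\<dots> \<le> n powr (1 + \<nu>)" using sN by (simp add: N_def)
      also have "\<dots> \<le> n powr (33 / 32)" using n1 \<nu> by (intro powr_mono) auto
      finally have "(s n)\<^sup>2 * n powr 2 \<le> real m ^ 2 * n powr (33 / 32)"
        using m0 n1 by (simp add: power_divide field_simps powr_realpow[of _ 2, simplified])
      then have "(s n)\<^sup>2 \<le> real m ^ 2 * n powr (33 / 32) / n powr 2"
        using n1 by (simp add: pos_le_divide_eq)
      also have "\<dots> = real m ^ 2 * n powr - (31 / 32)"
        unfolding times_divide_eq_right[symmetric] by (simp only: powr_diff[symmetric]) simp
      finally have "(s n)\<^sup>2 \<le> (\<epsilon> * h0 / 12)\<^sup>2" using ss by linarith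
      then have "s n \<le> \<epsilon> * h0 / 12" by (rule power2_le_imp_le) (use \<epsilon> h0 in auto)
      also have "\<dots> \<le> \<epsilon> * rate (p n) / 12" using \<epsilon> rate_h0 by (intro divide_right_mono mult_left_mono) auto
      finally show ?thesis by simp
    qed
    have u: "real (u n) \<le> n powr (1 / 4)" "n powr (1 / 4) - 1 \<le> real (u n)"
      unfolding u_def by (auto simp: of_nat_nat)
    have u1: "u n \<ge> 1" using small by (simp add: u_def le_nat_iff le_floor_iff)
    have k0: "n powr (1 / 8) \<le> real (k0 n)" "real (k0 n) \<le> n powr (1 / 8) + 1"
      unfolding k0_def by (auto simp: of_nat_nat)
    have k0pos: "exp 3 \<le> real (k0 n)" using small k0 by linarith
    then have k0pos': "0 < real (k0 n)" using exp_gt_zero[of "3 :: real"] by linarith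
    let ?a = "(2 * m) * ((2 * m) * u n)"
    have a_le: "real ?a \<le> 4 * real m ^ 2 * n powr (1 / 4)"
    proof -
      have "real ?a = 4 * real m ^ 2 * real (u n)" by (simp add: power2_eq_square)
      also have "\<dots> \<le> 4 * real m ^ 2 * n powr (1 / 4)" using u by (intro mult_left_mono) auto
      finally show ?thesis .
    qed
    have fact_u: "1 / fact (u n) \<le> exp (1 - n powr (1 / 4))"
    proof -
      have "exp 2 \<le> real (u n)" using small u by linarith
      then have "2 \<le> ln (u n)" using u1 by (subst ln_ge_iff) auto
      then have "real (u n) * 2 \<le> real (u n) * ln (u n)" by (intro mult_left_mono) auto
      then have "exp (n powr (1 / 4) - 1) \<le> exp (u n * ln (u n) - u n)" using u by simp
      also have "\<dots> \<le> fact (u n)" by (rule exp_le_fact)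
      finally have "1 / fact (u n) \<le> 1 / exp (n powr (1 / 4) - 1)" by (intro divide_left_mono) auto
      also have "\<dots> = exp (1 - n powr (1 / 4))" by (simp add: exp_diff)
      finally show ?thesis .
    qed
    have "(\<Sum>\<sigma> | \<sigma> permutes {1..n}. overlap_moment m n \<zeta> \<sigma>) / fact n \<le>
      exp (real ?a ^ 2 * n powr - (31 / 32) + M\<^sup>2 * n powr - (29 / 32))
      + exp (1 + 2 * m * M * n powr (1 / 16)) * (2 * m * n) / fact (u n)
      + n\<^sup>2 * exp (2 * m * M * n powr (1 / 16) - k0 n)"
      unfolding \<zeta>_def[abs_def] L_def M_def
    proof (rule overlap_average_le[OF m nm \<epsilon> sp s3 \<nu>(2,3) sN u1])
      show "?a \<le> n" using a_le big by linarith
      show "1 \<le> k0 n" using k0pos' by simp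
      show "3 \<le> ln (real (k0 n))" using k0pos k0pos' by (subst ln_ge_iff) auto
      show "k0 n \<le> n" using k0 small by linarith
      have "real (k0 n) ^ 2 \<le> (n powr (1 / 8) + 1)\<^sup>2" using k0 by (intro power_mono) auto
      then show "real (k0 n) ^ 2 \<le> n powr (31 / 32)" using small by linarith
      show "2 \<le> \<epsilon> / 4 * ln n" by (rule ln)
    qed
    also have "\<dots> \<le> exp ((4 * real m ^ 2 * n powr (1 / 4))\<^sup>2 * n powr - (31 / 32) + M\<^sup>2 * n powr - (29 / 32))
      + exp (1 + 2 * m * M * n powr (1 / 16)) * (2 * m * n) * exp (1 - n powr (1 / 4))
      + n\<^sup>2 * exp (2 * m * M * n powr (1 / 16) - n powr (1 / 8))"
    proof (intro add_mono)
      show "exp (real ?a ^ 2 * n powr - (31 / 32) + M\<^sup>2 * n powr - (29 / 32)) \<le>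
        exp ((4 * real m ^ 2 * n powr (1 / 4))\<^sup>2 * n powr - (31 / 32) + M\<^sup>2 * n powr - (29 / 32))"
        unfolding exp_le_cancel_iff using a_le M by (intro add_mono mult_right_mono power_mono) auto
      have "exp (1 + 2 * m * M * n powr (1 / 16)) * (2 * m * n) * (1 / fact (u n)) \<le>
        exp (1 + 2 * m * M * n powr (1 / 16)) * (2 * m * n) * exp (1 - n powr (1 / 4))"
        by (intro mult_left_mono fact_u) auto
      then show "exp (1 + 2 * m * M * n powr (1 / 16)) * (2 * m * n) / fact (u n) \<le>
        exp (1 + 2 * m * M * n powr (1 / 16)) * (2 * m * n) * exp (1 - n powr (1 / 4))" by simp
      show "n\<^sup>2 * exp (2 * m * M * n powr (1 / 16) - k0 n) \<le> n\<^sup>2 * exp (2 * m * M * n powr (1 / 16) - n powr (1 / 8))"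
        using k0 by (intro mult_left_mono) auto
    qed
    also have "\<dots> = 1 + V n" by (simp add: V_def)
    finally have var: "(\<Sum>\<sigma> | \<sigma> permutes {1..n}. overlap_moment m n \<zeta> \<sigma>) / fact n \<le> 1 + V n" .
    have lost: "measure_pmf.prob (ER_alt_given m n (p n) (s n) \<pi>) (- sparse_overlap m n \<zeta> \<pi>) \<le> 2 * r n"
      if \<pi>: "\<pi> permutes {1..n}" for \<pi>
    proof (rule prob_not_sparse_overlap_le[OF \<pi>, where \<theta> = "\<lambda>k. c * (1 + ln (n / k))"])
      show "1 \<le> m" "0 \<le> r n" "r n \<le> 1 / 2" using m r by (auto simp: r_def)
      show "0 \<le> \<zeta> 0" using p_pos by (simp add: \<zeta>_def)
      fix k assume k: "k \<in> {1..n}"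
      then show "0 \<le> c * (1 + ln (n / k))" using c by (intro mult_nonneg_nonneg add_nonneg_nonneg) auto
      show "(n choose k) * exp (- (c * (1 + ln (n / k))) * \<zeta> k +
          real (k choose m) * p n * (s n)\<^sup>2 * (exp (c * (1 + ln (n / k))) - 1)) \<le> r n ^ k"
        unfolding r_def \<zeta>_def a_def[symmetric] L_def
        by (rule truncation_tail_le[OF k m _ _ sp' c])
          (use C LC[of n] K in \<open>auto simp: L_def\<close>)
    qed
    show ?case by (rule ER_TV_le_truncated[OF lost var])
  qed
  then show ?thesis
    by (intro tendsto_sandwich[OF _ _ tendsto_const lim]) (auto simp: ER_TV_def TV_nonneg)
qed

theorem theorem3p1:
  fixes m :: nat and p s :: "nat \<Rightarrow> real"
  assumes "m \<ge> 2"
    and "\<And>n. 0 < p n \<and> p n < 1"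
    and "\<And>n. 0 \<le> s n \<and> s n \<le> 1"
  shows
    "((\<forall>\<^sub>F n in sequentially. (s n)\<^sup>2 \<ge> ER_threshold m n (p n))
        \<longrightarrow> (\<lambda>n. ER_TV m n (p n) (s n)) \<longlonglongrightarrow> 1)
     \<and>
     ((\<exists>\<delta>>0. \<forall>n. p n \<le> 1 - \<delta>) \<and> (\<lambda>n. ln (1 / p n)) \<in> o(\<lambda>n. ln (real n))
        \<longrightarrow> (\<forall>\<epsilon>>0. (\<forall>\<^sub>F n in sequentially. (s n)\<^sup>2 < (1 - \<epsilon>) * ER_threshold m n (p n))
              \<longrightarrow> (\<lambda>n. ER_TV m n (p n) (s n)) \<longlonglongrightarrow> 0))"
proof (intro conjI impI allI)
  assume "\<forall>\<^sub>F n in sequentially. ER_threshold m n (p n) \<le> (s n)\<^sup>2"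
  then show "(\<lambda>n. ER_TV m n (p n) (s n)) \<longlonglongrightarrow> 1"
    using assms by (intro ER_TV_tendsto_1) auto
next
  fix \<epsilon> :: real
  assume "(\<exists>\<delta>>0. \<forall>n. p n \<le> 1 - \<delta>) \<and> (\<lambda>n. ln (1 / p n)) \<in> o(\<lambda>n. ln (real n))"
  then obtain \<delta> where \<delta>: "\<delta> > 0" "\<And>n. p n \<le> 1 - \<delta>" and o: "(\<lambda>n. ln (1 / p n)) \<in> o(\<lambda>n. ln (real n))"
    by blast
  assume \<epsilon>: "0 < \<epsilon>" and less: "\<forall>\<^sub>F n in sequentially. (s n)\<^sup>2 < (1 - \<epsilon>) * ER_threshold m n (p n)"
  \<comment> \<open>An \<open>\<epsilon>\<close> above 1 is replaced by 1, which only weakens the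
    inequality because the threshold is nonnegative.\<close>
  have "\<forall>\<^sub>F n in sequentially. (s n)\<^sup>2 < (1 - min \<epsilon> 1) * ER_threshold m n (p n)"
    using less eventually_ge_at_top[of 1]
  proof eventually_elim
    case (elim n)
    have "0 < rate (p n)" using rate_pos assms(2) by blast
    then have "0 \<le> ER_threshold m n (p n)"
      using elim(2) assms(2)[of n] by (auto simp: ER_threshold_def rate_def intro!: divide_nonneg_nonneg)
    then have "(1 - \<epsilon>) * ER_threshold m n (p n) \<le> (1 - min \<epsilon> 1) * ER_threshold m n (p n)"
      by (intro mult_right_mono) auto
    with elim(1) show ?case by linarith
  qed
  then show "(\<lambda>n. ER_TV m n (p n) (s n)) \<longlonglongrightarrow> 0"
    using \<epsilon> by (intro ER_TV_tendsto_0[OF assms(1) assms(2) assms(3) \<delta> o, of "min \<epsilon> 1"]) auto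
qed

end
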